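(* Let $R$ be a finite commutative ring. For $n\ge1$ let $d_n=\operatorname{rk}\mathrm{St}_n(R)$, and set $d_0=1$. Then for all $n\ge1$, $$d_n=\sum_{i=1}^n(-1)^{i-1}\,\bigl|\mathrm{Gr}^n_{n-i}(R)\bigr|\,d_{n-i}.$$
   Context: A flag in $R^n$ is a chain $0\subsetneq V_1\subsetneq\cdots\subsetneq V_k\subsetneq R^n$ of free direct summands; complete if $k=n-1$, good if it is a subflag of a complete flag. The Tits complex $\mathcal{T}_n(R)$ has as vertices the direct summands $V$ of $R^n$, $0\ne V\ne R^n$, with $V$ and $R^n/V$ free, and a $k$-simplex for every good flag with $k+1$ terms. $\mathrm{St}_n(R)=\tilde H_{n-2}(\mathcal{T}_n(R);\mathbb{Z})$ (a free abelian group; note $\mathrm{St}_1(R)=\tilde H_{-1}(\emptyset)\cong\mathbb{Z}$). For $n\ge k\ge0$, the Grassmannian $\mathrm{Gr}^n_k(R)$ is the set of rank $k$ direct summands $V$ of $R^n$ such that $V$ and $R^n/V$ are free; $|\mathrm{Gr}^n_0(R)|=1$. *)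

theory Defs
  imports Main
begin

text \<open>Elements of R^n are modelled as functions nat => R vanishing from index n on.\<close>

definition vecs :: "nat \<Rightarrow> (nat \<Rightarrow> 'a::comm_ring_1) set" where
  "vecs n = {v. \<forall>i\<ge>n. v i = 0}"

definition zvec :: "nat \<Rightarrow> 'a::comm_ring_1" where
  "zvec = (\<lambda>_. 0)"

definition lincomb :: "nat \<Rightarrow> (nat \<Rightarrow> nat \<Rightarrow> 'a::comm_ring_1) \<Rightarrow> (nat \<Rightarrow> 'a) \<Rightarrow> (nat \<Rightarrow> 'a)" where
  "lincomb k b c = (\<lambda>j. \<Sum>i<k. c i * b i j)"

definition submodule :: "nat \<Rightarrow> (nat \<Rightarrow> 'a::comm_ring_1) set \<Rightarrow> bool" where
  "submodule n V \<longleftrightarrow> V \<subseteq> vecs n \<and> zvec \<in> V \<and>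
     (\<forall>v\<in>V. \<forall>w\<in>V. (\<lambda>j. v j + w j) \<in> V) \<and>
     (\<forall>r. \<forall>v\<in>V. (\<lambda>j. r * v j) \<in> V)"

definition direct_summand :: "nat \<Rightarrow> (nat \<Rightarrow> 'a::comm_ring_1) set \<Rightarrow> bool" where
  "direct_summand n V \<longleftrightarrow> submodule n V \<and>
     (\<exists>W. submodule n W \<and> V \<inter> W = {zvec} \<and>
          (\<forall>x\<in>vecs n. \<exists>v\<in>V. \<exists>w\<in>W. x = (\<lambda>j. v j + w j)))"

definition free_of_rank :: "nat \<Rightarrow> (nat \<Rightarrow> 'a::comm_ring_1) set \<Rightarrow> nat \<Rightarrow> bool" where
  "free_of_rank n V k \<longleftrightarrow> (\<exists>b. (\<forall>i<k. b i \<in> V) \<and>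
       V = {lincomb k b c | c. True} \<and>
       (\<forall>c. lincomb k b c = zvec \<longrightarrow> (\<forall>i<k. c i = 0)))"

definition free_mod :: "nat \<Rightarrow> (nat \<Rightarrow> 'a::comm_ring_1) set \<Rightarrow> bool" where
  "free_mod n V \<longleftrightarrow> (\<exists>k. free_of_rank n V k)"

text \<open>R^n / V is free: there are w_0, ..., w_(m-1) in R^n whose classes form a basis of R^n/V.\<close>
definition quotient_free :: "nat \<Rightarrow> (nat \<Rightarrow> 'a::comm_ring_1) set \<Rightarrow> bool" where
  "quotient_free n V \<longleftrightarrow> (\<exists>m w. (\<forall>i<m. w i \<in> vecs n) \<and>
       (\<forall>x\<in>vecs n. \<exists>c. \<exists>v\<in>V. x = (\<lambda>j. lincomb m w c j + v j)) \<and>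
       (\<forall>c. lincomb m w c \<in> V \<longrightarrow> (\<forall>i<m. c i = 0)))"

definition grassmannian :: "nat \<Rightarrow> nat \<Rightarrow> (nat \<Rightarrow> 'a::comm_ring_1) set set" where
  "grassmannian n k = {V. direct_summand n V \<and> free_of_rank n V k \<and> quotient_free n V}"

definition tits_vertices :: "nat \<Rightarrow> (nat \<Rightarrow> 'a::comm_ring_1) set set" where
  "tits_vertices n = {V. direct_summand n V \<and> V \<noteq> {zvec} \<and> V \<noteq> vecs n \<and>
                         free_mod n V \<and> quotient_free n V}"

text \<open>A flag 0 < V_1 < ... < V_k < R^n of free direct summands, recorded as the
  (finite, totally ordered by inclusion) set of its terms.\<close>
definition is_flag :: "nat \<Rightarrow> (nat \<Rightarrow> 'a::comm_ring_1) set set \<Rightarrow> bool" where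
  "is_flag n F \<longleftrightarrow> finite F \<and>
     (\<forall>V\<in>F. direct_summand n V \<and> free_mod n V \<and> V \<noteq> {zvec} \<and> V \<noteq> vecs n) \<and>
     (\<forall>V\<in>F. \<forall>W\<in>F. V \<subseteq> W \<or> W \<subseteq> V)"

definition complete_flag :: "nat \<Rightarrow> (nat \<Rightarrow> 'a::comm_ring_1) set set \<Rightarrow> bool" where
  "complete_flag n F \<longleftrightarrow> is_flag n F \<and> card F = n - 1"

definition good_flag :: "nat \<Rightarrow> (nat \<Rightarrow> 'a::comm_ring_1) set set \<Rightarrow> bool" where
  "good_flag n F \<longleftrightarrow> is_flag n F \<and> (\<exists>G. complete_flag n G \<and> F \<subseteq> G)"

text \<open>Simplices of the Tits complex, as sets of vertices; the empty flag gives the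
  (-1)-simplex of the augmented chain complex (used for reduced homology).\<close>
definition tits_simplices :: "nat \<Rightarrow> (nat \<Rightarrow> 'a::comm_ring_1) set set set" where
  "tits_simplices n = {F. good_flag n F \<and> F \<subseteq> tits_vertices n}"

definition chains :: "'b set set set \<Rightarrow> nat \<Rightarrow> ('b set set \<Rightarrow> int) set" where
  "chains S m = {c. \<forall>\<sigma>. c \<sigma> \<noteq> 0 \<longrightarrow> \<sigma> \<in> S \<and> card \<sigma> = m}"

text \<open>Boundary: the vertices of a simplex are ordered by inclusion; deleting the
  vertex v carries sign (-1)^(number of vertices strictly below v).\<close>
definition bdry :: "'b set set set \<Rightarrow> ('b set set \<Rightarrow> int) \<Rightarrow> ('b set set \<Rightarrow> int)" where
  "bdry S c = (\<lambda>\<tau>. \<Sum>\<sigma>\<in>{\<sigma>\<in>S. \<tau> \<subseteq> \<sigma> \<and> card \<sigma> = Suc (card \<tau>)}.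
       (-1) ^ card {w\<in>\<sigma>. w \<subset> the_elem (\<sigma> - \<tau>)} * c \<sigma>)"

definition cycles :: "'b set set set \<Rightarrow> nat \<Rightarrow> ('b set set \<Rightarrow> int) set" where
  "cycles S m = {c\<in>chains S m. bdry S c = (\<lambda>_. 0)}"

definition boundaries :: "'b set set set \<Rightarrow> nat \<Rightarrow> ('b set set \<Rightarrow> int) set" where
  "boundaries S m = bdry S ` chains S (Suc m)"

text \<open>Rank of the reduced homology group in the degree of simplices with m vertices
  (degree m-1): the maximal number of cycles that are Z-linearly independent modulo
  boundaries (= rank of the abelian group cycles/boundaries).\<close>
definition homology_rank :: "'b set set set \<Rightarrow> nat \<Rightarrow> nat" where
  "homology_rank S m = Sup {card A | A. finite A \<and> A \<subseteq> cycles S m \<and>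
      (\<forall>a :: ('b set set \<Rightarrow> int) \<Rightarrow> int.
          (\<lambda>\<tau>. \<Sum>x\<in>A. a x * x \<tau>) \<in> boundaries S m \<longrightarrow> (\<forall>x\<in>A. a x = 0))}"

text \<open>rk St_n(R) = rk of reduced H_(n-2) of T_n(R), i.e. simplices with n-1 vertices.\<close>
definition steinberg_rank :: "'a::comm_ring_1 itself \<Rightarrow> nat \<Rightarrow> nat" where
  "steinberg_rank _ n = homology_rank (tits_simplices n :: (nat \<Rightarrow> 'a) set set set) (n - 1)"

definition d_seq :: "'a::comm_ring_1 itself \<Rightarrow> nat \<Rightarrow> nat" where
  "d_seq T n = (if n = 0 then 1 else steinberg_rank T n)"

end

theory Submission
  imports Complex_Main Defs "HOL-Library.Function_Algebras" "HOL-Library.FuncSet"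
begin

text \<open>
  The Tits complex is the order complex of the poset of proper nonzero summands with free quotient.
  Once its reduced homology is known to vanish below the top degree \<open>n - 2\<close>, its Euler
  characteristic computes \<open>d\<^sub>n\<close> up to sign, and sorting the chains of summands by their
  largest term gives the recursion.

  For the vanishing, let \<open>X(A, B, e)\<close> be the poset of summands strictly between \<open>A\<close> and
  \<open>B\<close> which, modulo each maximal ideal \<open>I\<close> of the ring, avoid a given vector \<open>e I\<close>.
  Choose \<open>v \<in> B\<close> in general position with respect to \<open>A\<close> and \<open>e\<close>. The summands
  \<open>W\<close> for which \<open>W + Rv\<close> again lies in \<open>X(A, B, e)\<close> form a contractible subposet, by
  \<open>W \<le> W + Rv \<ge> A + Rv\<close>. The remaining \<open>W\<close> are added in order of decreasing rank,
  and the link of such a \<open>W\<close> is the join of posets \<open>X(A, W, e')\<close> and \<open>X(W, B, e)\<close> of the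
  same kind, for a suitable \<open>e'\<close>, so induction on the rank of \<open>B / A\<close> applies.
  Finiteness of the ring enters through its stable range 1, which makes all subquotients
  that occur free.
\<close>

section \<open>Homology of order complexes\<close>

text \<open>The vectors \<open>e\<close> are forced by the induction. Below an added W lie those w
  for which, modulo each I, v stays outside w and \<open>e I\<close> outside w + Rv; this is no
  longer a full interval. Inside W the two conditions merge into one avoided vector, but which one
  depends on the position of v relative to W modulo I, so a separate vector is kept for each maximal
  ideal. A vector outside the ambient module imposes nothing and gives back the full interval.

  General position needs only two independent directions in B / A: modulo I, \<open>e I\<close>
  cannot lie on both lines. The choices are glued by the Chinese remainder theorem, so residue
  fields with two elements cause no trouble.

  Stable range 1 gives cancellation (stably free modules are free). Hence a subquotient of two
  nested summands with free quotient is free, chains refine to complete flags, and the Tits complex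
  is a full order complex.

  In the Euler characteristic, the terms below a summand of rank m form a copy of the Tits poset of
  R^m. The empty chain contributes the constant 1, which is the term of the recursion with
  \<open>d_0 = 1\<close>.\<close>

definition order_complex :: "'b set set \<Rightarrow> 'b set set set" where
  "order_complex P = {\<sigma>. \<sigma> \<subseteq> P \<and> (\<forall>v\<in>\<sigma>. \<forall>w\<in>\<sigma>. v \<subseteq> w \<or> w \<subseteq> v)}"

definition supported :: "'b set set \<Rightarrow> ('b set set \<Rightarrow> int) \<Rightarrow> bool" where
  "supported P c \<longleftrightarrow> (\<forall>\<sigma>. c \<sigma> \<noteq> 0 \<longrightarrow> \<sigma> \<in> order_complex P)"

definition vsgn :: "'b set \<Rightarrow> 'b set set \<Rightarrow> int" where
  "vsgn x \<tau> = (-1) ^ card {w\<in>\<tau>. w \<subset> x}"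

definition cone :: "'b set \<Rightarrow> ('b set set \<Rightarrow> int) \<Rightarrow> ('b set set \<Rightarrow> int)" where
  "cone a b = (\<lambda>\<sigma>. if a \<in> \<sigma> then vsgn a \<sigma> * b (\<sigma> - {a}) else 0)"

text \<open>The sum runs over every vertex of \<open>P\<close> outside the simplex, whether or not
  the enlarged set is a chain, because a supported \<open>c\<close> vanishes on non-chains. The
  boundary is then unchanged when \<open>P\<close> grows (\<open>poset_bdry_mono\<close>), so pieces
  living on a subposet or a link can be added up in one complex.\<close>

definition poset_bdry :: "'b set set \<Rightarrow> ('b set set \<Rightarrow> int) \<Rightarrow> ('b set set \<Rightarrow> int)" where
  "poset_bdry P c = (\<lambda>\<tau>. \<Sum>x\<in>P - \<tau>. vsgn x \<tau> * c (insert x \<tau>))"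

lemma vsgn_square [simp]: "vsgn x \<tau> * vsgn x \<tau> = 1"
  unfolding vsgn_def by simp

lemma vsgn_square' [simp]: "vsgn x \<tau> * (vsgn x \<tau> * z) = z"
  by (metis vsgn_square mult.assoc mult_1)

lemma vsgn_insert_self: "vsgn x (insert x \<tau>) = vsgn x \<tau>"
  unfolding vsgn_def by (rule arg_cong[where f = "\<lambda>A. (-1) ^ card A"]) auto

lemma vsgn_Diff_self: "vsgn x (\<tau> - {x}) = vsgn x \<tau>"
  unfolding vsgn_def by (rule arg_cong[where f = "\<lambda>A. (-1) ^ card A"]) auto

lemma vsgn_insert:
  assumes "finite \<tau>" "y \<notin> \<tau>"
  shows "vsgn x (insert y \<tau>) = (if y \<subset> x then - vsgn x \<tau> else vsgn x \<tau>)"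
proof -
  have "{w \<in> insert y \<tau>. w \<subset> x} = (if y \<subset> x then insert y {w\<in>\<tau>. w \<subset> x} else {w\<in>\<tau>. w \<subset> x})"
    by auto
  then show ?thesis using assms unfolding vsgn_def by (auto simp: card_insert_if)
qed

lemma order_complex_mono: "P \<subseteq> Q \<Longrightarrow> order_complex P \<subseteq> order_complex Q"
  unfolding order_complex_def by auto

lemma order_complex_finite: "finite P \<Longrightarrow> \<sigma> \<in> order_complex P \<Longrightarrow> finite \<sigma>"
  unfolding order_complex_def by (auto intro: finite_subset)

lemma finite_order_complex: "finite P \<Longrightarrow> finite (order_complex P)"
  unfolding order_complex_def by (rule finite_subset[of _ "Pow P"]) auto

lemma order_complex_subset: "\<sigma> \<in> order_complex P \<Longrightarrow> \<tau> \<subseteq> \<sigma> \<Longrightarrow> \<tau> \<in> order_complex P"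
  unfolding order_complex_def by blast

lemma bdry_eq_poset_bdry:
  assumes P: "finite P" and c: "supported P c"
  shows "bdry (order_complex P) c = poset_bdry P c"
proof
  fix \<tau>
  let ?U = "{\<sigma> \<in> order_complex P. \<tau> \<subseteq> \<sigma> \<and> card \<sigma> = Suc (card \<tau>)}"
  let ?X = "{x \<in> P - \<tau>. insert x \<tau> \<in> order_complex P}"
  have inj: "inj_on (\<lambda>x. insert x \<tau>) ?X" by (auto simp: inj_on_def)
  have img: "?U = (\<lambda>x. insert x \<tau>) ` ?X"
  proof
    show "?U \<subseteq> (\<lambda>x. insert x \<tau>) ` ?X"
    proof
      fix \<sigma> assume s: "\<sigma> \<in> ?U"
      then have f: "finite \<sigma>" using P order_complex_finite by auto
      then have ft: "finite \<tau>" using s finite_subset by blast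
      have "card (\<sigma> - \<tau>) = 1" using s f ft by (simp add: card_Diff_subset)
      then obtain x where "\<sigma> - \<tau> = {x}" by (auto simp: card_1_singleton_iff)
      then have "\<sigma> = insert x \<tau>" "x \<notin> \<tau>" using s by auto
      then show "\<sigma> \<in> (\<lambda>x. insert x \<tau>) ` ?X" using s by (auto simp: order_complex_def)
    qed
    show "(\<lambda>x. insert x \<tau>) ` ?X \<subseteq> ?U"
    proof (rule image_subsetI)
      fix x assume x: "x \<in> ?X"
      then have "finite \<tau>" using order_complex_finite[OF P, of "insert x \<tau>"] by auto
      then show "insert x \<tau> \<in> ?U" using x by auto
    qed
  qed
  have el: "the_elem (insert x \<tau> - \<tau>) = x" if "x \<in> ?X" for x
    using that by (simp add: insert_Diff_if)
  have "bdry (order_complex P) c \<tau> = (\<Sum>x\<in>?X. vsgn x \<tau> * c (insert x \<tau>))"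
    unfolding bdry_def img sum.reindex[OF inj] o_def
    by (rule sum.cong) (simp_all only: el vsgn_def[symmetric] vsgn_insert_self)
  also have "\<dots> = poset_bdry P c \<tau>"
    unfolding poset_bdry_def using P c by (intro sum.mono_neutral_left) (auto simp: supported_def)
  finally show "bdry (order_complex P) c \<tau> = poset_bdry P c \<tau>" .
qed

lemma poset_bdry_mono:
  assumes "finite Q" "P \<subseteq> Q" "supported P c" shows "poset_bdry Q c = poset_bdry P c"
proof
  fix \<tau>
  have "c (insert x \<tau>) = 0" if "x \<notin> P" for x
    using that assms(3) unfolding supported_def order_complex_def by blast
  then show "poset_bdry Q c \<tau> = poset_bdry P c \<tau>"
    unfolding poset_bdry_def using assms by (intro sum.mono_neutral_right) auto
qed

lemma poset_bdry_add: "poset_bdry P (\<lambda>\<sigma>. b \<sigma> + c \<sigma>) = (\<lambda>\<sigma>. poset_bdry P b \<sigma> + poset_bdry P c \<sigma>)"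
  unfolding poset_bdry_def by (simp add: algebra_simps sum.distrib)

lemma poset_bdry_diff: "poset_bdry P (\<lambda>\<sigma>. b \<sigma> - c \<sigma>) = (\<lambda>\<sigma>. poset_bdry P b \<sigma> - poset_bdry P c \<sigma>)"
  unfolding poset_bdry_def by (simp add: algebra_simps sum_subtractf)

lemma supported_poset_bdry:
  assumes "supported P c" shows "supported P (poset_bdry P c)"
  unfolding supported_def
proof (intro allI impI)
  fix \<tau> assume "poset_bdry P c \<tau> \<noteq> 0"
  then obtain x where "c (insert x \<tau>) \<noteq> 0" unfolding poset_bdry_def
    by (metis (no_types, lifting) mult_zero_right sum.neutral)
  then show "\<tau> \<in> order_complex P" using assms order_complex_subset
    unfolding supported_def by blast
qed

section \<open>Decomposition of a chain at one vertex\<close>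

definition link :: "'b set set \<Rightarrow> 'b set \<Rightarrow> 'b set set" where
  "link Q a = {w\<in>Q. w \<subset> a \<or> a \<subset> w}"

lemma link_mono_insert: "link Q a \<subseteq> insert a Q" by (auto simp: link_def)

lemma insert_order_complex_link:
  "\<sigma> \<in> order_complex (link Q a) \<Longrightarrow> insert a \<sigma> \<in> order_complex (insert a Q)"
  unfolding order_complex_def link_def by auto

text \<open>On a simplex without \<open>a\<close> only the insertion of \<open>a\<close>
  contributes, and it returns \<open>b\<close>. On a simplex through \<open>a\<close>, an inserted
  vertex x lies in the link, so exactly one of x < a and a < x holds; hence exactly one of the two
  signs flips when the order of inserting x and \<open>a\<close> is exchanged.\<close>

lemma poset_bdry_cone:
  assumes P: "finite Q" and b: "supported (link Q a) b"
  shows "poset_bdry (insert a Q) (cone a b) = (\<lambda>\<tau>. b \<tau> - cone a (poset_bdry (insert a Q) b) \<tau>)"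
proof
  fix \<tau>
  let ?P = "insert a Q"
  have b0: "b \<sigma> = 0" if "a \<in> \<sigma>" for \<sigma>
    using that b unfolding supported_def order_complex_def link_def by blast
  have bf: "finite \<sigma>" if "b \<sigma> \<noteq> 0" for \<sigma>
    using that b P unfolding supported_def
    by (meson finite_subset link_mono_insert order_complex_finite finite_insert)
  show "poset_bdry ?P (cone a b) \<tau> = b \<tau> - cone a (poset_bdry ?P b) \<tau>"
  proof (cases "a \<in> \<tau>")
    case False
    have "poset_bdry ?P (cone a b) \<tau> = (\<Sum>x\<in>{a}. vsgn x \<tau> * cone a b (insert x \<tau>))"
      unfolding poset_bdry_def using P False
      by (intro sum.mono_neutral_right) (auto simp: cone_def)
    also have "\<dots> = b \<tau>" using False by (simp add: cone_def vsgn_insert_self)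
    finally show ?thesis using False by (simp add: cone_def)
  next
    case True
    have eq: "vsgn x \<tau> * cone a b (insert x \<tau>)
        = - (vsgn a \<tau> * (vsgn x (\<tau> - {a}) * b (insert x (\<tau> - {a}))))" if x: "x \<in> ?P - \<tau>" for x
    proof (cases "b (insert x (\<tau> - {a})) = 0")
      case True
      moreover have "insert x \<tau> - {a} = insert x (\<tau> - {a})" using x \<open>a \<in> \<tau>\<close> by auto
      ultimately show ?thesis by (simp add: cone_def)
    next
      case False
      have e: "insert x \<tau> - {a} = insert x (\<tau> - {a})" using x \<open>a \<in> \<tau>\<close> by auto
      have f: "finite (\<tau> - {a})" "finite \<tau>" using bf[OF False] by auto
      have "x \<in> link Q a" using False b unfolding supported_def order_complex_def by blast
      then have cmp: "(x \<subset> a \<and> \<not> a \<subset> x) \<or> (a \<subset> x \<and> \<not> x \<subset> a)" by (auto simp: link_def)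
      have 1: "vsgn x \<tau> = (if a \<subset> x then - vsgn x (\<tau> - {a}) else vsgn x (\<tau> - {a}))"
        using vsgn_insert[OF f(1), of a x] True by (simp add: insert_absorb)
      have 2: "vsgn a (insert x \<tau>) = (if x \<subset> a then - vsgn a \<tau> else vsgn a \<tau>)"
        using vsgn_insert[OF f(2), of x a] x by simp
      have 3: "cone a b (insert x \<tau>) = vsgn a (insert x \<tau>) * b (insert x (\<tau> - {a}))"
        using True by (simp add: cone_def e)
      from cmp show ?thesis by (elim disjE conjE) (simp_all only: 1 2 3 if_True if_False, simp_all)
    qed
    have "poset_bdry ?P (cone a b) \<tau> = (\<Sum>x\<in>?P - \<tau>. - (vsgn a \<tau> * (vsgn x (\<tau> - {a}) * b (insert x (\<tau> - {a})))))"
      unfolding poset_bdry_def by (rule sum.cong[OF refl eq])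
    also have "\<dots> = - vsgn a \<tau> * (\<Sum>x\<in>?P - \<tau>. vsgn x (\<tau> - {a}) * b (insert x (\<tau> - {a})))"
      by (simp add: sum_distrib_left sum_negf)
    \<comment> \<open>The index set grows by the vertex \<open>a\<close> only, where
      \<open>b\<close> vanishes.\<close>
    also have "(\<Sum>x\<in>?P - \<tau>. vsgn x (\<tau> - {a}) * b (insert x (\<tau> - {a})))
        = poset_bdry ?P b (\<tau> - {a})"
      unfolding poset_bdry_def using P True b0 by (intro sum.mono_neutral_left) auto
    finally show ?thesis using True by (simp add: cone_def b0)
  qed
qed

text \<open>The sign is the one used by \<open>cone\<close>, so coning off restores the simplices
  through \<open>a\<close>; \<open>rest_part\<close> keeps the others.\<close>

definition link_part :: "'b set \<Rightarrow> ('b set set \<Rightarrow> int) \<Rightarrow> ('b set set \<Rightarrow> int)" where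
  "link_part a c = (\<lambda>\<tau>. if a \<in> \<tau> then 0 else vsgn a \<tau> * c (insert a \<tau>))"

definition rest_part :: "'b set \<Rightarrow> ('b set set \<Rightarrow> int) \<Rightarrow> ('b set set \<Rightarrow> int)" where
  "rest_part a c = (\<lambda>\<tau>. if a \<in> \<tau> then 0 else c \<tau>)"

lemma cone_link_rest: "c = (\<lambda>\<sigma>. cone a (link_part a c) \<sigma> + rest_part a c \<sigma>)"
  by (auto simp: fun_eq_iff cone_def link_part_def rest_part_def vsgn_Diff_self insert_absorb)

lemma supported_link_part:
  assumes "supported (insert a Q) c" shows "supported (link Q a) (link_part a c)"
  unfolding supported_def
proof (intro allI impI)
  fix \<sigma> assume "link_part a c \<sigma> \<noteq> 0"
  then have "a \<notin> \<sigma>" "insert a \<sigma> \<in> order_complex (insert a Q)"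
    using assms by (auto simp: link_part_def supported_def split: if_splits)
  then show "\<sigma> \<in> order_complex (link Q a)" unfolding order_complex_def link_def by blast
qed

lemma supported_rest_part:
  assumes "supported (insert a Q) c" shows "supported Q (rest_part a c)"
  using assms unfolding supported_def rest_part_def order_complex_def by auto

lemma supported_cone:
  assumes "supported (link Q a) b" shows "supported (insert a Q) (cone a b)"
  unfolding supported_def
proof (intro allI impI)
  fix \<sigma> assume "cone a b \<sigma> \<noteq> 0"
  then have "a \<in> \<sigma>" "\<sigma> - {a} \<in> order_complex (link Q a)"
    using assms by (auto simp: cone_def supported_def split: if_splits)
  then show "\<sigma> \<in> order_complex (insert a Q)"
    using insert_order_complex_link[of "\<sigma> - {a}" Q a] by (simp add: insert_absorb)
qed

lemma poset_bdry_decompose: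
  assumes "finite Q" "supported (insert a Q) c"
  shows "poset_bdry (insert a Q) c = (\<lambda>\<tau>. link_part a c \<tau> - cone a (poset_bdry (link Q a) (link_part a c)) \<tau>
      + poset_bdry Q (rest_part a c) \<tau>)"
proof -
  note s = supported_link_part[OF assms(2)] supported_rest_part[OF assms(2)]
  have "poset_bdry (insert a Q) c = (\<lambda>\<tau>. poset_bdry (insert a Q) (cone a (link_part a c)) \<tau> + poset_bdry (insert a Q) (rest_part a c) \<tau>)"
    by (subst cone_link_rest[of c a]) (rule poset_bdry_add)
  then show ?thesis
    using poset_bdry_cone[OF assms(1) s(1)] poset_bdry_mono[OF _ link_mono_insert s(1)] poset_bdry_mono[OF _ subset_insertI s(2)] assms(1)
    by simp
qed

text \<open>Induction on the number of vertices: by the decomposition at \<open>a\<close>, the two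
  squares on the link and on \<open>Q\<close> vanish by hypothesis, and the remaining copies of the
  boundary of \<open>l\<close> cancel by the cone formula.\<close>

lemma poset_bdry_poset_bdry:
  assumes "finite P" "supported P c" shows "poset_bdry P (poset_bdry P c) = (\<lambda>_. 0)"
  using assms
proof (induction "card P" arbitrary: P c rule: less_induct)
  case less
  show ?case
  proof (cases "P = {}")
    case True then show ?thesis by (simp add: poset_bdry_def)
  next
    case False
    then obtain a Q where PQ: "P = insert a Q" "a \<notin> Q" by (meson Set.set_insert ex_in_conv)
    have Q: "finite Q" "card Q < card P" using PQ less.prems by auto
    have L: "finite (link Q a)" "card (link Q a) < card P"
      using Q PQ by (auto simp: link_def intro!: le_less_trans[OF card_mono[of Q]])
    define l r where "l = link_part a c" and "r = rest_part a c"
    have sl: "supported (link Q a) l" and sr: "supported Q r"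
      using less.prems PQ supported_link_part supported_rest_part by (auto simp: l_def r_def)
    have sdl: "supported (link Q a) (poset_bdry (link Q a) l)" by (rule supported_poset_bdry[OF sl])
    have sdr: "supported Q (poset_bdry Q r)" by (rule supported_poset_bdry[OF sr])
    have fin: "finite (insert a Q)" using Q by simp
    have d: "poset_bdry P c = (\<lambda>\<tau>. l \<tau> - cone a (poset_bdry (link Q a) l) \<tau> + poset_bdry Q r \<tau>)"
      using poset_bdry_decompose[OF Q(1)] less.prems PQ unfolding l_def r_def by simp
    have "poset_bdry P (poset_bdry P c) = (\<lambda>\<tau>. poset_bdry P l \<tau> - poset_bdry P (cone a (poset_bdry (link Q a) l)) \<tau> + poset_bdry P (poset_bdry Q r) \<tau>)"
      unfolding d by (simp add: poset_bdry_add poset_bdry_diff)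
    moreover have "poset_bdry P l = poset_bdry (link Q a) l"
      unfolding PQ by (rule poset_bdry_mono[OF fin link_mono_insert sl])
    moreover have "poset_bdry P (poset_bdry Q r) = (\<lambda>_. 0)"
      using poset_bdry_mono[OF fin subset_insertI sdr] less.hyps[OF Q(2) Q(1) sr] PQ by simp
    moreover have "poset_bdry P (poset_bdry (link Q a) l) = (\<lambda>_. 0)"
      using poset_bdry_mono[OF fin link_mono_insert sdl] less.hyps[OF L(2) L(1) sl] PQ by simp
    moreover have "poset_bdry P (cone a (poset_bdry (link Q a) l)) = (\<lambda>\<tau>. poset_bdry (link Q a) l \<tau> - cone a (poset_bdry P (poset_bdry (link Q a) l)) \<tau>)"
      unfolding PQ by (rule poset_bdry_cone[OF Q(1) sdl])
    ultimately show ?thesis by (simp add: cone_def fun_eq_iff)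
  qed
qed

text \<open>The index counts vertices, not dimension: \<open>j\<close> is homological degree j - 1.
  So this is vanishing of reduced homology in degrees up to m - 2, and m > 0 forces \<open>P\<close>
  to be nonempty through j = 0.\<close>

definition acyclic_below :: "'b set set \<Rightarrow> nat \<Rightarrow> bool" where
  "acyclic_below P m \<longleftrightarrow> (\<forall>j<m. cycles (order_complex P) j \<subseteq> boundaries (order_complex P) j)"

lemma chains_iff: "c \<in> chains (order_complex P) j \<longleftrightarrow> supported P c \<and> (\<forall>\<sigma>. c \<sigma> \<noteq> 0 \<longrightarrow> card \<sigma> = j)"
  by (auto simp: chains_def supported_def)

lemma chains_mono: "S \<subseteq> T \<Longrightarrow> chains S j \<subseteq> chains T j"
  by (auto simp: chains_def)

lemma chains_add: "b \<in> chains S j \<Longrightarrow> c \<in> chains S j \<Longrightarrow> (\<lambda>\<sigma>. b \<sigma> + c \<sigma>) \<in> chains S j"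
  unfolding chains_def by (smt (verit) mem_Collect_eq)

lemma chains_diff: "b \<in> chains S j \<Longrightarrow> c \<in> chains S j \<Longrightarrow> (\<lambda>\<sigma>. b \<sigma> - c \<sigma>) \<in> chains S j"
  unfolding chains_def by (smt (verit) mem_Collect_eq)

lemma acyclic_belowI:
  assumes "finite P"
    and "\<And>j c. j < m \<Longrightarrow> c \<in> chains (order_complex P) j \<Longrightarrow> poset_bdry P c = (\<lambda>_. 0) \<Longrightarrow>
      \<exists>b\<in>chains (order_complex P) (Suc j). poset_bdry P b = c"
  shows "acyclic_below P m"
  unfolding acyclic_below_def cycles_def boundaries_def
  using assms bdry_eq_poset_bdry[OF assms(1)] by (fastforce simp: chains_iff)

lemma acyclic_belowD:
  assumes "acyclic_below P m" "finite P" "j < m" "c \<in> chains (order_complex P) j" "poset_bdry P c = (\<lambda>_. 0)"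
  obtains b where "b \<in> chains (order_complex P) (Suc j)" "poset_bdry P b = c"
proof -
  have "c \<in> cycles (order_complex P) j"
    using assms bdry_eq_poset_bdry[OF assms(2)] by (simp add: cycles_def chains_iff)
  then obtain b where "b \<in> chains (order_complex P) (Suc j)" "bdry (order_complex P) b = c"
    using assms(1,3) unfolding acyclic_below_def boundaries_def by blast
  then show ?thesis using that bdry_eq_poset_bdry[OF assms(2)] by (simp add: chains_iff)
qed

lemma acyclic_below_mono: "acyclic_below P m \<Longrightarrow> k \<le> m \<Longrightarrow> acyclic_below P k"
  by (auto simp: acyclic_below_def)

lemma cone_chain:
  assumes "finite Q" "b \<in> chains (order_complex (link Q a)) j"
  shows "cone a b \<in> chains (order_complex (insert a Q)) (Suc j)"
  unfolding chains_iff
proof (intro conjI allI impI)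
  show "supported (insert a Q) (cone a b)" using assms supported_cone by (auto simp: chains_iff)
  fix \<sigma> assume "cone a b \<sigma> \<noteq> 0"
  then have s: "a \<in> \<sigma>" "b (\<sigma> - {a}) \<noteq> 0" by (auto simp: cone_def split: if_splits)
  then have "card (\<sigma> - {a}) = j" "\<sigma> - {a} \<in> order_complex (link Q a)"
    using assms(2) by (auto simp: chains_def)
  moreover have "finite (link Q a)" using assms(1) by (simp add: link_def)
  ultimately have "finite \<sigma>" "card (\<sigma> - {a}) = j"
    using order_complex_finite[of "link Q a" "\<sigma> - {a}"] by auto
  then show "card \<sigma> = Suc j" using card_Suc_Diff1[OF _ s(1)] by simp
qed

text \<open>Coning off the part of a cycle that misses \<open>a\<close> fills the whole cycle: the
  cycle condition says that the boundary of this part is minus the link part, and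
  \<open>poset_bdry_cone\<close> puts the missing simplices back.\<close>

lemma acyclic_below_cone_point:
  assumes "finite P" "a \<in> P" and cmp: "\<And>w. w \<in> P \<Longrightarrow> w \<subseteq> a \<or> a \<subseteq> w"
  shows "acyclic_below P m"
proof (rule acyclic_belowI[OF assms(1)])
  fix j c assume c: "c \<in> chains (order_complex P) j" and d: "poset_bdry P c = (\<lambda>_. 0)"
  define Q where "Q = P - {a}"
  have PQ: "P = insert a Q" "finite Q" using assms by (auto simp: Q_def)
  have link: "link Q a = Q" using cmp by (auto simp: link_def Q_def)
  define l r where "l = link_part a c" and "r = rest_part a c"
  have sc: "supported (insert a Q) c" using c PQ by (simp add: chains_iff)
  have sr: "supported (link Q a) r" using supported_rest_part[OF sc] by (simp add: r_def link)
  have rc: "r \<in> chains (order_complex (link Q a)) j" using sr c by (auto simp: chains_iff r_def rest_part_def)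
  have dec: "l \<tau> - cone a (poset_bdry (link Q a) l) \<tau> + poset_bdry Q r \<tau> = 0" for \<tau>
    using poset_bdry_decompose[OF PQ(2) sc] d PQ(1) by (simp add: l_def r_def fun_eq_iff)
  have neg: "poset_bdry Q r \<tau> = - l \<tau>" if "a \<notin> \<tau>" for \<tau>
    using dec[of \<tau>] that by (simp add: cone_def)
  have "poset_bdry P r = poset_bdry Q r" unfolding PQ(1) using sr link PQ by (intro poset_bdry_mono) auto
  then have "poset_bdry P (cone a r) = (\<lambda>\<tau>. r \<tau> - cone a (poset_bdry Q r) \<tau>)"
    using poset_bdry_cone[OF PQ(2) sr] PQ(1) by simp
  also have "\<dots> = (\<lambda>\<tau>. r \<tau> + cone a l \<tau>)"
    by (simp add: cone_def neg fun_eq_iff)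
  also have "\<dots> = c" using cone_link_rest[of c a] by (simp add: l_def r_def add.commute)
  finally show "\<exists>b\<in>chains (order_complex P) (Suc j). poset_bdry P b = c"
    using cone_chain[OF PQ(2) rc] PQ(1) by blast
qed

text \<open>Mayer-Vietoris on the level of chains. The link part of a cycle is a cycle of the link
  with one vertex fewer, whence the bound m - 1. Filling it by \<open>b\<close> and adding the
  boundary of \<open>cone a b\<close> pushes the cycle off \<open>a\<close> into \<open>Q\<close>,
  where it can be filled.\<close>

lemma acyclic_below_insert:
  assumes Q: "finite Q" and aQ: "acyclic_below Q m" and aL: "acyclic_below (link Q a) (m - 1)"
  shows "acyclic_below (insert a Q) m"
proof (rule acyclic_belowI)
  show "finite (insert a Q)" using Q by simp
  fix j c assume j: "j < m" and c: "c \<in> chains (order_complex (insert a Q)) j"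
    and d: "poset_bdry (insert a Q) c = (\<lambda>_. 0)"
  have fL: "finite (link Q a)" using Q by (simp add: link_def)
  define l r where "l = link_part a c" and "r = rest_part a c"
  have sc: "supported (insert a Q) c" using c by (simp add: chains_iff)
  have sl: "supported (link Q a) l" and sr: "supported Q r"
    using supported_link_part[OF sc] supported_rest_part[OF sc] by (auto simp: l_def r_def)
  have dec: "l \<tau> - cone a (poset_bdry (link Q a) l) \<tau> + poset_bdry Q r \<tau> = 0" for \<tau>
    using poset_bdry_decompose[OF Q sc] d by (simp add: l_def r_def fun_eq_iff)
  have dl: "poset_bdry (link Q a) l = (\<lambda>_. 0)"
  proof
    fix \<tau> show "poset_bdry (link Q a) l \<tau> = 0"
    proof (cases "a \<in> \<tau>")
      case True
      then have "\<tau> \<notin> order_complex (link Q a)" by (auto simp: order_complex_def link_def)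
      then show ?thesis using supported_poset_bdry[OF sl] unfolding supported_def by blast
    next
      case False
      have "l (insert a \<tau>) = 0" by (simp add: l_def link_part_def)
      moreover have "poset_bdry Q r (insert a \<tau>) = 0"
        unfolding poset_bdry_def by (rule sum.neutral) (auto simp: r_def rest_part_def)
      ultimately have "vsgn a (insert a \<tau>) * poset_bdry (link Q a) l \<tau> = 0"
        using dec[of "insert a \<tau>"] False by (simp add: cone_def)
      then show ?thesis by (simp add: vsgn_def)
    qed
  qed
  have "\<exists>b. b \<in> chains (order_complex (link Q a)) j \<and> poset_bdry (link Q a) b = l"
  proof (cases j)
    case 0
    \<comment> \<open>A multiple of the empty simplex has no part through \<open>a\<close>, and
      there is no lower degree of the link to appeal to.\<close>
    have "l = (\<lambda>_. 0)"
    proof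
      fix \<tau>
      have "card (insert a \<tau>) \<noteq> 0 \<or> insert a \<tau> \<notin> order_complex (insert a Q)"
        using order_complex_finite[of "insert a Q" "insert a \<tau>"] Q by auto
      then have "c (insert a \<tau>) = 0" using c 0 by (auto simp: chains_def)
      then show "l \<tau> = 0" by (simp add: l_def link_part_def)
    qed
    then show ?thesis by (intro exI[of _ "\<lambda>_. 0"]) (auto simp: chains_def poset_bdry_def)
  next
    case (Suc i)
    have "l \<in> chains (order_complex (link Q a)) i"
      unfolding chains_iff
    proof (intro conjI sl allI impI)
      fix \<sigma> assume s: "l \<sigma> \<noteq> 0"
      then have "finite \<sigma>" using sl fL order_complex_finite by (auto simp: supported_def)
      moreover have "a \<notin> \<sigma>" "c (insert a \<sigma>) \<noteq> 0"
        using s by (auto simp: l_def link_part_def split: if_splits)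
      ultimately show "card \<sigma> = i" using c Suc by (auto simp: chains_def)
    qed
    then show ?thesis using acyclic_belowD[OF aL fL _ _ dl, of i] j Suc by (metis less_diff_conv Suc_eq_plus1)
  qed
  then obtain b where b: "b \<in> chains (order_complex (link Q a)) j" "poset_bdry (link Q a) b = l" by blast
  then have sb: "supported (link Q a) b" by (simp add: chains_iff)
  let ?P = "insert a Q"
  have dcb: "poset_bdry ?P (cone a b) = (\<lambda>\<tau>. b \<tau> - cone a l \<tau>)"
    using poset_bdry_cone[OF Q sb] poset_bdry_mono[OF _ link_mono_insert sb] Q b by simp
  \<comment> \<open>The cycle after pushing it off \<open>a\<close>: the terms
    \<open>cone a l\<close> cancel, and \<open>r\<close> and \<open>b\<close> are both supported on
    \<open>Q\<close>.\<close>
  define e where "e = (\<lambda>\<tau>. r \<tau> + b \<tau>)"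
  have e: "e = (\<lambda>\<tau>. c \<tau> + poset_bdry ?P (cone a b) \<tau>)"
  proof
    fix \<tau>
    have "c \<tau> = cone a l \<tau> + r \<tau>" unfolding l_def r_def by (rule fun_cong[OF cone_link_rest])
    then show "e \<tau> = c \<tau> + poset_bdry ?P (cone a b) \<tau>" by (simp add: dcb e_def)
  qed
  have "poset_bdry ?P e = (\<lambda>_. 0)"
    unfolding e using d poset_bdry_poset_bdry[of ?P "cone a b"] supported_cone[OF sb] Q by (simp add: poset_bdry_add)
  moreover have ec: "e \<in> chains (order_complex Q) j"
  proof -
    have "order_complex (link Q a) \<subseteq> order_complex Q" by (rule order_complex_mono) (auto simp: link_def)
    then have "b \<in> chains (order_complex Q) j" using b(1) chains_mono by blast
    moreover have "r \<in> chains (order_complex Q) j"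
      using sr c by (auto simp: chains_iff r_def rest_part_def)
    ultimately show ?thesis unfolding e_def by (intro chains_add)
  qed
  ultimately have "poset_bdry Q e = (\<lambda>_. 0)"
    using poset_bdry_mono[of ?P Q e, OF _ subset_insertI] Q by (simp add: chains_iff)
  then obtain f where f: "f \<in> chains (order_complex Q) (Suc j)" "poset_bdry Q f = e"
    using acyclic_belowD[OF aQ Q j ec] by blast
  have "poset_bdry ?P f = e" using poset_bdry_mono[of ?P Q f, OF _ subset_insertI] f Q by (simp add: chains_iff)
  then have "poset_bdry ?P (\<lambda>\<tau>. f \<tau> - cone a b \<tau>) = c" by (simp add: poset_bdry_diff e)
  moreover have "(\<lambda>\<tau>. f \<tau> - cone a b \<tau>) \<in> chains (order_complex ?P) (Suc j)"
    using f(1) cone_chain[OF Q b(1)] chains_mono[OF order_complex_mono[of Q ?P]]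
    by (intro chains_diff) auto
  ultimately show "\<exists>b\<in>chains (order_complex ?P) (Suc j). poset_bdry ?P b = c" by blast
qed

text \<open>A minimal element of \<open>A\<close> is glued in last, so its link contains every
  member of \<open>A\<close> above it, but only members of \<open>Q\<close> below it.\<close>

lemma acyclic_below_add_decreasing:
  assumes "finite Q" "finite A" "acyclic_below Q m"
    and "\<And>a. a \<in> A \<Longrightarrow> acyclic_below ({w\<in>Q. w \<subset> a} \<union> {w\<in>Q \<union> A. a \<subset> w}) (m - 1)"
  shows "acyclic_below (Q \<union> A) m"
  using assms(2,4)
proof (induction "card A" arbitrary: A)
  case 0 then show ?case using assms by simp
next
  case (Suc k)
  then have "A \<noteq> {}" by auto
  then obtain a where a: "a \<in> A" "\<And>b. b \<in> A \<Longrightarrow> \<not> b \<subset> a"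
    using finite_has_minimal[OF Suc.prems(1)] by (metis psubsetE subset_antisym)
  let ?A = "A - {a}"
  have "acyclic_below (Q \<union> ?A) m"
  proof (rule Suc.hyps(1))
    show "k = card ?A" "finite ?A" using Suc a by auto
    fix b assume b: "b \<in> ?A"
    have "{w \<in> Q \<union> ?A. b \<subset> w} = {w \<in> Q \<union> A. b \<subset> w} \<or> a \<notin> Q \<and> b \<subset> a" by auto
    then show "acyclic_below ({w \<in> Q. w \<subset> b} \<union> {w \<in> Q \<union> ?A. b \<subset> w}) (m - 1)"
      using Suc.prems(2)[of b] a b by auto
  qed
  moreover have "acyclic_below (link (Q \<union> ?A) a) (m - 1)"
  proof -
    have "link (Q \<union> ?A) a = {w\<in>Q. w \<subset> a} \<union> {w\<in>Q \<union> A. a \<subset> w}" using a by (auto simp: link_def)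
    then show ?thesis using Suc.prems(2)[OF a(1)] by simp
  qed
  ultimately have "acyclic_below (insert a (Q \<union> ?A)) m"
    using assms(1) Suc.prems(1) by (intro acyclic_below_insert) auto
  moreover have "insert a (Q \<union> ?A) = Q \<union> A" using a by auto
  ultimately show ?case by simp
qed

text \<open>Now a maximal element of \<open>A\<close> is glued in last, so only members of
  \<open>Q\<close> occur above it in its link. This order suits elements whose link is to be
  contracted to a cone point above them in \<open>Q\<close>.\<close>

lemma acyclic_below_add_increasing:
  assumes "finite Q" "finite A" "acyclic_below Q m"
    and "\<And>a. a \<in> A \<Longrightarrow> acyclic_below ({w\<in>Q. a \<subset> w} \<union> {w\<in>Q \<union> A. w \<subset> a}) (m - 1)"
  shows "acyclic_below (Q \<union> A) m"
  using assms(2,4)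
proof (induction "card A" arbitrary: A)
  case 0 then show ?case using assms by simp
next
  case (Suc k)
  then have "A \<noteq> {}" by auto
  then obtain a where a: "a \<in> A" "\<And>b. b \<in> A \<Longrightarrow> \<not> a \<subset> b"
    using finite_has_maximal[OF Suc.prems(1)] by (metis psubsetE subset_antisym)
  let ?A = "A - {a}"
  have "acyclic_below (Q \<union> ?A) m"
  proof (rule Suc.hyps(1))
    show "k = card ?A" "finite ?A" using Suc a by auto
    fix b assume b: "b \<in> ?A"
    have "{w \<in> Q \<union> ?A. w \<subset> b} = {w \<in> Q \<union> A. w \<subset> b} \<or> a \<notin> Q \<and> a \<subset> b" by auto
    then show "acyclic_below ({w \<in> Q. b \<subset> w} \<union> {w \<in> Q \<union> ?A. w \<subset> b}) (m - 1)"
      using Suc.prems(2)[of b] a b by auto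
  qed
  moreover have "acyclic_below (link (Q \<union> ?A) a) (m - 1)"
  proof -
    have "link (Q \<union> ?A) a = {w\<in>Q. a \<subset> w} \<union> {w\<in>Q \<union> A. w \<subset> a}" using a by (auto simp: link_def)
    then show ?thesis using Suc.prems(2)[OF a(1)] by simp
  qed
  ultimately have "acyclic_below (insert a (Q \<union> ?A)) m"
    using assms(1) Suc.prems(1) by (intro acyclic_below_insert) auto
  moreover have "insert a (Q \<union> ?A) = Q \<union> A" using a by auto
  ultimately show ?case by simp
qed

section \<open>Top homology rank and Euler characteristic\<close>

definition rscale :: "rat \<Rightarrow> ('x \<Rightarrow> rat) \<Rightarrow> ('x \<Rightarrow> rat)" where
  "rscale r f = (\<lambda>x. r * f x)"

interpretation rv: vector_space rscale
  by unfold_locales (auto simp: rscale_def fun_eq_iff algebra_simps)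

lemma rv_span_disjoint:
  assumes B: "rv.independent B" and "B0 \<subseteq> B" "C \<subseteq> B" "B0 \<inter> C = {}" and x: "x \<in> rv.span B0" "x \<in> rv.span C"
  shows "x = 0"
proof -
  have "rv.representation B x = rv.representation B0 x" "rv.representation B x = rv.representation C x"
    using rv.representation_extend[OF B x(1)] rv.representation_extend[OF B x(2)] assms(2,3) by simp_all
  then have "rv.representation B x b = 0" for b
    using rv.representation_ne_zero[of B0 x b] rv.representation_ne_zero[of C x b] assms(4) by (metis disjoint_iff)
  moreover have "x \<in> rv.span B" using x(1) rv.span_mono[OF assms(2)] by blast
  ultimately show ?thesis using rv.sum_nonzero_representation_eq[OF B] by fastforce
qed

text \<open>The ambient function space may be infinite-dimensional, so finiteness is put on
  \<open>V\<close> through \<open>F\<close>. A basis of the kernel is extended by \<open>C\<close>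
  to one of \<open>V\<close>; \<open>f\<close> is injective on the span of \<open>C\<close>, which
  maps onto the image.\<close>

lemma rv_rank_nullity:
  assumes f: "Vector_Spaces.linear rscale rscale f" and V: "rv.subspace V" "V \<subseteq> rv.span F" "finite F"
  shows "rv.dim V = rv.dim {x\<in>V. f x = 0} + rv.dim (f ` V)"
proof -
  interpret f: Vector_Spaces.linear rscale rscale f by (rule f)
  let ?K = "{x\<in>V. f x = 0}"
  obtain B0 where B0: "B0 \<subseteq> ?K" "rv.independent B0" "?K \<subseteq> rv.span B0" "card B0 = rv.dim ?K"
    by (rule rv.basis_exists)
  obtain B where B: "B0 \<subseteq> B" "B \<subseteq> V" "rv.independent B" "V \<subseteq> rv.span B"
    using rv.maximal_independent_subset_extend[of B0 V] B0 by blast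
  have fB: "finite B" using rv.independent_span_bound[OF V(3) B(3)] B(2) V(2) by blast
  define C where "C = B - B0"
  have CV: "rv.span C \<subseteq> V" using B V by (intro rv.span_minimal) (auto simp: C_def)
  have C: "rv.independent C" using rv.independent_mono[OF B(3)] by (auto simp: C_def)
  have inj: "inj_on f (rv.span C)"
  proof (rule inj_onI)
    fix x y assume xy: "x \<in> rv.span C" "y \<in> rv.span C" "f x = f y"
    have d: "x - y \<in> rv.span C" using xy rv.span_diff by blast
    have "f (x - y) = 0" using xy by (simp add: f.diff)
    then have "x - y \<in> rv.span B0" using d CV B0(3) by blast
    then have "x - y = 0" using rv_span_disjoint[OF B(3) B(1) _ _ _ d] by (auto simp: C_def)
    then show "x = y" by simp
  qed
  have "rv.independent (f ` C)" by (rule f.independent_injective_image[OF C inj])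
  moreover have "f ` C \<subseteq> f ` V" using B by (auto simp: C_def)
  moreover have "f ` V \<subseteq> rv.span (f ` C)"
  proof
    fix y assume "y \<in> f ` V"
    then obtain v where v: "v \<in> V" "y = f v" by blast
    have "B = B0 \<union> C" using B by (auto simp: C_def)
    then have "v \<in> rv.span (B0 \<union> C)" using B v by auto
    then obtain b c where bc: "v = b + c" "b \<in> rv.span B0" "c \<in> rv.span C" unfolding rv.span_Un by blast
    have "f b = 0" using bc(2) f.subspace_kernel B0(1) rv.span_minimal[of B0 "{x. f x = 0}"] by blast
    then have "y = f c" using v bc by (simp add: f.add)
    then show "y \<in> rv.span (f ` C)" using bc(3) f.span_image by blast
  qed
  ultimately have "card (f ` C) = rv.dim (f ` V)" by (intro rv.basis_card_eq_dim)
  moreover have "card (f ` C) = card C"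
    using inj rv.span_superset by (intro card_image) (rule inj_on_subset)
  moreover have "card B = rv.dim V" using B by (intro rv.basis_card_eq_dim)
  moreover have "card B = card B0 + card C"
    using fB B(1) card_Diff_subset[of B0 B] card_mono[of B B0] finite_subset[of B0 B] by (simp add: C_def)
  ultimately show ?thesis using B0(4) by simp
qed

lemma rv_dim_supported:
  assumes "finite T"
  shows "rv.dim {c :: 'x \<Rightarrow> rat. \<forall>x. c x \<noteq> 0 \<longrightarrow> x \<in> T} = card T"
    and "\<exists>F. finite F \<and> {c :: 'x \<Rightarrow> rat. \<forall>x. c x \<noteq> 0 \<longrightarrow> x \<in> T} \<subseteq> rv.span F"
    and "rv.subspace {c :: 'x \<Rightarrow> rat. \<forall>x. c x \<noteq> 0 \<longrightarrow> x \<in> T}"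
proof -
  let ?V = "{c :: 'x \<Rightarrow> rat. \<forall>x. c x \<noteq> 0 \<longrightarrow> x \<in> T}"
  define \<delta> :: "'x \<Rightarrow> 'x \<Rightarrow> rat" where "\<delta> t = (\<lambda>x. if x = t then 1 else 0)" for t
  have inj: "inj \<delta>"
  proof (rule injI)
    fix s t assume "\<delta> s = \<delta> t"
    from fun_cong[OF this, of s] show "s = t" by (simp add: \<delta>_def split: if_splits)
  qed
  have sumap: "(\<Sum>t\<in>T. rscale (u t) (\<delta> t)) x = (if x \<in> T then u x else 0)" for u x
  proof -
    have "(\<Sum>t\<in>S. rscale (u t) (\<delta> t)) x = (\<Sum>t\<in>S. if t = x then u t else 0)" if "finite S" for S
      using that by induction (auto simp: rscale_def \<delta>_def)
    then show ?thesis using assms by simp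
  qed
  have sub: "\<delta> ` T \<subseteq> ?V" by (auto simp: \<delta>_def split: if_splits)
  have sp: "?V \<subseteq> rv.span (\<delta> ` T)"
  proof
    fix c assume c: "c \<in> ?V"
    have "c = (\<Sum>t\<in>T. rscale (c t) (\<delta> t))" using c by (auto simp: fun_eq_iff sumap)
    also have "\<dots> \<in> rv.span (\<delta> ` T)" by (intro rv.span_sum rv.span_scale rv.span_base) auto
    finally show "c \<in> rv.span (\<delta> ` T)" .
  qed
  have ind: "rv.independent (\<delta> ` T)"
  proof -
    have "u v = 0" if uv: "(\<Sum>v\<in>\<delta> ` T. rscale (u v) v) = 0" "v \<in> \<delta> ` T" for u v
    proof -
      have e: "(\<Sum>t\<in>T. rscale (u (\<delta> t)) (\<delta> t)) = 0"
        using uv(1) by (simp add: sum.reindex inj_on_subset[OF inj])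
      obtain t where t: "t \<in> T" "v = \<delta> t" using uv(2) by blast
      from fun_cong[OF e, of t] show ?thesis using t by (simp add: sumap)
    qed
    then show ?thesis using assms by (auto simp: rv.dependent_finite)
  qed
  show "rv.dim ?V = card T"
    using rv.basis_card_eq_dim[OF sub sp ind] card_image[OF inj_on_subset[OF inj subset_UNIV], of T] by simp
  show "\<exists>F. finite F \<and> ?V \<subseteq> rv.span F" using sp assms by blast
  show "rv.subspace ?V"
  proof (rule rv.subspaceI)
    fix x y assume "x \<in> ?V" "y \<in> ?V"
    then show "x + y \<in> ?V" by simp (metis add.right_neutral)
  qed (auto simp: rscale_def)
qed

section \<open>Rational chains and clearing of denominators\<close>

definition rat_fun :: "('x \<Rightarrow> int) \<Rightarrow> ('x \<Rightarrow> rat)" where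
  "rat_fun c = (\<lambda>x. of_int (c x))"

lemma inj_rat_fun: "inj rat_fun"
  by (rule injI) (auto simp: rat_fun_def fun_eq_iff)

lemma common_denominator_on:
  fixes c :: "'x \<Rightarrow> rat"
  assumes "finite T"
  shows "\<exists>d::int. d > 0 \<and> (\<forall>x\<in>T. c x * of_int d \<in> \<int>)"
  using assms
proof induction
  case empty then show ?case by (intro exI[of _ 1]) auto
next
  case (insert t T)
  then obtain d where d: "d > 0" "\<forall>x\<in>T. c x * of_int d \<in> \<int>" by blast
  obtain a b where ab: "quotient_of (c t) = (a, b)" by fastforce
  have b: "b > 0" "c t = of_int a / of_int b"
    using quotient_of_denom_pos[OF ab] quotient_of_div[OF ab] by auto
  have "c x * of_int (d * b) \<in> \<int>" if "x \<in> insert t T" for x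
  proof (cases "x = t")
    case True
    have "c t * of_int (d * b) = of_int (a * d)" using b by (simp add: field_simps)
    then show ?thesis using True by (metis Ints_of_int)
  next
    case False
    have "c x * of_int (d * b) = (c x * of_int d) * of_int b" by simp
    then show ?thesis using d(2) that False by (metis Ints_mult Ints_of_int insertE)
  qed
  then show ?case using d b by (intro exI[of _ "d * b"]) auto
qed

lemma clear_denominators:
  fixes c :: "'x \<Rightarrow> rat"
  assumes "finite T" "\<And>x. c x \<noteq> 0 \<Longrightarrow> x \<in> T"
  obtains d :: int and c' where "d > 0" "rscale (of_int d) c = rat_fun c'" "\<And>x. c' x \<noteq> 0 \<Longrightarrow> c x \<noteq> 0"
proof -
  obtain d :: int where d: "d > 0" "\<forall>x\<in>T. c x * of_int d \<in> \<int>" using common_denominator_on[OF assms(1)] by blast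
  define c' where "c' x = \<lfloor>of_int d * c x\<rfloor>" for x
  have "of_int d * c x = of_int (c' x)" for x
  proof (cases "c x = 0")
    case False
    then have "of_int d * c x \<in> \<int>" using d(2) assms(2) by (metis mult.commute)
    then show ?thesis by (auto simp: c'_def elim: Ints_cases)
  qed (simp add: c'_def)
  then have "rscale (of_int d) c = rat_fun c'" by (simp add: rscale_def rat_fun_def)
  moreover have "c x \<noteq> 0" if "c' x \<noteq> 0" for x using that by (auto simp: c'_def)
  ultimately show ?thesis using that d by blast
qed

definition rat_bdry :: "'b set set \<Rightarrow> ('b set set \<Rightarrow> rat) \<Rightarrow> ('b set set \<Rightarrow> rat)" where
  "rat_bdry P c = (\<lambda>\<tau>. \<Sum>x\<in>P - \<tau>. of_int (vsgn x \<tau>) * c (insert x \<tau>))"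

lemma rat_bdry_rat_fun: "rat_bdry P (rat_fun c) = rat_fun (poset_bdry P c)"
  by (simp add: rat_bdry_def rat_fun_def poset_bdry_def)

lemma linear_rat_bdry: "Vector_Spaces.linear rscale rscale (rat_bdry P)"
  unfolding Vector_Spaces.linear_iff
  by (auto simp: rv.vector_space_axioms rat_bdry_def rscale_def fun_eq_iff sum.distrib[symmetric]
      sum_distrib_left algebra_simps)

definition qchains :: "'b set set \<Rightarrow> nat \<Rightarrow> ('b set set \<Rightarrow> rat) set" where
  "qchains P j = {c. \<forall>\<sigma>. c \<sigma> \<noteq> 0 \<longrightarrow> \<sigma> \<in> {\<sigma>\<in>order_complex P. card \<sigma> = j}}"

lemma poset_bdry_chains:
  assumes "finite P" "c \<in> chains (order_complex P) (Suc j)" shows "poset_bdry P c \<in> chains (order_complex P) j"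
  unfolding chains_iff
proof (intro conjI allI impI)
  show "supported P (poset_bdry P c)" using assms by (intro supported_poset_bdry) (simp add: chains_iff)
  fix \<tau> assume "poset_bdry P c \<tau> \<noteq> 0"
  then obtain x where x: "x \<in> P - \<tau>" "c (insert x \<tau>) \<noteq> 0" unfolding poset_bdry_def
    by (metis (no_types, lifting) mult_zero_right sum.neutral)
  then have "insert x \<tau> \<in> order_complex P" "card (insert x \<tau>) = Suc j" using assms by (auto simp: chains_def)
  then show "card \<tau> = j" using order_complex_finite[OF assms(1), of "insert x \<tau>"] x by auto
qed

lemma qchains_clear:
  assumes "finite P" "c \<in> qchains P j"
  obtains d :: int and c' where "d > 0" "rscale (of_int d) c = rat_fun c'" "c' \<in> chains (order_complex P) j"
proof -
  have "finite {\<sigma>\<in>order_complex P. card \<sigma> = j}" using finite_order_complex[OF assms(1)] by simp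
  from clear_denominators[OF this, of c] assms(2) obtain d :: int and c' where
    "d > 0" "rscale (of_int d) c = rat_fun c'" "\<And>x. c' x \<noteq> 0 \<Longrightarrow> c x \<noteq> 0"
    unfolding qchains_def by blast
  then show ?thesis using that[of d c'] assms(2) by (auto simp: chains_def qchains_def)
qed

lemma rat_fun_chains: "c \<in> chains (order_complex P) j \<Longrightarrow> rat_fun c \<in> qchains P j"
  by (auto simp: chains_def qchains_def rat_fun_def)

lemma qchains_subspace: "finite P \<Longrightarrow> rv.subspace (qchains P j)"
  unfolding qchains_def by (rule rv_dim_supported(3)) (simp add: finite_order_complex)

lemma rscale_inverse: "d > 0 \<Longrightarrow> rscale (of_int d) c = e \<Longrightarrow> c = rscale (1 / of_int d) e"
  by (auto simp: rscale_def fun_eq_iff nonzero_eq_divide_eq mult.commute)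

text \<open>Exactness over the integers passes to the rationals: a rational cycle is scaled to an
  integral one, filled there, and the filling is scaled back.\<close>

lemma rat_bdry_image_qchains:
  assumes P: "finite P" and ac: "acyclic_below P N" and j: "j < N"
  shows "rat_bdry P ` qchains P (Suc j) = {c\<in>qchains P j. rat_bdry P c = 0}"
proof (intro set_eqI iffI)
  interpret l: Vector_Spaces.linear rscale rscale "rat_bdry P" by (rule linear_rat_bdry)
  fix y assume "y \<in> rat_bdry P ` qchains P (Suc j)"
  then obtain c where c: "c \<in> qchains P (Suc j)" "y = rat_bdry P c" by blast
  obtain d :: int and c' where d: "d > 0" "rscale (of_int d) c = rat_fun c'" "c' \<in> chains (order_complex P) (Suc j)"
    using qchains_clear[OF P c(1)] .
  have y: "y = rscale (1 / of_int d) (rat_fun (poset_bdry P c'))"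
    using rscale_inverse[OF d(1,2)] c(2) by (simp add: l.scale rat_bdry_rat_fun)
  have "y \<in> qchains P j" unfolding y
    by (rule rv.subspace_scale[OF qchains_subspace[OF P] rat_fun_chains[OF poset_bdry_chains[OF P d(3)]]])
  moreover have "rat_bdry P y = 0" unfolding y l.scale rat_bdry_rat_fun
    using poset_bdry_poset_bdry[OF P, of c'] d(3) by (simp add: chains_iff rat_fun_def rscale_def fun_eq_iff)
  ultimately show "y \<in> {c\<in>qchains P j. rat_bdry P c = 0}" by blast
next
  interpret l: Vector_Spaces.linear rscale rscale "rat_bdry P" by (rule linear_rat_bdry)
  fix c assume "c \<in> {c\<in>qchains P j. rat_bdry P c = 0}"
  then have c: "c \<in> qchains P j" "rat_bdry P c = 0" by auto
  obtain d :: int and c' where d: "d > 0" "rscale (of_int d) c = rat_fun c'" "c' \<in> chains (order_complex P) j"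
    using qchains_clear[OF P c(1)] .
  have "rat_fun (poset_bdry P c') = 0"
    unfolding rat_bdry_rat_fun[symmetric] d(2)[symmetric] l.scale c(2) by simp
  then have "poset_bdry P c' = (\<lambda>_. 0)" by (simp add: rat_fun_def fun_eq_iff)
  then obtain b where b: "b \<in> chains (order_complex P) (Suc j)" "poset_bdry P b = c'"
    using acyclic_belowD[OF ac P j d(3)] by blast
  have "c = rat_bdry P (rscale (1 / of_int d) (rat_fun b))"
    using rscale_inverse[OF d(1,2)] b(2) by (simp add: l.scale rat_bdry_rat_fun)
  moreover have "rscale (1 / of_int d) (rat_fun b) \<in> qchains P (Suc j)"
    by (rule rv.subspace_scale[OF qchains_subspace[OF P] rat_fun_chains[OF b(1)]])
  ultimately show "c \<in> rat_bdry P ` qchains P (Suc j)" by blast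
qed

lemma rat_bdry_qchains_0:
  assumes "finite P" "c \<in> qchains P 0" shows "rat_bdry P c = 0"
proof -
  have "c (insert x \<tau>) = 0" for x \<tau>
    using assms order_complex_finite[OF assms(1), of "insert x \<tau>"] by (auto simp: qchains_def)
  then show ?thesis by (simp add: rat_bdry_def fun_eq_iff)
qed

text \<open>Rank-nullity and exactness give one step: the cycles on j + 1 vertices and those on j
  vertices have dimensions adding up to the number of simplices on j + 1 vertices. The exponent i +
  j has the parity of j - i and avoids truncated subtraction.\<close>

lemma dim_qcycles:
  assumes P: "finite P" and ac: "acyclic_below P N" and "j \<le> N"
  shows "int (rv.dim {c\<in>qchains P j. rat_bdry P c = 0})
    = (\<Sum>i\<le>j. (-1) ^ (i + j) * int (card {\<sigma>\<in>order_complex P. card \<sigma> = i}))"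
  using assms(3)
proof (induction j)
  case 0
  have "{c\<in>qchains P 0. rat_bdry P c = 0} = qchains P 0" using rat_bdry_qchains_0[OF P] by blast
  moreover have "rv.dim (qchains P 0) = card {\<sigma>\<in>order_complex P. card \<sigma> = 0}"
    unfolding qchains_def by (rule rv_dim_supported(1)) (simp add: finite_order_complex[OF P])
  ultimately have "rv.dim {c\<in>qchains P 0. rat_bdry P c = 0} = card {\<sigma>\<in>order_complex P. card \<sigma> = 0}"
    by (simp only:)
  moreover have "(\<Sum>i\<le>0. (-1) ^ (i + 0) * int (card {\<sigma>\<in>order_complex P. card \<sigma> = i}))
    = int (card {\<sigma>\<in>order_complex P. card \<sigma> = 0})" by simp
  ultimately show ?case by (simp only:)
next
  case (Suc j)
  have fin: "finite {\<sigma>\<in>order_complex P. card \<sigma> = Suc j}" using finite_order_complex[OF P] by simp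
  obtain F where F: "finite F" "qchains P (Suc j) \<subseteq> rv.span F"
    using rv_dim_supported(2)[OF fin] unfolding qchains_def by blast
  have "card {\<sigma>\<in>order_complex P. card \<sigma> = Suc j} = rv.dim (qchains P (Suc j))"
    unfolding qchains_def by (rule rv_dim_supported(1)[OF fin, symmetric])
  also have "\<dots> = rv.dim {c\<in>qchains P (Suc j). rat_bdry P c = 0} + rv.dim (rat_bdry P ` qchains P (Suc j))"
    by (rule rv_rank_nullity[OF linear_rat_bdry qchains_subspace[OF P] F(2,1)])
  also have "rat_bdry P ` qchains P (Suc j) = {c\<in>qchains P j. rat_bdry P c = 0}"
    using Suc.prems by (intro rat_bdry_image_qchains[OF P ac]) simp
  finally have "int (rv.dim {c\<in>qchains P (Suc j). rat_bdry P c = 0})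
    = int (card {\<sigma>\<in>order_complex P. card \<sigma> = Suc j}) - int (rv.dim {c\<in>qchains P j. rat_bdry P c = 0})" by linarith
  also have "\<dots> = (\<Sum>i\<le>Suc j. (-1) ^ (i + Suc j) * int (card {\<sigma>\<in>order_complex P. card \<sigma> = i}))"
    unfolding Suc.IH[OF Suc_leD[OF Suc.prems]] by (simp add: sum_negf[symmetric])
  finally show ?case .
qed

text \<open>There are no boundaries in the top degree, so independence modulo boundaries is plain
  independence over the integers. This agrees with independence over the rationals after clearing
  denominators, and the supremum is attained by a rational basis scaled to integral cycles.\<close>

lemma homology_rank_top:
  assumes P: "finite P" and top: "\<And>\<sigma>. \<sigma> \<in> order_complex P \<Longrightarrow> card \<sigma> \<le> N"
  shows "homology_rank (order_complex P) N = rv.dim {c\<in>qchains P N. rat_bdry P c = 0}"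
proof -
  let ?S = "order_complex P" let ?Z = "{c\<in>qchains P N. rat_bdry P c = 0}"
  interpret l: Vector_Spaces.linear rscale rscale "rat_bdry P" by (rule linear_rat_bdry)
  have "chains ?S (Suc N) = {\<lambda>_. 0}"
    using top by (fastforce simp: chains_def fun_eq_iff)
  then have bd: "boundaries ?S N = {\<lambda>_. 0}" by (simp add: boundaries_def bdry_def)
  have cyc: "cycles ?S N = {c\<in>chains ?S N. poset_bdry P c = (\<lambda>_. 0)}"
    using bdry_eq_poset_bdry[OF P] by (auto simp: cycles_def chains_iff)
  have cycZ: "rat_fun c \<in> ?Z" if "c \<in> cycles ?S N" for c
    using that rat_fun_chains by (auto simp: cyc rat_bdry_rat_fun) (simp add: rat_fun_def fun_eq_iff)
  obtain B where B: "B \<subseteq> ?Z" "rv.independent B" "?Z \<subseteq> rv.span B" "card B = rv.dim ?Z"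
    by (rule rv.basis_exists)
  have fin: "finite {\<sigma>\<in>?S. card \<sigma> = N}" using finite_order_complex[OF P] by simp
  obtain F where F: "finite F" "qchains P N \<subseteq> rv.span F"
    using rv_dim_supported(2)[OF fin] unfolding qchains_def by blast
  have fB: "finite B" using rv.independent_span_bound[OF F(1) B(2)] F(2) B(1) by blast
  let ?I = "\<lambda>A. finite A \<and> A \<subseteq> cycles ?S N \<and> (\<forall>a :: ('a set set \<Rightarrow> int) \<Rightarrow> int.
      (\<lambda>\<tau>. \<Sum>x\<in>A. a x * x \<tau>) = (\<lambda>_. 0) \<longrightarrow> (\<forall>x\<in>A. a x = 0))"
  have hr: "homology_rank ?S N = Sup {card A | A. ?I A}"
    unfolding homology_rank_def bd by simp
  have upper: "card A \<le> rv.dim ?Z" if A: "?I A" for A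
  proof -
    have inj: "inj_on rat_fun A" using inj_rat_fun by (rule inj_on_subset) simp
    have "rv.independent (rat_fun ` A)"
    proof -
      have "u v = 0" if uv: "(\<Sum>v\<in>rat_fun ` A. rscale (u v) v) = 0" "v \<in> rat_fun ` A" for u v
      proof -
        have s: "(\<Sum>x\<in>A. rscale (u (rat_fun x)) (rat_fun x)) = 0"
          using uv(1) by (simp add: sum.reindex[OF inj])
        obtain d :: int where d: "d > 0" "\<forall>x\<in>A. u (rat_fun x) * of_int d \<in> \<int>"
          using common_denominator_on[of A "\<lambda>x. u (rat_fun x)"] A by blast
        \<comment> \<open>The product is already an integer for x in \<open>A\<close>, so the floor
          only changes its type.\<close>
        define a where "a x = \<lfloor>u (rat_fun x) * of_int d\<rfloor>" for x
        have a: "of_int (a x) = u (rat_fun x) * of_int d" if "x \<in> A" for x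
          using d(2) that by (auto simp: a_def elim: Ints_cases)
        have "(\<Sum>x\<in>A. a x * x \<tau>) = 0" for \<tau>
        proof -
          have sumap: "(\<Sum>x\<in>T. rscale (u (rat_fun x)) (rat_fun x)) \<tau> = (\<Sum>x\<in>T. u (rat_fun x) * of_int (x \<tau>))"
            if "finite T" for T
            using that by induction (auto simp: rscale_def rat_fun_def)
          have "of_int (\<Sum>x\<in>A. a x * x \<tau>) = (\<Sum>x\<in>A. u (rat_fun x) * of_int d * of_int (x \<tau>))"
            by (simp add: a)
          also have "\<dots> = of_int d * (\<Sum>x\<in>A. rscale (u (rat_fun x)) (rat_fun x)) \<tau>"
            using A by (simp add: sumap sum_distrib_left mult_ac)
          also have "\<dots> = 0" by (simp add: s)
          finally show ?thesis by (simp only: of_int_eq_0_iff)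
        qed
        then have "\<forall>x\<in>A. a x = 0" using A by blast
        then show ?thesis using uv(2) a d(1) by force
      qed
      then show ?thesis using A by (auto simp: rv.dependent_finite)
    qed
    moreover have "rat_fun ` A \<subseteq> rv.span B" using A cycZ B(3) by blast
    ultimately have "card (rat_fun ` A) \<le> card B" using rv.independent_span_bound[OF fB] by blast
    then show ?thesis using B(4) card_image[OF inj] by simp
  qed
  have "\<forall>b\<in>B. \<exists>d::int. \<exists>c. d > 0 \<and> rscale (of_int d) b = rat_fun c \<and> c \<in> chains ?S N"
    using B(1) qchains_clear[OF P] by (metis (no_types, lifting) mem_Collect_eq subsetD)
  then obtain d :: "('a set set \<Rightarrow> rat) \<Rightarrow> int" and g where
    dg: "\<And>b. b \<in> B \<Longrightarrow> d b > 0 \<and> rscale (of_int (d b)) b = rat_fun (g b) \<and> g b \<in> chains ?S N" by metis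
  \<comment> \<open>Basis vectors with the same integral multiple would be proportional; injectivity
    is what gives the image the cardinality of the basis.\<close>
  have gi: "inj_on g B"
  proof (rule inj_onI, rule ccontr)
    fix b b' assume b: "b \<in> B" "b' \<in> B" "g b = g b'" "b \<noteq> b'"
    have "b = rscale (1 / of_int (d b)) (rscale (of_int (d b')) b')"
      using rscale_inverse[of "d b" b "rat_fun (g b)"] dg[OF b(1)] dg[OF b(2)] b(3) by simp
    also have "\<dots> \<in> rv.span (B - {b})" using b by (intro rv.span_scale rv.span_base) auto
    finally show False using B(2) b(1) by (auto simp: rv.dependent_def)
  qed
  have gI: "?I (g ` B)"
  proof (intro conjI allI impI ballI)
    show "finite (g ` B)" using fB by simp
    show "g ` B \<subseteq> cycles ?S N"
    proof
      fix c assume "c \<in> g ` B"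
      then obtain b where b: "b \<in> B" "c = g b" by blast
      have "rat_fun (poset_bdry P c) = rscale (of_int (d b)) (rat_bdry P b)"
        using dg[OF b(1)] b(2) by (metis rat_bdry_rat_fun l.scale)
      also have "\<dots> = 0" using B(1) b(1) by auto
      finally have "poset_bdry P c = (\<lambda>_. 0)" by (simp add: rat_fun_def fun_eq_iff)
      then show "c \<in> cycles ?S N" using dg[OF b(1)] b(2) by (simp add: cyc)
    qed
    fix a :: "('a set set \<Rightarrow> int) \<Rightarrow> int" and x
    assume s: "(\<lambda>\<tau>. \<Sum>x\<in>g ` B. a x * x \<tau>) = (\<lambda>_. 0)" and x: "x \<in> g ` B"
    have sumap: "(\<Sum>b\<in>T. rscale (of_int (a (g b)) * of_int (d b)) b) \<tau> = of_int (\<Sum>b\<in>T. a (g b) * g b \<tau>)"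
      if "finite T" "T \<subseteq> B" for T \<tau>
      using that
    proof induction
      case (insert b T)
      have "of_int (d b) * b \<tau> = of_int (g b \<tau>)"
        using dg[of b] insert.prems by (auto simp: rscale_def rat_fun_def fun_eq_iff)
      then show ?case using insert by (simp add: rscale_def mult.assoc)
    qed simp
    have ind: "\<forall>v\<in>B. u v = 0" if "(\<Sum>v\<in>B. rscale (u v) v) = 0" for u
      using B(2) that unfolding rv.dependent_finite[OF fB] by blast
    have "(\<Sum>b\<in>B. rscale (of_int (a (g b)) * of_int (d b)) b) = 0"
    proof
      fix \<tau>
      have "(\<Sum>b\<in>B. a (g b) * g b \<tau>) = 0"
        using fun_cong[OF s, of \<tau>] by (simp add: sum.reindex[OF gi])
      then show "(\<Sum>b\<in>B. rscale (of_int (a (g b)) * of_int (d b)) b) \<tau> = 0 \<tau>"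
        using sumap[OF fB subset_refl, of \<tau>] by simp
    qed
    from ind[OF this] have "\<forall>b\<in>B. of_int (a (g b)) * (of_int (d b) :: rat) = 0" .
    then show "a x = 0" using x dg by fastforce
  qed
  have "rv.dim ?Z = card (g ` B)" using card_image[OF gi] B(4) by (simp only:)
  then have "rv.dim ?Z \<in> {card A | A. ?I A}" using gI by (intro CollectI exI[of _ "g ` B"] conjI) simp_all
  moreover have "k \<le> rv.dim ?Z" if k: "k \<in> {card A | A. ?I A}" for k
  proof -
    from k obtain A where A: "k = card A \<and> ?I A" unfolding mem_Collect_eq by (rule exE)
    show ?thesis using upper[OF conjunct2[OF A]] conjunct1[OF A] by (simp only:)
  qed
  ultimately show ?thesis unfolding hr by (rule cSup_eq_maximum)
qed

lemma homology_rank_eq_euler: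
  assumes P: "finite P" and top: "\<And>\<sigma>. \<sigma> \<in> order_complex P \<Longrightarrow> card \<sigma> \<le> N" and ac: "acyclic_below P N"
  shows "int (homology_rank (order_complex P) N) = (-1) ^ N * (\<Sum>\<sigma>\<in>order_complex P. (-1) ^ card \<sigma>)"
proof -
  have "(\<Sum>\<sigma>\<in>order_complex P. (-1) ^ card \<sigma>) = (\<Sum>i\<le>N. \<Sum>\<sigma>\<in>{\<sigma>\<in>order_complex P. card \<sigma> = i}. (-1::int) ^ card \<sigma>)"
    using finite_order_complex[OF P] top by (intro sum.group[symmetric]) auto
  also have "\<dots> = (\<Sum>i\<le>N. (-1) ^ i * int (card {\<sigma>\<in>order_complex P. card \<sigma> = i}))"
    by (intro sum.cong) auto
  finally have e: "(\<Sum>\<sigma>\<in>order_complex P. (-1::int) ^ card \<sigma>)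
    = (\<Sum>i\<le>N. (-1) ^ i * int (card {\<sigma>\<in>order_complex P. card \<sigma> = i}))" .
  have "homology_rank (order_complex P) N = rv.dim {c\<in>qchains P N. rat_bdry P c = 0}"
    by (rule homology_rank_top[OF P top])
  then have "int (homology_rank (order_complex P) N)
    = (\<Sum>i\<le>N. (-1) ^ (i + N) * int (card {\<sigma>\<in>order_complex P. card \<sigma> = i}))"
    using dim_qcycles[OF P ac order_refl] by (simp only:)
  then show ?thesis unfolding e by (simp add: sum_distrib_left power_add mult_ac)
qed

section \<open>Free subquotients over a finite commutative ring\<close>

definition smul :: "'a::comm_ring_1 \<Rightarrow> (nat \<Rightarrow> 'a) \<Rightarrow> (nat \<Rightarrow> 'a)" where
  "smul r v = (\<lambda>j. r * v j)"

interpretation vec: module smul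
  by unfold_locales (auto simp: smul_def fun_eq_iff algebra_simps)

lemma span_subspace_id [simp]: "vec.subspace A \<Longrightarrow> vec.span A = A"
  by simp

text \<open>The powers of \<open>a\<close> are periodic from some exponent i on. An exponent k at
  least i and divisible by the period p satisfies \<open>a ^ (k + k) = a ^ k\<close>.\<close>

lemma finite_ring_idempotent_power:
  fixes a :: "'a::{comm_ring_1,finite}"
  obtains k where "k \<ge> 1" "a ^ k * a ^ k = a ^ k"
proof -
  have "\<not> inj (\<lambda>i::nat. a ^ i)"
    using finite_imageD[of "\<lambda>i. a ^ i" UNIV] by auto
  then obtain i j where "i < j" "a ^ i = a ^ j" unfolding inj_def by (metis linorder_neqE_nat)
  then obtain p where p: "p \<ge> 1" "a ^ i = a ^ (i + p)"
    by (metis le_add_diff_inverse less_imp_le_nat zero_less_diff less_one linorder_not_le)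
  have per: "a ^ (m + p * l) = a ^ m" if "m \<ge> i" for m l
  proof (induction l)
    case (Suc l)
    have "a ^ (m + p * Suc l) = a ^ (i + p) * a ^ (m - i + p * l)"
      using that by (simp add: power_add[symmetric] algebra_simps)
    also have "\<dots> = a ^ i * a ^ (m - i + p * l)" using p by simp
    also have "\<dots> = a ^ (m + p * l)" using that by (simp add: power_add[symmetric])
    finally show ?case using Suc by simp
  qed simp
  \<comment> \<open>A multiple of the period that is at least i and at least 1.\<close>
  let ?k = "p * (i + 1)"
  have "?k \<ge> 1 * (i + 1)" using p(1) by (intro mult_le_mono) auto
  then have "a ^ ?k * a ^ ?k = a ^ ?k" "?k \<ge> 1"
    using per[of ?k "i + 1"] by (auto simp: power_add[symmetric])
  then show ?thesis using that by blast
qed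

text \<open>If \<open>e\<close> is an idempotent power of \<open>a\<close>, then \<open>a\<close> is a unit on the \<open>e\<close>-part of the ring and
  nilpotent on the \<open>(1 - e)\<close>-part, where \<open>b\<close> is a unit; hence \<open>t = 1 - e\<close> works.\<close>
lemma finite_ring_stable_range_1:
  fixes a b x :: "'a::{comm_ring_1,finite}"
  assumes "x * a + b = 1"
  obtains t w where "(a + t * b) * w = 1"
proof -
  obtain k where k: "k \<ge> 1" "a ^ k * a ^ k = a ^ k" by (rule finite_ring_idempotent_power)
  define e u where "e = a ^ k" and "u = a + (1 - e) * b"
  have ee: "e * e = e" using k by (simp add: e_def)
  have zero: "z = 0" if "u * z = 0" for z
  proof -
    have "e * (u * z) = a * (e * z) + (e - e * e) * (b * z)" unfolding u_def by (simp add: algebra_simps)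
    then have "a * (e * z) = 0" using that ee by simp
    then have "a ^ k * (e * z) = 0" using k(1)
      by (metis (no_types, opaque_lifting) Suc_le_D One_nat_def power_Suc2 mult.assoc mult_zero_right)
    then have ez: "e * z = 0" using ee by (simp add: e_def mult.assoc[symmetric])
    have "u * z = a * z + b * z - b * (e * z)" unfolding u_def by (simp add: algebra_simps)
    then have "a * z + b * z = 0" using that ez by simp
    moreover have "b = 1 - x * a" using assms by (metis add_diff_cancel_left')
    \<comment> \<open>Iterating this identity k times produces the factor \<open>a ^ k\<close>, that
      is \<open>e\<close>, which is already known to kill z.\<close>
    ultimately have z: "z = ((x - 1) * a) * z" by (simp add: algebra_simps)
    have "z = ((x - 1) * a) ^ i * z" for i
    proof (induction i)
      case (Suc i) then show ?case using z by (metis mult.assoc power_Suc2)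
    qed simp
    from this[of k] have "z = (x - 1) ^ k * (e * z)" by (simp add: e_def power_mult_distrib mult.assoc)
    then show ?thesis using ez by simp
  qed
  have "inj (\<lambda>z. u * z)"
    by (rule injI) (metis zero right_diff_distrib eq_iff_diff_eq_0)
  then have "surj (\<lambda>z. u * z)" by (rule finite_UNIV_inj_surj[OF finite])
  then obtain w where "u * w = 1" by (metis surjD)
  then show ?thesis using that unfolding u_def by blast
qed

definition is_ideal :: "'a::comm_ring_1 set \<Rightarrow> bool" where
  "is_ideal I \<longleftrightarrow> 0 \<in> I \<and> (\<forall>a\<in>I. \<forall>b\<in>I. a + b \<in> I) \<and> (\<forall>r. \<forall>a\<in>I. r * a \<in> I)"

text \<open>Maximality is encoded as the quotient being a field: every element outside I has an
  inverse modulo I.\<close>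

definition maxspec :: "'a::comm_ring_1 set set" where
  "maxspec = {I. is_ideal I \<and> 1 \<notin> I \<and> (\<forall>a. a \<notin> I \<longrightarrow> (\<exists>b. 1 - a * b \<in> I))}"

lemma ideal_below_maximal:
  fixes J :: "'a::{comm_ring_1,finite} set"
  assumes "is_ideal J" "1 \<notin> J"
  obtains I where "I \<in> maxspec" "J \<subseteq> I"
proof -
  let ?F = "{I. is_ideal I \<and> 1 \<notin> I \<and> J \<subseteq> I}"
  have "\<exists>I\<in>?F. \<forall>I'\<in>?F. I \<subseteq> I' \<longrightarrow> I = I'"
    using assms by (intro finite_has_maximal) auto
  then obtain I where I0: "I \<in> ?F" "\<forall>I'\<in>?F. I \<subseteq> I' \<longrightarrow> I = I'" by (elim bexE)
  then have I: "is_ideal I" "1 \<notin> I" "J \<subseteq> I" by auto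
  have m: "I = I'" if "is_ideal I'" "1 \<notin> I'" "J \<subseteq> I'" "I \<subseteq> I'" for I'
    using I0(2) that by simp
  have "\<exists>b. 1 - a * b \<in> I" if a: "a \<notin> I" for a
  proof -
    let ?K = "{i + a * b | i b. i \<in> I}"
    have K: "is_ideal ?K" unfolding is_ideal_def
    proof (intro conjI ballI allI)
      show "0 \<in> ?K" using I(1) by (auto simp: is_ideal_def intro!: exI[of _ 0])
      fix x y r assume x: "x \<in> ?K"
      then obtain i b where xi: "x = i + a * b" "i \<in> I" by blast
      have "r * x = r * i + a * (r * b)" using xi by (simp add: algebra_simps)
      then show "r * x \<in> ?K" using xi I(1) unfolding is_ideal_def by blast
      assume "y \<in> ?K"
      then obtain i' b' where yi: "y = i' + a * b'" "i' \<in> I" by blast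
      have "x + y = (i + i') + a * (b + b')" using xi yi by (simp add: algebra_simps)
      then show "x + y \<in> ?K" using xi yi I(1) unfolding is_ideal_def by blast
    qed
    have IK: "I \<subseteq> ?K"
    proof
      fix i assume "i \<in> I"
      moreover have "i = i + a * 0" by simp
      ultimately show "i \<in> ?K" by blast
    qed
    have "a = 0 + a * 1" by simp
    then have "a \<in> ?K" using I(1) unfolding is_ideal_def by blast
    then have "1 \<in> ?K" using m[OF K] IK I(3) a by blast
    then obtain i b where "1 = i + a * b" "i \<in> I" by blast
    then show ?thesis by (metis add_diff_cancel_right')
  qed
  then show ?thesis using that[of I] I by (auto simp: maxspec_def)
qed

text \<open>If the coefficients generated a proper ideal, it would lie in a maximal ideal containing
  all of them.\<close>

lemma unimodular_coefficients:
  fixes \<alpha> :: "'b \<Rightarrow> 'a::{comm_ring_1,finite}"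
  assumes C: "finite C" and u: "\<And>I. I \<in> maxspec \<Longrightarrow> \<exists>c\<in>C. \<alpha> c \<notin> I"
  obtains x where "(\<Sum>c\<in>C. x c * \<alpha> c) = 1"
proof -
  let ?J = "{\<Sum>c\<in>C. x c * \<alpha> c | x. True}"
  have J: "is_ideal ?J" unfolding is_ideal_def
  proof (intro conjI ballI allI)
    show "0 \<in> ?J" by (auto intro!: exI[of _ "\<lambda>_. 0"])
    fix s t r assume s: "s \<in> ?J"
    then obtain x where x: "s = (\<Sum>c\<in>C. x c * \<alpha> c)" by blast
    show "r * s \<in> ?J" unfolding x
      by (auto intro!: exI[of _ "\<lambda>c. r * x c"] simp: sum_distrib_left mult.assoc)
    assume "t \<in> ?J"
    then obtain y where y: "t = (\<Sum>c\<in>C. y c * \<alpha> c)" by blast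
    show "s + t \<in> ?J" unfolding x y
      by (auto intro!: exI[of _ "\<lambda>c. x c + y c"] simp: sum.distrib distrib_right)
  qed
  have \<alpha>J: "\<alpha> c \<in> ?J" if "c \<in> C" for c
  proof -
    have "(\<Sum>d\<in>C. (if d = c then 1 else 0) * \<alpha> d) = (\<Sum>d\<in>C. if d = c then \<alpha> d else 0)"
      by (rule sum.cong) auto
    also have "\<dots> = \<alpha> c" using that C by simp
    finally show ?thesis by (intro CollectI exI conjI TrueI) (rule sym)
  qed
  have "1 \<in> ?J"
  proof (rule ccontr)
    assume "1 \<notin> ?J"
    then obtain I where I: "I \<in> maxspec" "?J \<subseteq> I" by (rule ideal_below_maximal[OF J])
    obtain c where "c \<in> C" "\<alpha> c \<notin> I" using u[OF I(1)] by blast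
    then show False using \<alpha>J[of c] I(2) by (meson subsetD)
  qed
  then obtain x where "1 = (\<Sum>c\<in>C. x c * \<alpha> c)" by (elim CollectE exE conjE)
  then show ?thesis using that[of x] by simp
qed

text \<open>\<open>B / A\<close> is free of rank \<open>r\<close>: over a finite ring, \<open>r\<close> generators of a
  module with \<open>|R|\<^sup>r\<close> elements are automatically independent.\<close>
definition free_ext :: "(nat \<Rightarrow> 'a::{comm_ring_1,finite}) set \<Rightarrow> (nat \<Rightarrow> 'a) set \<Rightarrow> nat \<Rightarrow> bool" where
  "free_ext A B r \<longleftrightarrow> vec.subspace A \<and> finite A \<and> card B = card (UNIV::'a set) ^ r * card A \<and>
     (\<exists>C. finite C \<and> card C \<le> r \<and> B = vec.span (A \<union> C))"

lemma ring_card_ge_2: "card (UNIV::'a::{comm_ring_1,finite} set) \<ge> 2"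
proof -
  have "card {0::'a, 1} \<le> card (UNIV::'a set)" by (rule card_mono) auto
  then show ?thesis by simp
qed

lemma subspace_card_pos: "vec.subspace A \<Longrightarrow> finite A \<Longrightarrow> card A > 0"
  using vec.subspace_0[of A] by (auto simp: card_gt_0_iff)

lemma mem_span_insert:
  assumes "vec.subspace A" shows "x \<in> vec.span (insert c A) \<longleftrightarrow> (\<exists>k. x - smul k c \<in> A)"
  using assms by (simp add: vec.span_breakdown_eq)

lemma span_insert_image:
  assumes "vec.subspace A" shows "vec.span (insert c A) = (\<lambda>(k, a). a + smul k c) ` (UNIV \<times> A)"
proof (intro set_eqI iffI)
  fix x assume "x \<in> vec.span (insert c A)"
  then obtain k where "x - smul k c \<in> A" using assms by (auto simp: mem_span_insert)
  then show "x \<in> (\<lambda>(k, a). a + smul k c) ` (UNIV \<times> A)"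
    by (intro image_eqI[of _ _ "(k, x - smul k c)"]) auto
next
  fix x assume "x \<in> (\<lambda>(k, a). a + smul k c) ` (UNIV \<times> A)"
  then obtain k a where "x = a + smul k c" "a \<in> A" by auto
  then have "x - smul k c \<in> A" by simp
  then show "x \<in> vec.span (insert c A)" using assms by (auto simp: mem_span_insert)
qed

lemma finite_span_insert:
  fixes A :: "(nat \<Rightarrow> 'a::{comm_ring_1,finite}) set"
  shows "vec.subspace A \<Longrightarrow> finite A \<Longrightarrow> finite (vec.span (insert c A))"
  by (simp add: span_insert_image)

lemma card_span_insert_le:
  fixes A :: "(nat \<Rightarrow> 'a::{comm_ring_1,finite}) set"
  assumes "vec.subspace A" "finite A"
  shows "card (vec.span (insert c A)) \<le> card (UNIV::'a set) * card A"
  unfolding span_insert_image[OF assms(1)]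
  using card_image_le[of "(UNIV::'a set) \<times> A" "\<lambda>(k, a). a + smul k c"] assms(2)
  by (simp add: card_cartesian_product)

lemma span_insert_span_Un: "vec.span (insert c (vec.span (A \<union> C))) = vec.span (A \<union> insert c C)"
  by (auto simp: vec.span_breakdown_eq vec.span_span)

lemma card_span_Un_le:
  fixes A :: "(nat \<Rightarrow> 'a::{comm_ring_1,finite}) set"
  assumes "vec.subspace A" "finite A" "finite C"
  shows "finite (vec.span (A \<union> C)) \<and>
    card (vec.span (A \<union> C)) \<le> card (UNIV::'a set) ^ card C * card A"
  using assms(3)
proof induction
  case empty then show ?case using assms by simp
next
  case (insert c C)
  have "finite (vec.span (A \<union> insert c C))"
    using finite_span_insert[of "vec.span (A \<union> C)" c] insert by (simp add: span_insert_span_Un)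
  moreover have "card (vec.span (A \<union> insert c C)) \<le> card (UNIV::'a set) * card (vec.span (A \<union> C))"
    using card_span_insert_le[of "vec.span (A \<union> C)" c] insert by (simp add: span_insert_span_Un)
  ultimately show ?case using insert
    by (auto simp: mult.assoc elim!: order_trans intro: mult_le_mono2)
qed

lemma free_ext_subspace: "free_ext A B r \<Longrightarrow> vec.subspace A" "free_ext A B r \<Longrightarrow> vec.subspace B"
  by (auto simp: free_ext_def)

lemma free_ext_finite: "free_ext A B r \<Longrightarrow> finite A" "free_ext A B r \<Longrightarrow> finite B"
  using card_span_Un_le by (auto simp: free_ext_def)

lemma free_ext_subset: "free_ext A B r \<Longrightarrow> A \<subseteq> B"
  by (auto simp: free_ext_def intro: vec.span_base)

lemma free_ext_card:
  "free_ext A (B :: (nat \<Rightarrow> 'a::{comm_ring_1,finite}) set) r \<Longrightarrow> card B = card (UNIV::'a set) ^ r * card A"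
  by (auto simp: free_ext_def)

text \<open>Fewer than r generators would span fewer than \<open>|R|^r * |A|\<close> elements, so
  the bound on the number of generators is attained.\<close>

lemma free_ext_basis:
  assumes "free_ext A B r"
  obtains C where "finite C" "card C = r" "B = vec.span (A \<union> C)"
proof -
  obtain C where C: "finite C" "card C \<le> r" "B = vec.span (A \<union> C)" using assms by (auto simp: free_ext_def)
  have "card (UNIV::'a set) ^ r * card A \<le> card (UNIV::'a set) ^ card C * card A"
    using card_span_Un_le[of A C] assms C by (auto simp: free_ext_def)
  then have "card (UNIV::'a set) ^ r \<le> card (UNIV::'a set) ^ card C"
    using subspace_card_pos[of A] assms by (auto simp: free_ext_def)
  then have "r \<le> card C" using ring_card_ge_2[where 'a = 'a] by (simp add: power_increasing_iff)
  then show ?thesis using that C by auto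
qed

lemma free_ext_refl: "vec.subspace A \<Longrightarrow> finite A \<Longrightarrow> free_ext A A 0"
  by (auto simp: free_ext_def)

lemma free_ext_0D: "free_ext A B 0 \<Longrightarrow> A = B"
  by (auto simp: free_ext_def)

lemma free_ext_trans:
  assumes "free_ext A B r" "free_ext B D s" shows "free_ext A D (r + s)"
proof -
  obtain C where C: "finite C" "card C = r" "B = vec.span (A \<union> C)" using free_ext_basis[OF assms(1)] .
  obtain C' where C': "finite C'" "card C' = s" "D = vec.span (B \<union> C')" using free_ext_basis[OF assms(2)] .
  have "vec.span (B \<union> C') = vec.span (A \<union> (C \<union> C'))"
  proof (rule vec.span_eq[THEN iffD2], intro conjI Un_least)
    show "B \<subseteq> vec.span (A \<union> (C \<union> C'))" unfolding C by (rule vec.span_mono) auto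
    have "A \<subseteq> B" "C \<subseteq> B" unfolding C by (auto intro: vec.span_base)
    then show "A \<subseteq> vec.span (B \<union> C')" "C \<subseteq> vec.span (B \<union> C')" by (auto intro: vec.span_base)
  qed (auto intro: vec.span_base)
  moreover have "card (C \<union> C') \<le> r + s" using card_Un_le[of C C'] C C' by simp
  ultimately show ?thesis using assms C C'
    unfolding free_ext_def by (auto simp: power_add mult_ac intro!: exI[of _ "C \<union> C'"])
qed

lemma free_ext_unique:
  assumes "free_ext A B r" "free_ext A B s" shows "r = s"
proof -
  have "card (UNIV::'a set) ^ r = card (UNIV::'a set) ^ s"
    using assms free_ext_card[OF assms(1)] free_ext_card[OF assms(2)] subspace_card_pos[of A]
    by (auto simp: free_ext_def)
  then show ?thesis using ring_card_ge_2[where 'a = 'a] by (simp add: power_inject_exp)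
qed

lemma free_ext_eq_iff:
  assumes "free_ext A B r" shows "r = 0 \<longleftrightarrow> A = B"
  using assms free_ext_unique[of A B r 0] free_ext_refl[of A] free_ext_0D free_ext_subspace(1) free_ext_finite(1)
  by metis

text \<open>Adjoining v multiplies the size by at most \<open>|R|\<close>, and adjoining
  \<open>C\<close> by at most \<open>|R|^r\<close>. The size of \<open>B\<close> is the product of
  both bounds, so both are attained.\<close>

lemma free_ext_split:
  fixes A :: "(nat \<Rightarrow> 'a::{comm_ring_1,finite}) set"
  assumes "vec.subspace A" "finite A" "card B = card (UNIV::'a set) ^ Suc r * card A"
    and "finite C" "card C \<le> r" "B = vec.span (vec.span (insert v A) \<union> C)"
  shows "free_ext A (vec.span (insert v A)) 1" "free_ext (vec.span (insert v A)) B r"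
proof -
  let ?q = "card (UNIV::'a set)" let ?A = "vec.span (insert v A)"
  have fin: "finite ?A" by (rule finite_span_insert[OF assms(1,2)])
  have "card B \<le> ?q ^ card C * card ?A" using card_span_Un_le[of ?A C] fin assms by simp
  also have "\<dots> \<le> ?q ^ r * card ?A" using assms ring_card_ge_2[where 'a = 'a] by (intro mult_le_mono1 power_increasing) auto
  finally have le: "?q ^ r * (?q * card A) \<le> ?q ^ r * card ?A" using assms by (simp add: mult_ac)
  then have "?q * card A \<le> card ?A" using ring_card_ge_2[where 'a = 'a] by simp
  then have eq: "card ?A = ?q * card A" using card_span_insert_le[OF assms(1,2), of v] by simp
  show "free_ext A ?A 1" using eq assms unfolding free_ext_def by (auto intro!: exI[of _ "{v}"])
  show "free_ext ?A B r" using eq assms fin unfolding free_ext_def by (auto simp: mult_ac)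
qed

lemma free_ext_1_scalar:
  fixes A :: "(nat \<Rightarrow> 'a::{comm_ring_1,finite}) set"
  assumes "free_ext A B 1" "B = vec.span (insert v A)" "smul k v \<in> A"
  shows "k = 0"
proof -
  have A: "vec.subspace A" "finite A" using assms free_ext_subspace free_ext_finite by blast+
  let ?f = "\<lambda>(k, a). a + smul k v"
  have "card (?f ` (UNIV \<times> A)) = card ((UNIV::'a set) \<times> A)"
    using free_ext_card[OF assms(1)] assms(2) A by (simp add: span_insert_image card_cartesian_product)
  then have inj: "inj_on ?f ((UNIV::'a set) \<times> A)" using A by (intro eq_card_imp_inj_on) auto
  have eq: "?f (k, - smul k v) = ?f (0, 0)" by simp
  have "(k, - smul k v) = (0, 0)"
    by (rule inj_onD[OF inj eq])
      (use assms(3) vec.subspace_0[OF A(1)] vec.subspace_neg[OF A(1)] in blast)+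
  then show ?thesis by simp
qed

text \<open>A vector with unimodular coordinates modulo \<open>A\<close> belongs to a basis of D /
  A. Stable range 1 supplies an elementary change of basis after which the coordinate of v at
  \<open>c0\<close> is a unit; then v can take the place of \<open>c0\<close>.\<close>

lemma free_ext_exchange:
  fixes A :: "(nat \<Rightarrow> 'a::{comm_ring_1,finite}) set"
  assumes fe: "free_ext A D r" and C: "finite C" "card C = r" "D = vec.span (A \<union> C)"
    and v: "v = a + (\<Sum>c\<in>C. smul (\<alpha> c) c)" "a \<in> A" and x: "(\<Sum>c\<in>C. x c * \<alpha> c) = 1"
  shows "r \<ge> 1" "free_ext A (vec.span (insert v A)) 1" "free_ext (vec.span (insert v A)) D (r - 1)"
proof -
  have "C \<noteq> {}" using x by auto
  then obtain c0 where c0: "c0 \<in> C" by blast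
  let ?C = "C - {c0}"
  define b where "b = (\<Sum>c\<in>?C. x c * \<alpha> c)"
  have "x c0 * \<alpha> c0 + b = 1" using x C c0 by (simp add: b_def sum.remove)
  then obtain t w where tw: "(\<alpha> c0 + t * b) * w = 1" by (rule finite_ring_stable_range_1)
  \<comment> \<open>In terms of \<open>c0\<close> and the \<open>g c\<close>, the coordinate of v at
    \<open>c0\<close> becomes the unit \<open>\<alpha> c0 + t * b\<close>, while the other
    coordinates stay the same.\<close>
  define g where "g = (\<lambda>c. c - smul (t * x c) c0)"
  let ?A = "vec.span (insert v A)"
  have r: "r = Suc (card ?C)" using C c0 by (metis card_Suc_Diff1)
  have vD: "v \<in> D" unfolding v C(3)
    using v(2) by (intro vec.span_add vec.span_sum vec.span_scale vec.span_base) auto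
  have D: "vec.subspace D" using fe free_ext_subspace by blast
  have sub: "?A \<subseteq> D" using vD free_ext_subset[OF fe] D by (intro vec.span_minimal) auto
  have CD: "C \<subseteq> D" unfolding C(3) by (auto intro: vec.span_base)
  let ?E = "vec.span (?A \<union> g ` ?C)"
  have vE: "v \<in> ?E" and AE: "A \<subseteq> ?E" by (auto intro!: vec.span_base)
  have gE: "g c \<in> ?E" if "c \<in> ?C" for c using that by (auto intro!: vec.span_base)
  have "smul (\<alpha> c0 + t * b) c0 = v - a - (\<Sum>c\<in>?C. smul (\<alpha> c) (g c))"
  proof -
    have "(\<Sum>c\<in>?C. smul (\<alpha> c) (g c)) = (\<Sum>c\<in>?C. smul (\<alpha> c) c) - (\<Sum>c\<in>?C. smul (t * (x c * \<alpha> c)) c0)"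
      unfolding g_def by (simp add: sum_subtractf vec.scale_right_diff_distrib mult_ac)
    also have "(\<Sum>c\<in>?C. smul (t * (x c * \<alpha> c)) c0) = smul (t * b) c0"
      unfolding b_def sum_distrib_left by (simp add: vec.scale_sum_left)
    finally have 1: "(\<Sum>c\<in>?C. smul (\<alpha> c) (g c)) = (\<Sum>c\<in>?C. smul (\<alpha> c) c) - smul (t * b) c0" .
    have 2: "v = a + (smul (\<alpha> c0) c0 + (\<Sum>c\<in>?C. smul (\<alpha> c) c))" unfolding v using C c0 by (simp add: sum.remove)
    show ?thesis unfolding 1 2 vec.scale_left_distrib by (simp add: fun_eq_iff)
  qed
  also have "\<dots> \<in> ?E" using vE AE v(2) gE by (intro vec.span_diff vec.span_sum vec.span_scale) auto
  finally have "smul w (smul (\<alpha> c0 + t * b) c0) \<in> ?E" by (rule vec.span_scale)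
  then have c0E: "c0 \<in> ?E" using tw by (simp add: mult.commute[of w])
  have "c \<in> ?E" if "c \<in> C" for c
  proof (cases "c = c0")
    case False
    have "c = g c + smul (t * x c) c0" by (simp add: g_def)
    then show ?thesis using gE[of c] c0E that False by (metis DiffI singletonD vec.span_add vec.span_scale)
  qed (use c0E in simp)
  then have "D \<subseteq> ?E" unfolding C(3) using AE by (intro vec.span_minimal) auto
  moreover have "?E \<subseteq> D"
  proof (rule vec.span_minimal[OF _ D])
    show "?A \<union> g ` ?C \<subseteq> D" using sub CD D c0
      by (auto simp: g_def intro!: vec.subspace_diff vec.subspace_scale)
  qed
  ultimately have DE: "D = ?E" by blast
  have "card (g ` ?C) \<le> card ?C" using C by (simp add: card_image_le)
  note split = free_ext_split[OF free_ext_subspace(1)[OF fe] free_ext_finite(1)[OF fe]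
      free_ext_card[OF fe, unfolded r] _ this DE]
  show "r \<ge> 1" "free_ext A ?A 1" "free_ext ?A D (r - 1)"
    using split C(1) r by simp_all
qed

lemma span_Un_finiteE:
  assumes "vec.subspace A" "finite C" "v \<in> vec.span (A \<union> C)"
  obtains a \<alpha> where "a \<in> A" "v = a + (\<Sum>c\<in>C. smul (\<alpha> c) c)"
  using assms by (auto simp: vec.span_Un vec.span_finite)

text \<open>This is A + ID. For A inside D it is the preimage of the image of A in D / ID, so
  non-membership is a condition over the residue field.\<close>

definition residual :: "(nat \<Rightarrow> 'a::comm_ring_1) set \<Rightarrow> 'a set \<Rightarrow> (nat \<Rightarrow> 'a) set \<Rightarrow> (nat \<Rightarrow> 'a) set" where
  "residual D I A = vec.span (A \<union> {smul r d | r d. r \<in> I \<and> d \<in> D})"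

text \<open>If all coordinates of v lay in one maximal ideal I, then v would lie in A + ID. So the
  coordinates are unimodular and the exchange applies.\<close>

lemma free_ext_insert_unimodular:
  fixes A :: "(nat \<Rightarrow> 'a::{comm_ring_1,finite}) set"
  assumes fe: "free_ext A D r" and v: "v \<in> D" "\<And>I. I \<in> maxspec \<Longrightarrow> v \<notin> residual D I A"
  shows "r \<ge> 1" "free_ext A (vec.span (insert v A)) 1" "free_ext (vec.span (insert v A)) D (r - 1)"
proof -
  obtain C where C: "finite C" "card C = r" "D = vec.span (A \<union> C)" using free_ext_basis[OF fe] .
  obtain a \<alpha> where a: "a \<in> A" "v = a + (\<Sum>c\<in>C. smul (\<alpha> c) c)"
    using span_Un_finiteE[of A C v] v C free_ext_subspace[OF fe] by metis
  have "\<exists>c\<in>C. \<alpha> c \<notin> I" if I: "I \<in> maxspec" for I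
  proof (rule ccontr)
    assume "\<not> ?thesis"
    moreover have "C \<subseteq> D" unfolding C by (auto intro: vec.span_base)
    ultimately have "v \<in> residual D I A" unfolding residual_def a(2)
      using a(1) by (intro vec.span_add vec.span_sum vec.span_base) auto
    then show False using v(2)[OF I] by blast
  qed
  then obtain x where "(\<Sum>c\<in>C. x c * \<alpha> c) = 1" using unimodular_coefficients[OF C(1)] by metis
  then show "r \<ge> 1" "free_ext A (vec.span (insert v A)) 1" "free_ext (vec.span (insert v A)) D (r - 1)"
    using free_ext_exchange[OF fe C a(2,1)] by blast+
qed

text \<open>With D = U + Rv, the coefficient of v modulo U is a linear functional taking the value 1
  at v; its values on a basis of D / A show that the coordinates of v are unimodular. Hence D / (A +
  Rv) is free of rank r - 1, and this quotient is isomorphic to U / A.\<close>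

lemma free_ext_cancel_1:
  fixes A :: "(nat \<Rightarrow> 'a::{comm_ring_1,finite}) set"
  assumes A1: "free_ext A D r" and U: "free_ext U D 1" "A \<subseteq> U"
  shows "r \<ge> 1" "free_ext A U (r - 1)"
proof -
  obtain C where C: "finite C" "card C = r" "D = vec.span (A \<union> C)" using free_ext_basis[OF A1] .
  obtain V where "card V = 1" "D = vec.span (U \<union> V)" using free_ext_basis[OF U(1)] by metis
  then obtain v where v: "D = vec.span (insert v U)" by (auto simp: card_1_singleton_iff)
  have su: "vec.subspace U" "vec.subspace A" "vec.subspace D"
    using U A1 free_ext_subspace by blast+
  note free1 = free_ext_1_scalar[OF U(1) v]
  have dec: "\<exists>\<gamma>. d - smul \<gamma> v \<in> U" if "d \<in> D" for d
    using that su unfolding v by (simp add: vec.span_breakdown_eq)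
  then obtain \<gamma> where \<gamma>: "\<And>d. d \<in> D \<Longrightarrow> d - smul (\<gamma> d) v \<in> U" by metis
  have CD: "C \<subseteq> D" unfolding C by (auto intro: vec.span_base)
  have vD: "v \<in> D" unfolding v by (auto intro: vec.span_base)
  obtain a \<alpha> where a: "a \<in> A" "v = a + (\<Sum>c\<in>C. smul (\<alpha> c) c)"
    using span_Un_finiteE[of A C v] vD C su by metis
  \<comment> \<open>The right side lies in \<open>U\<close>, and no nonzero multiple of v does; this
    is where the relation for the exchange comes from.\<close>
  have "smul (1 - (\<Sum>c\<in>C. \<gamma> c * \<alpha> c)) v = a + (\<Sum>c\<in>C. smul (\<alpha> c) (c - smul (\<gamma> c) v))"
    by (subst (1) vec.scale_left_diff_distrib, subst (1) vec.scale_one, subst (1) a(2))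
      (simp add: vec.scale_right_diff_distrib sum_subtractf vec.scale_sum_left[symmetric] mult.commute)
  also have "\<dots> \<in> U" using a U(2) \<gamma> CD su(1)
    by (intro vec.subspace_add vec.subspace_sum vec.subspace_scale) auto
  finally have "(\<Sum>c\<in>C. \<gamma> c * \<alpha> c) = 1" using free1 by fastforce
  note ex = free_ext_exchange[OF A1 C a(2,1) this]
  show "r \<ge> 1" by (rule ex)
  obtain C' where C': "finite C'" "card C' = r - 1" "D = vec.span (vec.span (insert v A) \<union> C')"
    using free_ext_basis[OF ex(3)] .
  have CD': "C' \<subseteq> D" unfolding C' by (auto intro: vec.span_base)
  \<comment> \<open>Translation along v moves the basis of D / (A + Rv) into
    \<open>U\<close>.\<close>
  let ?g = "\<lambda>c. c - smul (\<gamma> c) v"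
  let ?E = "vec.span (A \<union> ?g ` C')"
  have EU: "?E \<subseteq> U" using U(2) \<gamma> CD' su by (intro vec.span_minimal) auto
  have "D \<subseteq> vec.span (insert v ?E)"
  proof -
    have A: "A \<subseteq> vec.span (insert v ?E)" by (auto intro!: vec.span_base)
    moreover have v': "v \<in> vec.span (insert v ?E)" by (auto intro!: vec.span_base)
    moreover have "c \<in> vec.span (insert v ?E)" if "c \<in> C'" for c
    proof -
      have "?g c \<in> vec.span (insert v ?E)" using that by (auto intro!: vec.span_base)
      then have "?g c + smul (\<gamma> c) v \<in> vec.span (insert v ?E)" using v' vec.span_add vec.span_scale by blast
      then show ?thesis by simp
    qed
    ultimately show ?thesis unfolding C'(3) by (intro vec.span_minimal Un_least) auto
  qed
  have "U \<subseteq> ?E"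
  proof
    fix u assume u: "u \<in> U"
    then have "u \<in> D" using free_ext_subset[OF U(1)] by blast
    then have "u \<in> vec.span (insert v ?E)" using \<open>D \<subseteq> vec.span (insert v ?E)\<close> by blast
    then obtain k where k: "u - smul k v \<in> ?E" unfolding mem_span_insert[OF vec.subspace_span] by blast
    then have "u - (u - smul k v) \<in> U" using EU u su by (blast intro: vec.subspace_diff)
    then have "k = 0" using free1 by simp
    then show "u \<in> ?E" using k by (simp add: vec.scale_zero_left)
  qed
  then have UE: "U = ?E" using EU by blast
  have "card (UNIV::'a set) * card U = card (UNIV::'a set) * (card (UNIV::'a set) ^ (r - 1) * card A)"
    using free_ext_card[OF U(1)] free_ext_card[OF A1] ex(1) by (simp add: power_eq_if)
  then have "card U = card (UNIV::'a set) ^ (r - 1) * card A"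
    using ring_card_ge_2[where 'a = 'a] by simp
  moreover have "card (?g ` C') \<le> r - 1" using C' card_image_le by metis
  ultimately show "free_ext A U (r - 1)" using UE C' su(2) free_ext_finite[OF A1] unfolding free_ext_def by blast
qed

text \<open>Cancellation for stably free modules: the basis vectors of D / U are split off one at a
  time, each by the rank 1 case.\<close>

lemma free_ext_cancel:
  fixes A :: "(nat \<Rightarrow> 'a::{comm_ring_1,finite}) set"
  assumes A: "free_ext A D r" and U: "free_ext U D s" "A \<subseteq> U"
  shows "s \<le> r \<and> free_ext A U (r - s)"
  using U
proof (induction s arbitrary: U)
  case 0 then show ?case using A free_ext_0D by (metis diff_zero zero_le)
next
  case (Suc s)
  obtain C where C: "finite C" "card C = Suc s" "D = vec.span (U \<union> C)" using free_ext_basis[OF Suc.prems(1)] .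
  then obtain v C' where v: "C = insert v C'" "v \<notin> C'" "card C' = s" "finite C'"
    by (metis card_Suc_eq finite_insert)
  let ?U = "vec.span (insert v U)"
  have "D = vec.span (?U \<union> C')"
  proof -
    have "vec.span (?U \<union> C') = vec.span (insert v U \<union> C')"
    proof (rule vec.span_eq[THEN iffD2], intro conjI Un_least)
      show "?U \<subseteq> vec.span (insert v U \<union> C')" by (rule vec.span_mono) auto
    qed (auto intro!: vec.span_base)
    then show ?thesis using C v by simp
  qed
  then have s: "free_ext U ?U 1" "free_ext ?U D s"
    using free_ext_split[of U D s C' v] Suc.prems v by (auto simp: free_ext_def)
  have "A \<subseteq> ?U" using Suc.prems free_ext_subset[OF s(1)] by blast
  from Suc.IH[OF s(2) this] have ih: "s \<le> r" "free_ext A ?U (r - s)" by auto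
  show ?case using free_ext_cancel_1[OF ih(2) s(1) Suc.prems(2)] by auto
qed

section \<open>Reduction modulo the maximal ideals\<close>

text \<open>Only the quotient is mentioned. By cancellation, nested members of this class have free
  subquotients, so the class carries all ranks used in the induction.\<close>

definition cofree :: "(nat \<Rightarrow> 'a::{comm_ring_1,finite}) set \<Rightarrow> (nat \<Rightarrow> 'a) set \<Rightarrow> bool" where
  "cofree D W \<longleftrightarrow> (\<exists>s. free_ext W D s)"

lemma cofree_free_ext:
  assumes "cofree D A" "cofree D B" "A \<subseteq> B" obtains r where "free_ext A B r"
  using assms free_ext_cancel unfolding cofree_def by blast

lemma cofree_trans: "free_ext A B r \<Longrightarrow> cofree D B \<Longrightarrow> cofree D A"
  unfolding cofree_def using free_ext_trans by blast

lemma cofree_subspace: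
  assumes "cofree D A" shows "vec.subspace A" "vec.subspace D" "finite D" "finite A" "A \<subseteq> D"
  using assms free_ext_subspace free_ext_finite free_ext_subset unfolding cofree_def by blast+

lemma maxspecD:
  assumes "I \<in> maxspec"
  shows "0 \<in> I" "1 \<notin> I" "a \<in> I \<Longrightarrow> b \<in> I \<Longrightarrow> a + b \<in> I" "a \<in> I \<Longrightarrow> r * a \<in> I" "a \<in> I \<Longrightarrow> a * r \<in> I"
    "a \<notin> I \<Longrightarrow> \<exists>b. 1 - a * b \<in> I"
proof -
  show 4: "a \<in> I \<Longrightarrow> r * a \<in> I" using assms by (auto simp: maxspec_def is_ideal_def)
  then show "a \<in> I \<Longrightarrow> a * r \<in> I" by (subst mult.commute)
qed (use assms in \<open>auto simp: maxspec_def is_ideal_def\<close>)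

lemma maxspec_prime:
  assumes I: "I \<in> maxspec" and "a \<notin> I" "b \<notin> I" shows "a * b \<notin> I"
proof
  assume ab: "a * b \<in> I"
  obtain c where c: "1 - a * c \<in> I" using maxspecD(6)[OF I assms(2)] by blast
  have "b = b * (1 - a * c) + c * (a * b)" by (simp add: algebra_simps)
  then have "b \<in> I" using c ab maxspecD(3,4)[OF I] by metis
  then show False using assms by blast
qed

lemma maxspec_not_subset:
  assumes "I \<in> maxspec" "J \<in> maxspec" "J \<noteq> I" shows "\<exists>y. y \<in> J \<and> y \<notin> I"
proof (rule ccontr)
  assume "\<not> ?thesis"
  then have sub: "J \<subseteq> I" by blast
  then obtain a where a: "a \<in> I" "a \<notin> J" using assms by blast
  obtain b where "1 - a * b \<in> J" using maxspecD(6)[OF assms(2) a(2)] by blast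
  then have "(1 - a * b) + a * b \<in> I" using sub a maxspecD(3,5)[OF assms(1)] by blast
  then show False using maxspecD(2)[OF assms(1)] by simp
qed

text \<open>A product of elements taken from the other maximal ideals stays outside I because I is
  prime, and it can be rescaled to 1 modulo I. These elements glue choices made separately at each
  maximal ideal.\<close>

lemma maxspec_separating:
  assumes I: "(I :: 'a::{comm_ring_1,finite} set) \<in> maxspec"
  shows "\<exists>x. 1 - x \<in> I \<and> (\<forall>J\<in>maxspec. J \<noteq> I \<longrightarrow> x \<in> J)"
proof -
  obtain y where y: "\<And>J. J \<in> maxspec \<Longrightarrow> J \<noteq> I \<Longrightarrow> y J \<in> J \<and> y J \<notin> I"
    using maxspec_not_subset[OF I] by metis
  let ?z = "\<lambda>S. \<Prod>J\<in>S. y J"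
  have "?z S \<notin> I" if "S \<subseteq> maxspec - {I}" for S
    using finite[of S] that
  proof induction
    case empty then show ?case using maxspecD(2)[OF I] by simp
  next
    case (insert J S) then show ?case using maxspec_prime[OF I] y by auto
  qed
  then obtain b where b: "1 - ?z (maxspec - {I}) * b \<in> I" using maxspecD(6)[OF I] by blast
  have "?z (maxspec - {I}) * b \<in> J" if J: "J \<in> maxspec" "J \<noteq> I" for J
  proof -
    have "?z (maxspec - {I}) = y J * ?z (maxspec - {I} - {J})"
      using J by (intro prod.remove) auto
    then show ?thesis using y[OF J] maxspecD(5)[OF J(1)] by (simp add: mult.assoc)
  qed
  then show ?thesis using b by blast
qed

lemma residual_subspace [simp]: "vec.subspace (residual D I A)"
  by (simp add: residual_def)

lemma residual_mono: "A \<subseteq> B \<Longrightarrow> residual D I A \<subseteq> residual D I B"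
  unfolding residual_def by (rule vec.span_mono) auto

lemma residual_smul: "r \<in> I \<Longrightarrow> d \<in> D \<Longrightarrow> smul r d \<in> residual D I A"
  by (auto simp: residual_def intro!: vec.span_base)

lemma residual_subset: "vec.subspace D \<Longrightarrow> A \<subseteq> D \<Longrightarrow> residual D I A \<subseteq> D"
  unfolding residual_def by (rule vec.span_minimal) (auto intro: vec.subspace_scale)

lemma residual_span_insert:
  "y \<in> residual D I (vec.span (insert v A)) \<longleftrightarrow> (\<exists>k. y - smul k v \<in> residual D I A)"
proof -
  let ?S = "{smul r d | r d. r \<in> I \<and> d \<in> D}"
  have "vec.span (vec.span (insert v A) \<union> ?S) = vec.span (insert v (A \<union> ?S))"
  proof (rule vec.span_eq[THEN iffD2], intro conjI Un_least)
    show "vec.span (insert v A) \<subseteq> vec.span (insert v (A \<union> ?S))" by (rule vec.span_mono) auto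
    show "?S \<subseteq> vec.span (insert v (A \<union> ?S))" by (rule order_trans[OF _ vec.span_superset]) auto
    have "insert v A \<subseteq> vec.span (insert v A)" by (rule vec.span_superset)
    then show "insert v (A \<union> ?S) \<subseteq> vec.span (vec.span (insert v A) \<union> ?S)"
      by (intro order_trans[OF _ vec.span_superset]) auto
  qed
  then show ?thesis unfolding residual_def by (simp add: vec.span_breakdown_eq)
qed

text \<open>A scalar outside I is invertible modulo I, and the error term lies in ID; so v itself
  would be residual.\<close>

lemma residual_scalar:
  assumes I: "I \<in> maxspec" and v: "v \<in> D" "v \<notin> residual D I A" "smul k v \<in> residual D I A"
  shows "k \<in> I"
proof (rule ccontr)
  assume "k \<notin> I"
  then obtain b where b: "1 - k * b \<in> I" using maxspecD(6)[OF I] by blast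
  have "v = smul b (smul k v) + smul (1 - k * b) v"
    by (simp add: vec.scale_left_diff_distrib mult.commute)
  also have "\<dots> \<in> residual D I A"
    by (intro vec.subspace_add[OF residual_subspace vec.subspace_scale[OF residual_subspace v(3)]]
        residual_smul[OF b v(1)])
  finally show False using v by blast
qed

text \<open>A basis vector c of a free extension is nonzero in the residue space. Extending c to a
  basis of D / U and collecting the other basis vectors gives a complement \<open>?U\<close> in
  which c has no nonzero multiple; membership of c in U + ID would give (1 - k) c in
  \<open>?U\<close> with k in I.\<close>

lemma residual_free_ext_1:
  fixes U :: "(nat \<Rightarrow> 'a::{comm_ring_1,finite}) set"
  assumes I: "I \<in> maxspec" and U: "free_ext U (vec.span (insert c U)) 1"
    and co: "cofree D (vec.span (insert c U))"
  shows "c \<notin> residual D I U"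
proof
  assume cr: "c \<in> residual D I U"
  let ?B = "vec.span (insert c U)"
  obtain s where s: "free_ext ?B D s" using co by (auto simp: cofree_def)
  obtain C where C: "finite C" "card C = s" "D = vec.span (?B \<union> C)" using free_ext_basis[OF s] .
  have su: "vec.subspace U" "finite U" using U free_ext_subspace free_ext_finite by blast+
  let ?U = "vec.span (U \<union> C)"
  have fin: "finite ?U" and card: "card ?U \<le> card (UNIV::'a set) ^ s * card U"
    using card_span_Un_le[OF su C(1)] C(2) by auto
  have D: "D = vec.span (insert c ?U)"
    unfolding C(3)
  proof (rule vec.span_eq[THEN iffD2], intro conjI Un_least insert_subsetI)
    have UC: "U \<subseteq> ?U" "C \<subseteq> ?U" by (auto intro: vec.span_base)
    then show "?B \<subseteq> vec.span (insert c ?U)" by (intro vec.span_mono) auto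
    show "C \<subseteq> vec.span (insert c ?U)" using UC by (intro order_trans[OF _ vec.span_superset]) auto
    have B: "insert c U \<subseteq> ?B" by (rule vec.span_superset)
    then show "c \<in> vec.span (?B \<union> C)" by (auto intro: vec.span_base)
    show "?U \<subseteq> vec.span (?B \<union> C)" using B by (intro vec.span_mono) auto
  qed
  have "card D = card (UNIV::'a set) ^ Suc s * card U"
    using free_ext_card[OF free_ext_trans[OF U s]] by simp
  moreover have "card D \<le> card (UNIV::'a set) * card ?U"
    unfolding D by (rule card_span_insert_le) (use fin in auto)
  moreover have "card (UNIV::'a set) * card ?U \<le> card (UNIV::'a set) ^ Suc s * card U"
    using card by simp
  ultimately have "card D = card (UNIV::'a set) * card ?U" by linarith
  then have fe: "free_ext ?U D 1"
    unfolding free_ext_def using fin D by (auto intro!: exI[of _ "{c}"])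
  note free = free_ext_1_scalar[OF fe D]
  \<comment> \<open>This is \<open>?U\<close> + Ic; since D is \<open>?U\<close> + Rc, it contains
    ID.\<close>
  let ?M = "{u + smul k c | u k. u \<in> ?U \<and> k \<in> I}"
  have M: "vec.subspace ?M" unfolding vec.subspace_def
  proof (intro conjI ballI allI)
    have "(0::nat \<Rightarrow> 'a) = 0 + smul 0 c" by simp
    then show "0 \<in> ?M" using vec.span_zero maxspecD(1)[OF I] by blast
    fix x y r assume "x \<in> ?M"
    then obtain u k where x: "x = u + smul k c" "u \<in> ?U" "k \<in> I" by blast
    have "smul r x = smul r u + smul (r * k) c" unfolding x by (simp add: vec.scale_right_distrib)
    then show "smul r x \<in> ?M" using x vec.span_scale maxspecD(4)[OF I] by blast
    assume "y \<in> ?M"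
    then obtain u' k' where y: "y = u' + smul k' c" "u' \<in> ?U" "k' \<in> I" by blast
    have "x + y = (u + u') + smul (k + k') c" unfolding x y by (simp add: vec.scale_left_distrib add_ac)
    then show "x + y \<in> ?M" using x y vec.span_add maxspecD(3)[OF I] by blast
  qed
  have "residual D I U \<subseteq> ?M" unfolding residual_def
  proof (rule vec.span_minimal[OF _ M], intro Un_least subsetI)
    fix x assume "x \<in> U"
    then have "x \<in> ?U" by (auto intro: vec.span_base)
    moreover have "x = x + smul 0 c" by simp
    ultimately show "x \<in> ?M" using maxspecD(1)[OF I] by blast
  next
    fix x assume "x \<in> {smul r d |r d. r \<in> I \<and> d \<in> D}"
    then obtain r d where x: "x = smul r d" "r \<in> I" "d \<in> D" by blast
    then obtain k where k: "d - smul k c \<in> ?U" unfolding D mem_span_insert[OF vec.subspace_span] by blast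
    have "x = smul r (d - smul k c) + smul (r * k) c" unfolding x
      by (simp add: vec.scale_right_diff_distrib)
    then show "x \<in> ?M" using k x(2) vec.span_scale[OF k] maxspecD(5)[OF I] by blast
  qed
  then obtain u k where uk: "c = u + smul k c" "u \<in> ?U" "k \<in> I" using cr by blast
  then have "smul (1 - k) c = u" by (simp add: vec.scale_left_diff_distrib) (metis add_diff_cancel_right')
  then have "1 - k = 0" using free uk by blast
  then show False using uk(3) maxspecD(2)[OF I] by simp
qed

text \<open>Since B / A has rank at least 2, two basis vectors \<open>c1\<close> and
  \<open>c2\<close> are independent residually at each I. The vector \<open>e I\<close> cannot lie
  on both residual lines through A, so one of the two is a good choice at I.\<close>

lemma exists_generic_vector:
  fixes A :: "(nat \<Rightarrow> 'a::{comm_ring_1,finite}) set"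
  assumes fe: "free_ext A B r" "r \<ge> 2" and co: "cofree D B"
    and e: "\<And>I. I \<in> maxspec \<Longrightarrow> e I \<notin> residual D I A"
  obtains v where "v \<in> B" "\<And>I. I \<in> maxspec \<Longrightarrow> v \<notin> residual D I A"
    "\<And>I. I \<in> maxspec \<Longrightarrow> e I \<notin> residual D I (vec.span (insert v A))"
proof -
  obtain C where C: "finite C" "card C = r" "B = vec.span (A \<union> C)" using free_ext_basis[OF fe(1)] .
  obtain r' where r': "r = Suc (Suc r')" using fe(2) by (metis Suc_le_D numeral_2_eq_2 Suc_le_mono le_SucE)
  obtain c1 c2 C' where c: "C = insert c1 (insert c2 C')" "finite C'" "card C' = r'" "c1 \<noteq> c2"
    using C r' by (metis card_Suc_eq finite_insert insertI1)
  have su: "vec.subspace A" "finite A" using fe free_ext_subspace free_ext_finite by blast+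
  \<comment> \<open>Stated for any ordering of the first two basis vectors, since it is used with
    both.\<close>
  have two: "c1 \<notin> residual D I (vec.span (insert c2 A))"
    if C: "C = insert c1 (insert c2 C')" and I: "I \<in> maxspec" for c1 c2 I
  proof -
    have B: "B = vec.span (vec.span (insert c2 A) \<union> insert c1 C')"
      unfolding \<open>B = _\<close> C
    proof (rule vec.span_eq[THEN iffD2], intro conjI Un_least)
      have "insert c2 A \<subseteq> vec.span (insert c2 A)" by (rule vec.span_superset)
      then show "A \<subseteq> vec.span (vec.span (insert c2 A) \<union> insert c1 C')"
        "insert c1 (insert c2 C') \<subseteq> vec.span (vec.span (insert c2 A) \<union> insert c1 C')"
        by (intro order_trans[OF _ vec.span_superset]; auto)+
      show "vec.span (insert c2 A) \<subseteq> vec.span (A \<union> insert c1 (insert c2 C'))"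
        by (rule vec.span_mono) auto
      show "insert c1 C' \<subseteq> vec.span (A \<union> insert c1 (insert c2 C'))"
        by (intro order_trans[OF _ vec.span_superset]) auto
    qed
    have "card (insert c1 C') \<le> Suc r'" using c card_insert_le_m1 by (simp add: card_insert_if)
    note s1 = free_ext_split[OF su free_ext_card[OF fe(1), unfolded r'] _ this B]
    have A1: "free_ext (vec.span (insert c2 A)) B (Suc r')" using s1 c by simp
    have B2: "B = vec.span (vec.span (insert c1 (vec.span (insert c2 A))) \<union> C')"
    proof -
      have "vec.span (vec.span (insert c1 (vec.span (insert c2 A))) \<union> C')
        = vec.span (insert c1 (vec.span (insert c2 A)) \<union> C')"
      proof (rule vec.span_eq[THEN iffD2], intro conjI Un_least)
        show "vec.span (insert c1 (vec.span (insert c2 A))) \<subseteq> vec.span (insert c1 (vec.span (insert c2 A)) \<union> C')"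
          by (rule vec.span_mono) auto
        show "C' \<subseteq> vec.span (insert c1 (vec.span (insert c2 A)) \<union> C')"
          "C' \<subseteq> vec.span (vec.span (insert c1 (vec.span (insert c2 A))) \<union> C')"
          by (intro order_trans[OF _ vec.span_superset]; auto)+
        have "insert c1 (vec.span (insert c2 A)) \<subseteq> vec.span (insert c1 (vec.span (insert c2 A)))"
          by (rule vec.span_superset)
        then show "insert c1 (vec.span (insert c2 A)) \<subseteq> vec.span (vec.span (insert c1 (vec.span (insert c2 A))) \<union> C')"
          by (intro order_trans[OF _ vec.span_superset]) auto
      qed
      then show ?thesis using B by simp
    qed
    note s2 = free_ext_split[OF free_ext_subspace(1)[OF A1] free_ext_finite(1)[OF A1] free_ext_card[OF A1]
        c(2) eq_refl[OF c(3)] B2]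
    show ?thesis by (rule residual_free_ext_1[OF I s2(1) cofree_trans[OF s2(2) co]])
  qed
  have CB: "C \<subseteq> B" unfolding C by (auto intro: vec.span_base)
  have BD: "B \<subseteq> D" and D: "vec.subspace D" and B: "vec.subspace B"
    using cofree_subspace[OF co] by auto
  have "\<exists>c\<in>{c1, c2}. c \<notin> residual D I A \<and> e I \<notin> residual D I (vec.span (insert c A))"
    if I: "I \<in> maxspec" for I
  proof -
    have n1: "c1 \<notin> residual D I (vec.span (insert c2 A))" using two[OF c(1) I] .
    have n2: "c2 \<notin> residual D I (vec.span (insert c1 A))" using two[OF _ I, of c2 c1] c(1) by (simp add: insert_commute)
    have sub: "residual D I A \<subseteq> residual D I (vec.span (insert c A))" for c
      by (rule residual_mono) (auto intro: vec.span_base)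
    have m: "c1 \<notin> residual D I A" "c2 \<notin> residual D I A" using n1 n2 sub by blast+
    \<comment> \<open>On both lines, \<open>e I\<close> would yield a multiple of \<open>c1\<close>
      lying residually in A + Rc2 whose scalar is outside I.\<close>
    have False if e1: "e I \<in> residual D I (vec.span (insert c1 A))" and e2: "e I \<in> residual D I (vec.span (insert c2 A))"
    proof -
      obtain k where k: "e I - smul k c1 \<in> residual D I A" using e1 by (auto simp: residual_span_insert)
      have "smul k c1 \<notin> residual D I A"
      proof
        assume "smul k c1 \<in> residual D I A"
        then have "(e I - smul k c1) + smul k c1 \<in> residual D I A" using k by (intro vec.subspace_add) auto
        then show False using e[OF I] by simp
      qed
      then have kI: "k \<notin> I" using residual_smul[of k I c1 D A] CB BD c(1) by blast
      have "e I - (e I - smul k c1) \<in> residual D I (vec.span (insert c2 A))"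
        by (rule vec.subspace_diff[OF residual_subspace e2 subsetD[OF sub k]])
      then have "smul k c1 \<in> residual D I (vec.span (insert c2 A))" by simp
      then show False using residual_scalar[OF I _ n1] kI CB BD c(1) by blast
    qed
    then show ?thesis using m by blast
  qed
  then obtain \<sigma> where \<sigma>: "\<And>I. I \<in> maxspec \<Longrightarrow> \<sigma> I \<in> {c1, c2} \<and> \<sigma> I \<notin> residual D I A \<and>
      e I \<notin> residual D I (vec.span (insert (\<sigma> I) A))" by metis
  obtain x where x: "\<And>I. (I::'a set) \<in> maxspec \<Longrightarrow> 1 - x I \<in> I \<and> (\<forall>J\<in>maxspec. J \<noteq> I \<longrightarrow> x I \<in> J)"
    using maxspec_separating by metis
  \<comment> \<open>The Chinese remainder combination: v agrees with the choice
    \<open>\<sigma> I\<close> modulo ID at every I, and both conditions depend only on v modulo A +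
    ID.\<close>
  define v where "v = (\<Sum>I\<in>maxspec. smul (x I) (\<sigma> I))"
  have \<sigma>B: "\<sigma> I \<in> B" if "I \<in> maxspec" for I using \<sigma>[OF that] CB c(1) by auto
  have vB: "v \<in> B" unfolding v_def using \<sigma>B B by (intro vec.subspace_sum vec.subspace_scale)
  have diff: "v - \<sigma> I \<in> residual D I A" if I: "I \<in> maxspec" for I
  proof -
    have "v = smul (x I) (\<sigma> I) + (\<Sum>J\<in>maxspec - {I}. smul (x J) (\<sigma> J))"
      unfolding v_def using I by (intro sum.remove) auto
    then have "v - \<sigma> I = (\<Sum>J\<in>maxspec - {I}. smul (x J) (\<sigma> J)) - smul (1 - x I) (\<sigma> I)"
      by (simp add: vec.scale_left_diff_distrib)
    also have "\<dots> \<in> residual D I A"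
    proof (intro vec.subspace_diff vec.subspace_sum residual_subspace residual_smul)
      show "1 - x I \<in> I" "\<sigma> I \<in> D" using x[OF I] \<sigma>B[OF I] BD by auto
      fix J :: "'a set" assume "J \<in> maxspec - {I}"
      then show "x J \<in> I" "\<sigma> J \<in> D" using x[of J] I \<sigma>B[of J] BD by auto
    qed
    finally show ?thesis .
  qed
  have "v \<notin> residual D I A" if I: "I \<in> maxspec" for I
  proof
    assume "v \<in> residual D I A"
    from vec.subspace_diff[OF residual_subspace this diff[OF I]]
    have "v - (v - \<sigma> I) \<in> residual D I A" .
    then show False using \<sigma>[OF I] by simp
  qed
  moreover have "e I \<notin> residual D I (vec.span (insert v A))" if I: "I \<in> maxspec" for I
  proof
    assume "e I \<in> residual D I (vec.span (insert v A))"
    then obtain k where k: "e I - smul k v \<in> residual D I A" by (auto simp: residual_span_insert)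
    have "e I - smul k (\<sigma> I) = (e I - smul k v) + smul k (v - \<sigma> I)" by (simp add: vec.scale_right_diff_distrib)
    also have "\<dots> \<in> residual D I A"
      by (rule vec.subspace_add[OF residual_subspace k vec.subspace_scale[OF residual_subspace diff[OF I]]])
    finally have "e I \<in> residual D I (vec.span (insert (\<sigma> I) A))" by (auto simp: residual_span_insert)
    then show False using \<sigma>[OF I] by blast
  qed
  ultimately show ?thesis using that vB by blast
qed

section \<open>Vanishing of homology of intervals\<close>

lemma cofree_span_insert:
  assumes "cofree D W" "v \<in> D" "\<And>I. I \<in> maxspec \<Longrightarrow> v \<notin> residual D I W"
  shows "free_ext W (vec.span (insert v W)) 1" "cofree D (vec.span (insert v W))"
  using assms free_ext_insert_unimodular[of W D _ v] unfolding cofree_def by blast+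

text \<open>A vector \<open>e I\<close> outside \<open>D\<close> imposes no condition at \<open>I\<close>.\<close>
definition avoiding :: "(nat \<Rightarrow> 'a::{comm_ring_1,finite}) set \<Rightarrow> (nat \<Rightarrow> 'a) set \<Rightarrow> (nat \<Rightarrow> 'a) set
    \<Rightarrow> ('a set \<Rightarrow> nat \<Rightarrow> 'a) \<Rightarrow> (nat \<Rightarrow> 'a) set set" where
  "avoiding D A B e = {W. cofree D W \<and> A \<subset> W \<and> W \<subset> B \<and> (\<forall>I\<in>maxspec. e I \<notin> residual D I W)}"

lemma cofree_between_ranks:
  assumes AB: "free_ext A B r" and co: "cofree D B" and W: "cofree D W" "A \<subset> W" "W \<subset> B"
  obtains k l where "k \<ge> 1" "l \<ge> 1" "k + l = r" "free_ext A W k" "free_ext W B l"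
proof -
  have A: "cofree D A" using cofree_trans[OF AB co] .
  obtain k where k: "free_ext A W k" using cofree_free_ext[OF A W(1)] W by blast
  obtain l where l: "free_ext W B l" using cofree_free_ext[OF W(1) co] W by blast
  have "k \<noteq> 0" "l \<noteq> 0" using free_ext_eq_iff[OF k] free_ext_eq_iff[OF l] W by auto
  moreover have "k + l = r" by (rule free_ext_unique[OF free_ext_trans[OF k l] AB])
  ultimately show ?thesis using that[of k l] k l by simp
qed

lemma finite_avoiding:
  assumes "cofree D B" shows "finite (avoiding D A B e)"
proof (rule finite_subset)
  show "avoiding D A B e \<subseteq> Pow B" by (auto simp: avoiding_def)
  show "finite (Pow B)" using cofree_subspace(4)[OF assms] by simp
qed

text \<open>Provides vectors outside any finite module D; as values of \<open>e\<close> they impose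
  no condition.\<close>

lemma infinite_nat_functions: "infinite (UNIV :: (nat \<Rightarrow> 'a::zero_neq_one) set)"
proof -
  have "inj (\<lambda>(n::nat) j. if j = n then 1 else (0::'a))"
  proof (rule injI)
    fix m n :: nat assume "(\<lambda>j. if j = m then 1 else (0::'a)) = (\<lambda>j. if j = n then 1 else 0)"
    from fun_cong[OF this, of m] show "m = n" by (simp split: if_splits)
  qed
  then show ?thesis using finite_imageD infinite_UNIV_nat by (metis finite_subset subset_UNIV)
qed

text \<open>The condition imposed by \<open>e'\<close> on submodules of \<open>W\<close>: avoid \<open>v\<close> where \<open>W\<close> contains it
  residually; otherwise avoid the point where the residual line through \<open>e I\<close> in direction
  \<open>v\<close> meets \<open>W\<close>, if there is one.\<close>
lemma avoiding_link_below:
  assumes D: "cofree D W" and AW: "A \<subseteq> W" and v: "v \<in> D" "\<And>I. I \<in> maxspec \<Longrightarrow> v \<notin> residual D I A"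
    and eA: "\<And>I. I \<in> maxspec \<Longrightarrow> e I \<notin> residual D I (vec.span (insert v A))"
    and eW: "\<And>I. I \<in> maxspec \<Longrightarrow> e I \<notin> residual D I W"
  obtains e' where "\<And>I. I \<in> maxspec \<Longrightarrow> e' I \<notin> residual D I A"
    "\<And>I w. I \<in> maxspec \<Longrightarrow> w \<subseteq> W \<Longrightarrow>
       e' I \<notin> residual D I w \<longleftrightarrow> v \<notin> residual D I w \<and> e I \<notin> residual D I (vec.span (insert v w))"
proof -
  have sD: "vec.subspace D" "finite D" "W \<subseteq> D" using cofree_subspace[OF D] by auto
  obtain z where z: "z \<notin> D" using infinite_nat_functions sD(2) ex_new_if_finite by blast
  have "\<exists>f. f \<notin> residual D I A \<and> (\<forall>w\<subseteq>W. f \<notin> residual D I w \<longleftrightarrow>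
      v \<notin> residual D I w \<and> e I \<notin> residual D I (vec.span (insert v w)))" if I: "I \<in> maxspec" for I
  proof (cases "v \<in> residual D I W")
    case True
    have "e I \<notin> residual D I (vec.span (insert v w))" if "w \<subseteq> W" for w
    proof
      assume "e I \<in> residual D I (vec.span (insert v w))"
      then obtain k where "e I - smul k v \<in> residual D I w" by (auto simp: residual_span_insert)
      then have "e I - smul k v \<in> residual D I W" using residual_mono[OF that] by blast
      from vec.subspace_add[OF residual_subspace this vec.subspace_scale[OF residual_subspace True, of k]]
      show False using eW[OF I] by simp
    qed
    then show ?thesis using v(2)[OF I] by blast
  next
    case vW: False
    show ?thesis
    proof (cases "e I \<in> residual D I (vec.span (insert v W))")
      case True
      then obtain k where k: "e I - smul k v \<in> residual D I W" by (auto simp: residual_span_insert)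
      \<comment> \<open>The meeting point does not depend on the scalar: two scalars that work
        differ by an element of I, because v is not residually in \<open>W\<close>.\<close>
      have eq: "e I - smul k v \<in> residual D I w \<longleftrightarrow> e I \<in> residual D I (vec.span (insert v w))"
        if w: "w \<subseteq> W" for w
      proof
        assume "e I \<in> residual D I (vec.span (insert v w))"
        then obtain l where l: "e I - smul l v \<in> residual D I w" by (auto simp: residual_span_insert)
        then have "e I - smul l v \<in> residual D I W" using residual_mono[OF w] by blast
        from vec.subspace_diff[OF residual_subspace this k]
        have "smul (k - l) v \<in> residual D I W" by (simp add: vec.scale_left_diff_distrib)
        then have "k - l \<in> I" using residual_scalar[OF I v(1) vW] by blast
        then have "smul (k - l) v \<in> residual D I w" using v(1) by (rule residual_smul)
        from vec.subspace_diff[OF residual_subspace l this]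
        show "e I - smul k v \<in> residual D I w" by (simp add: vec.scale_left_diff_distrib)
      qed (auto simp: residual_span_insert)
      have "e I - smul k v \<notin> residual D I A" using eA[OF I] by (auto simp: residual_span_insert)
      moreover have "v \<notin> residual D I w" if "w \<subseteq> W" for w using vW residual_mono[OF that] by blast
      ultimately show ?thesis using eq by blast
    next
      case eW: False
      have "z \<notin> residual D I w" "v \<notin> residual D I w" "e I \<notin> residual D I (vec.span (insert v w))"
        if w: "w \<subseteq> W" for w
      proof -
        show "z \<notin> residual D I w" using residual_subset[OF sD(1), of w I] w sD z by blast
        show "v \<notin> residual D I w" using vW residual_mono[OF w] by blast
        have "vec.span (insert v w) \<subseteq> vec.span (insert v W)" using w by (intro vec.span_mono) auto
        then show "e I \<notin> residual D I (vec.span (insert v w))" using eW residual_mono by blast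
      qed
      then show ?thesis using AW by blast
    qed
  qed
  then show ?thesis using that by metis
qed

text \<open>Carrying along the factor \<open>K\<close>, every element of which is comparable to the whole
  interval, makes a homology computation for joins unnecessary: in the induction step the
  lower half of a link is absorbed into \<open>K\<close>.\<close>
lemma avoiding_acyclic:
  fixes A :: "(nat \<Rightarrow> 'a::{comm_ring_1,finite}) set"
  assumes "free_ext A B r" "cofree D B" "\<And>I. I \<in> maxspec \<Longrightarrow> e I \<notin> residual D I A"
    and "finite K" "\<And>U. U \<in> K \<Longrightarrow> U \<subseteq> A \<or> B \<subseteq> U" "acyclic_below K p"
  shows "acyclic_below (K \<union> avoiding D A B e) (p + r - 1)"
  using assms
proof (induction r arbitrary: A B e K p rule: less_induct)
  case (less r)
  note AB = less.prems(1) and co = less.prems(2) and e = less.prems(3) and K = less.prems(4-6)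
  let ?X = "avoiding D A B e"
  show ?case
  proof (cases "r \<ge> 2")
    \<comment> \<open>Rank at most 1 leaves nothing strictly between A and B, and p + r - 1 is then
      at most p.\<close>
    case False
    have "?X = {}"
    proof (rule ccontr)
      assume "?X \<noteq> {}"
      then obtain W where "cofree D W" "A \<subset> W" "W \<subset> B" by (auto simp: avoiding_def)
      from cofree_between_ranks[OF AB co this] show False using False by auto
    qed
    then show ?thesis using False K(3) by (auto intro: acyclic_below_mono)
  next
    case True
    obtain v where v: "v \<in> B" "\<And>I. I \<in> maxspec \<Longrightarrow> v \<notin> residual D I A"
      "\<And>I. I \<in> maxspec \<Longrightarrow> e I \<notin> residual D I (vec.span (insert v A))"
      using exists_generic_vector[OF AB True co e] by metis
    have sD: "vec.subspace D" "finite D" "B \<subseteq> D" and sB: "vec.subspace B" using cofree_subspace[OF co] by auto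
    have cA: "cofree D A" using cofree_trans[OF AB co] .
    have vD: "v \<in> D" using v sD by blast
    define M where "M = vec.span (insert v A)"
    define Y1 where "Y1 = {W\<in>?X. v \<in> W}"
    \<comment> \<open>The conditions make W + Rv a free extension by v and put it into
      \<open>Y1\<close>.\<close>
    define Y2 where "Y2 = {W\<in>?X. vec.span (insert v W) \<noteq> B \<and> (\<forall>I\<in>maxspec. v \<notin> residual D I W \<and>
        e I \<notin> residual D I (vec.span (insert v W)))}"
    define Z where "Z = ?X - Y1 - Y2"
    have fX: "finite ?X" by (rule finite_avoiding[OF co])
    have fin: "finite Y1" "finite Y2" "finite Z" using fX by (auto simp: Y1_def Y2_def Z_def)
    have X: "?X = Y1 \<union> Y2 \<union> Z" by (auto simp: Y1_def Y2_def Z_def)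
    have subX: "vec.subspace W" if "W \<in> ?X" for W using that cofree_subspace by (auto simp: avoiding_def)
    have KX: "U \<subset> W \<or> W \<subset> U" if "U \<in> K" "W \<in> ?X" for U W
      using K(2)[OF that(1)] that(2) by (auto simp: avoiding_def)
    have feM: "free_ext A M 1" and cM: "cofree D M"
      using cofree_span_insert[OF cA vD v(2)] by (auto simp: M_def)
    have MY: "M \<in> Y1"
    proof -
      have "A \<subset> M" using free_ext_subset[OF feM] free_ext_eq_iff[OF feM] by auto
      moreover have "M \<subseteq> B" unfolding M_def
        using v(1) free_ext_subset[OF AB] sB by (intro vec.span_minimal) auto
      moreover have "M \<noteq> B" using free_ext_unique[OF feM, of r] AB True by auto
      moreover have "v \<in> M" by (auto simp: M_def intro: vec.span_base)
      ultimately show ?thesis using cM v(3) by (auto simp: Y1_def avoiding_def M_def)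
    qed
    have ac1: "acyclic_below (K \<union> Y1) m" for m
    proof (rule acyclic_below_cone_point[of _ M])
      show "finite (K \<union> Y1)" "M \<in> K \<union> Y1" using K fin MY by auto
      fix w assume "w \<in> K \<union> Y1"
      then show "w \<subseteq> M \<or> M \<subseteq> w"
      proof
        assume "w \<in> K" then show ?thesis using KX MY by (auto simp: Y1_def)
      next
        assume w: "w \<in> Y1"
        then have "insert v A \<subseteq> w" "vec.subspace w" using subX by (auto simp: Y1_def avoiding_def)
        then show ?thesis unfolding M_def using vec.span_minimal by blast
      qed
    qed
    have ac2: "acyclic_below (K \<union> Y1 \<union> Y2) m" for m
    \<comment> \<open>Other members of \<open>Y2\<close> above W need not be comparable with W + Rv,
      since they miss v. Adding in increasing order keeps them out of the link, which then has W +
      Rv as a cone point.\<close>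
    proof (rule acyclic_below_add_increasing[OF _ fin(2) ac1])
      show "finite (K \<union> Y1)" using K fin by auto
      fix W assume W: "W \<in> Y2"
      define W' where "W' = vec.span (insert v W)"
      have WX: "W \<in> ?X" using W by (simp add: Y2_def)
      have c': "free_ext W W' 1" "cofree D W'"
        using cofree_span_insert[of D W v] W vD unfolding W'_def Y2_def avoiding_def by auto
      have WW': "W \<subset> W'" using free_ext_subset[OF c'(1)] free_ext_eq_iff[OF c'(1)] by auto
      have "W' \<subseteq> B" unfolding W'_def
        using v(1) WX sB by (intro vec.span_minimal) (auto simp: avoiding_def)
      moreover have "v \<in> W'" by (auto simp: W'_def intro: vec.span_base)
      ultimately have WY: "W' \<in> Y1" using W c'(2) WW' by (auto simp: Y1_def Y2_def avoiding_def W'_def)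
      show "acyclic_below ({w \<in> K \<union> Y1. W \<subset> w} \<union> {w \<in> K \<union> Y1 \<union> Y2. w \<subset> W}) (m - 1)"
      proof (rule acyclic_below_cone_point[of _ W'])
        show "finite ({w \<in> K \<union> Y1. W \<subset> w} \<union> {w \<in> K \<union> Y1 \<union> Y2. w \<subset> W})" using K fin by auto
        show "W' \<in> {w \<in> K \<union> Y1. W \<subset> w} \<union> {w \<in> K \<union> Y1 \<union> Y2. w \<subset> W}" using WW' WY by auto
        fix w assume "w \<in> {w \<in> K \<union> Y1. W \<subset> w} \<union> {w \<in> K \<union> Y1 \<union> Y2. w \<subset> W}"
        then consider "w \<subset> W" | "w \<in> K" | "w \<in> Y1" "W \<subset> w" by blast
        then show "w \<subseteq> W' \<or> W' \<subseteq> w"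
        proof cases
          case 1 then show ?thesis using WW' by blast
        next
          case 2 then show ?thesis using KX[of w W'] WY by (auto simp: Y1_def)
        next
          case 3
          then have "insert v W \<subseteq> w" "vec.subspace w" using subX by (auto simp: Y1_def)
          then show ?thesis unfolding W'_def using vec.span_minimal by blast
        qed
      qed
    qed
    have "acyclic_below (K \<union> Y1 \<union> Y2 \<union> Z) (p + r - 1)"
    proof (rule acyclic_below_add_decreasing[OF _ fin(3) ac2])
      show "finite (K \<union> Y1 \<union> Y2)" using K fin by auto
      fix W assume W: "W \<in> Z"
      then have WX: "W \<in> ?X" and vW: "v \<notin> W" by (auto simp: Z_def Y1_def)
      then have W': "cofree D W" "A \<subset> W" "W \<subset> B" and eW: "\<And>I. I \<in> maxspec \<Longrightarrow> e I \<notin> residual D I W"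
        by (auto simp: avoiding_def)
      obtain k l where kl: "k \<ge> 1" "l \<ge> 1" "k + l = r" "free_ext A W k" "free_ext W B l"
        using cofree_between_ranks[OF AB co W'] .
      
      obtain e' where e': "\<And>I. I \<in> maxspec \<Longrightarrow> e' I \<notin> residual D I A"
        "\<And>I w. I \<in> maxspec \<Longrightarrow> w \<subseteq> W \<Longrightarrow>
          e' I \<notin> residual D I w \<longleftrightarrow> v \<notin> residual D I w \<and> e I \<notin> residual D I (vec.span (insert v w))"
        using avoiding_link_below[OF W'(1) psubset_imp_subset[OF W'(2)] vD v(2) v(3) eW] by metis
      \<comment> \<open>Nothing in \<open>Y1\<close> lies below W, as v is not in W. Conversely, w +
        Rv cannot be all of B: then B / w would have rank 1, with W strictly between.\<close>
      have below: "{w \<in> Y1 \<union> Y2. w \<subset> W} = avoiding D A W e'"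
      proof (intro set_eqI iffI)
        fix w assume w: "w \<in> {w \<in> Y1 \<union> Y2. w \<subset> W}"
        then have "w \<in> Y2" "w \<subset> W" using vW by (auto simp: Y1_def)
        then show "w \<in> avoiding D A W e'" using e'(2)[of _ w] by (auto simp: Y2_def avoiding_def)
      next
        fix w assume "w \<in> avoiding D A W e'"
        then have w: "cofree D w" "A \<subset> w" "w \<subset> W" "\<And>I. I \<in> maxspec \<Longrightarrow> e' I \<notin> residual D I w"
          by (auto simp: avoiding_def)
        have ok: "v \<notin> residual D I w \<and> e I \<notin> residual D I (vec.span (insert v w))" if "I \<in> maxspec" for I
          using e'(2)[OF that, of w] w that by blast
        have "e I \<notin> residual D I w" if "I \<in> maxspec" for I
          using eW[OF that] residual_mono[OF psubset_imp_subset[OF w(3)]] by blast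
        then have "w \<in> ?X" using w W' by (auto simp: avoiding_def)
        moreover have "vec.span (insert v w) \<noteq> B"
        proof
          assume B: "vec.span (insert v w) = B"
          have f1: "free_ext w B 1" using cofree_span_insert[OF w(1) vD] ok B by blast
          from cofree_between_ranks[OF f1 co W'(1) w(3) W'(3)] show False by auto
        qed
        ultimately show "w \<in> {w \<in> Y1 \<union> Y2. w \<subset> W}" using ok w by (auto simp: Y2_def)
      qed
      have above: "{w \<in> ?X. W \<subset> w} = avoiding D W B e"
        using W' by (auto simp: avoiding_def)
      have split: "{w \<in> K \<union> Y1 \<union> Y2. w \<subset> W} \<union> {w \<in> K \<union> Y1 \<union> Y2 \<union> Z. W \<subset> w}
          = (K \<union> avoiding D A W e') \<union> avoiding D W B e"
        unfolding below[symmetric] above[symmetric] X using KX[OF _ WX] by blast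
      \<comment> \<open>The induction hypothesis is used for A and W with the factor
        \<open>K\<close>, then for W and B with the enlarged factor. The bound becomes (p + k - 1) +
        l - 1 = p + r - 2, which is what gluing in W requires.\<close>
      have acK: "acyclic_below (K \<union> avoiding D A W e') (p + k - 1)"
      proof (rule less.IH[OF _ kl(4) W'(1) e'(1) K(1) _ K(3)])
        show "k < r" using kl by simp
        show "U \<subseteq> A \<or> W \<subseteq> U" if "U \<in> K" for U using K(2)[OF that] W'(3) by blast
      qed
      have "acyclic_below ((K \<union> avoiding D A W e') \<union> avoiding D W B e) (p + k - 1 + l - 1)"
      proof (rule less.IH[OF _ kl(5) co eW _ _ acK])
        show "l < r" using kl by simp
        show "finite (K \<union> avoiding D A W e')" using K finite_avoiding[OF W'(1)] by simp
        show "U \<subseteq> W \<or> B \<subseteq> U" if "U \<in> K \<union> avoiding D A W e'" for U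
          using that K(2)[of U] W'(2) by (auto simp: avoiding_def)
      qed
      then show "acyclic_below ({w \<in> K \<union> Y1 \<union> Y2. w \<subset> W} \<union> {w \<in> K \<union> Y1 \<union> Y2 \<union> Z. W \<subset> w}) (p + r - 1 - 1)"
        unfolding split using kl by (auto elim: acyclic_below_mono)
    qed
    then show ?thesis unfolding X by (simp add: Un_assoc)
  qed
qed

section \<open>The Tits complex\<close>

lemma vecs_subspace [simp]: "vec.subspace (vecs n)"
  by (auto simp: vec.subspace_def vecs_def smul_def)

lemma zvec_eq_0: "zvec = 0"
  by (simp add: zvec_def fun_eq_iff)

lemma lincomb_eq_sum: "lincomb k b c = (\<Sum>i<k. smul (c i) (b i))"
proof
  fix j
  have "(\<Sum>i<k. smul (c i) (b i)) j = (\<Sum>i<k. c i * b i j)" for k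
    by (induction k) (auto simp: smul_def)
  then show "lincomb k b c j = (\<Sum>i<k. smul (c i) (b i)) j" by (simp add: lincomb_def)
qed

lemma submodule_iff: "submodule n V \<longleftrightarrow> vec.subspace V \<and> V \<subseteq> vecs n"
  unfolding submodule_def vec.subspace_def zvec_eq_0 smul_def
  by (auto simp: plus_fun_def)

lemma lincomb_diff: "lincomb k b c - lincomb k b c' = lincomb k b (\<lambda>i. c i - c' i)"
  by (simp add: lincomb_eq_sum sum_subtractf vec.scale_left_diff_distrib)

lemma lincomb_in_subspace: "vec.subspace V \<Longrightarrow> (\<And>i. i < k \<Longrightarrow> b i \<in> V) \<Longrightarrow> lincomb k b c \<in> V"
  unfolding lincomb_eq_sum by (intro vec.subspace_sum vec.subspace_scale) auto

lemma card_coefficients: "card (({..<m} \<rightarrow>\<^sub>E UNIV) :: (nat \<Rightarrow> 'a::finite) set) = card (UNIV::'a set) ^ m"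
  by (simp add: card_PiE)

text \<open>Coordinates give a bijection of D with coefficient tuples times V, which yields the
  cardinality in \<open>free_ext\<close>.\<close>

lemma free_extI:
  fixes V :: "(nat \<Rightarrow> 'a::{comm_ring_1,finite}) set"
  assumes V: "vec.subspace V" "finite V" "V \<subseteq> D" and D: "vec.subspace D"
    and w: "\<And>i. i < m \<Longrightarrow> w i \<in> D" "\<And>x. x \<in> D \<Longrightarrow> \<exists>c. \<exists>v\<in>V. x = lincomb m w c + v"
      "\<And>c i. lincomb m w c \<in> V \<Longrightarrow> i < m \<Longrightarrow> c i = 0"
  shows "free_ext V D m"
proof -
  \<comment> \<open>Coefficient functions are made extensional on the first m indices, since
    \<open>lincomb\<close> does not see the other values and each tuple must be counted
    once.\<close>
  let ?E = "({..<m} \<rightarrow>\<^sub>E UNIV) :: (nat \<Rightarrow> 'a) set"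
  let ?f = "\<lambda>(c, v). lincomb m w c + v"
  have "inj_on ?f (?E \<times> V)"
  proof (rule inj_onI, clarify)
    fix c v c' v' assume c: "c \<in> ?E" "c' \<in> ?E" and v: "v \<in> V" "v' \<in> V"
      and eq: "lincomb m w c + v = lincomb m w c' + v'"
    have "lincomb m w (\<lambda>i. c i - c' i) = v' - v"
      using eq unfolding lincomb_diff[symmetric] by (simp add: algebra_simps)
    also have "\<dots> \<in> V" using v V by (intro vec.subspace_diff)
    finally have "c i = c' i" if "i < m" for i using w(3) that by fastforce
    then have "c = c'" using c by (intro PiE_ext[of c _ _ c']) auto
    then show "c = c' \<and> v = v'" using eq by simp
  qed
  moreover have "?f ` (?E \<times> V) = D"
  proof
    show "?f ` (?E \<times> V) \<subseteq> D"
      using V D w(1) by (auto intro!: vec.subspace_add lincomb_in_subspace)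
    show "D \<subseteq> ?f ` (?E \<times> V)"
    proof
      fix x assume "x \<in> D"
      then obtain c v where x: "v \<in> V" "x = lincomb m w c + v" using w(2) by blast
      have "lincomb m w (restrict c {..<m}) = lincomb m w c" by (simp add: lincomb_def)
      then show "x \<in> ?f ` (?E \<times> V)" using x by (intro image_eqI[of _ _ "(restrict c {..<m}, v)"]) auto
    qed
  qed
  ultimately have "card D = card (?E \<times> V)" by (metis card_image)
  then have card: "card D = card (UNIV::'a set) ^ m * card V"
    by (simp add: card_cartesian_product card_coefficients)
  have "D = vec.span (V \<union> w ` {..<m})"
  proof
    show "vec.span (V \<union> w ` {..<m}) \<subseteq> D" using V w(1) D by (intro vec.span_minimal) auto
    show "D \<subseteq> vec.span (V \<union> w ` {..<m})"
    proof
      fix x assume "x \<in> D"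
      then obtain c v where x: "v \<in> V" "x = lincomb m w c + v" using w(2) by blast
      show "x \<in> vec.span (V \<union> w ` {..<m})" unfolding x(2) using x(1)
        by (intro vec.span_add lincomb_in_subspace vec.subspace_span vec.span_base) auto
    qed
  qed
  moreover have "card (w ` {..<m}) \<le> m" using card_image_le[of "{..<m}" w] by simp
  ultimately show ?thesis unfolding free_ext_def using V card by (intro conjI exI[of _ "w ` {..<m}"]) auto
qed

text \<open>Generators give a surjection from coefficient tuples times V onto D; the two finite sets
  have the same size, so it is injective, which is independence modulo V.\<close>

lemma free_extE:
  fixes V :: "(nat \<Rightarrow> 'a::{comm_ring_1,finite}) set"
  assumes fe: "free_ext V D m"
  obtains w where "\<And>i. i < m \<Longrightarrow> w i \<in> D" "\<And>x. x \<in> D \<Longrightarrow> \<exists>c. \<exists>v\<in>V. x = lincomb m w c + v"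
      "\<And>c i. lincomb m w c \<in> V \<Longrightarrow> i < m \<Longrightarrow> c i = 0"
proof -
  obtain C where C: "finite C" "card C = m" "D = vec.span (V \<union> C)" using free_ext_basis[OF fe] .
  have V: "vec.subspace V" "finite V" using fe free_ext_subspace free_ext_finite by blast+
  obtain w where w: "bij_betw w {..<m} C" using C by (metis ex_bij_betw_nat_finite atLeast0LessThan)
  have wD: "w i \<in> D" if "i < m" for i
    using w that unfolding C by (auto simp: bij_betw_def intro!: vec.span_base)
  have surj: "\<exists>c. \<exists>v\<in>V. x = lincomb m w c + v" if xD: "x \<in> D" for x
  proof -
    obtain a \<alpha> where a: "a \<in> V" "x = a + (\<Sum>c\<in>C. smul (\<alpha> c) c)"
      using span_Un_finiteE[OF V(1) C(1)] xD C(3) by metis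
    have "lincomb m w (\<alpha> \<circ> w) = (\<Sum>c\<in>C. smul (\<alpha> c) c)"
      unfolding lincomb_eq_sum using sum.reindex_bij_betw[OF w, of "\<lambda>c. smul (\<alpha> c) c"] by simp
    then show ?thesis using a by (intro exI[of _ "\<alpha> \<circ> w"] bexI[of _ a]) (simp_all add: add.commute)
  qed
  let ?E = "({..<m} \<rightarrow>\<^sub>E UNIV) :: (nat \<Rightarrow> 'a) set"
  let ?f = "\<lambda>(c, v). lincomb m w c + v"
  have res: "lincomb m w (restrict c {..<m}) = lincomb m w c" for c by (simp add: lincomb_def)
  have finE: "finite (?E \<times> V)" using V by (intro finite_cartesian_product finite_PiE) auto
  have sub: "D \<subseteq> ?f ` (?E \<times> V)"
  proof
    fix x assume "x \<in> D"
    then obtain c v where x: "v \<in> V" "x = lincomb m w c + v" using surj by blast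
    then show "x \<in> ?f ` (?E \<times> V)" using res by (intro image_eqI[of _ _ "(restrict c {..<m}, v)"]) auto
  qed
  have "card D = card (?E \<times> V)"
    using free_ext_card[OF fe] by (simp add: card_cartesian_product card_coefficients)
  moreover have "card D \<le> card (?f ` (?E \<times> V))" using sub finE by (intro card_mono) auto
  ultimately have inj: "inj_on ?f (?E \<times> V)"
    using card_image_le[OF finE, of ?f] finE by (intro eq_card_imp_inj_on) auto
  have "c i = 0" if c: "lincomb m w c \<in> V" "i < m" for c i
  proof -
    have 1: "?f (restrict c {..<m}, - lincomb m w c) = ?f (restrict (\<lambda>_. 0) {..<m}, 0)"
      unfolding prod.case res by (simp add: lincomb_eq_sum)
    have 2: "restrict b {..<m} \<in> ?E" for b :: "nat \<Rightarrow> 'a" by (rule restrict_PiE_iff[THEN iffD2]) simp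
    from inj_onD[OF inj 1 SigmaI[OF 2 vec.subspace_neg[OF V(1) c(1)]] SigmaI[OF 2 vec.subspace_0[OF V(1)]]]
    have "restrict c {..<m} = restrict (\<lambda>_. 0) {..<m}" by (rule Pair_inject)
    from fun_cong[OF this, of i] show ?thesis using c by simp
  qed
  then show ?thesis using that wD surj by blast
qed

lemma free_ext_vecs: "free_ext {0} (vecs n :: (nat \<Rightarrow> 'a::{comm_ring_1,finite}) set) n"
proof -
  define b :: "nat \<Rightarrow> nat \<Rightarrow> 'a" where "b i = (\<lambda>j. if j = i then 1 else 0)" for i
  have lc: "lincomb n b c j = (if j < n then c j else 0)" for c j
  proof -
    have "lincomb n b c j = (\<Sum>i<n. if j = i then c i else 0)"
      unfolding lincomb_def b_def by (rule sum.cong) auto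
    then show ?thesis by simp
  qed
  show ?thesis
  proof (rule free_extI[where w = b])
    fix x :: "nat \<Rightarrow> 'a" assume "x \<in> vecs n"
    then have "x = lincomb n b x + 0" by (auto simp: fun_eq_iff lc vecs_def)
    then show "\<exists>c. \<exists>v\<in>{0}. x = lincomb n b c + v" by blast
  next
    fix c i assume "lincomb n b c \<in> {0}" "i < n"
    then show "c i = 0" using lc[of c i] by simp
  next
    show "vec.subspace (vecs n :: (nat \<Rightarrow> 'a) set)" by simp
  qed (auto simp: vecs_def b_def)
qed

lemma finite_vecs: "finite (vecs n :: (nat \<Rightarrow> 'a::{comm_ring_1,finite}) set)"
  by (rule free_ext_finite(2)[OF free_ext_vecs])

lemma quotient_free_iff:
  fixes V :: "(nat \<Rightarrow> 'a::{comm_ring_1,finite}) set"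
  assumes "vec.subspace V" "V \<subseteq> vecs n"
  shows "quotient_free n V \<longleftrightarrow> cofree (vecs n) V"
proof
  assume "quotient_free n V"
  then obtain m w where w: "\<forall>i<m. w i \<in> vecs n"
      "\<forall>x\<in>vecs n. \<exists>c. \<exists>v\<in>V. x = (\<lambda>j. lincomb m w c j + v j)"
      "\<forall>c. lincomb m w c \<in> V \<longrightarrow> (\<forall>i<m. c i = 0)" unfolding quotient_free_def by blast
  have "free_ext V (vecs n) m"
    by (rule free_extI[where w = w])
      (use w assms finite_subset[OF assms(2) finite_vecs] in \<open>auto simp: plus_fun_def\<close>)
  then show "cofree (vecs n) V" by (auto simp: cofree_def)
next
  assume "cofree (vecs n) V"
  then obtain m where "free_ext V (vecs n) m" by (auto simp: cofree_def)
  from free_extE[OF this] obtain w where "\<And>i. i < m \<Longrightarrow> w i \<in> vecs n"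
      "\<And>x. x \<in> vecs n \<Longrightarrow> \<exists>c. \<exists>v\<in>V. x = lincomb m w c + v"
      "\<And>c i. lincomb m w c \<in> V \<Longrightarrow> i < m \<Longrightarrow> c i = 0" by metis
  then show "quotient_free n V" unfolding quotient_free_def
    by (intro exI[of _ m] exI[of _ w]) (auto simp: plus_fun_def)
qed

lemma free_of_rank_iff:
  fixes V :: "(nat \<Rightarrow> 'a::{comm_ring_1,finite}) set"
  assumes "vec.subspace V"
  shows "free_of_rank n V k \<longleftrightarrow> free_ext {0} V k"
proof
  assume "free_of_rank n V k"
  then obtain b where b: "\<forall>i<k. b i \<in> V" "V = {lincomb k b c | c. True}"
      "\<forall>c. lincomb k b c = 0 \<longrightarrow> (\<forall>i<k. c i = 0)" unfolding free_of_rank_def zvec_eq_0 by blast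
  show "free_ext {0} V k"
  proof (rule free_extI[where w = b])
    fix x assume "x \<in> V"
    then obtain c where "x = lincomb k b c" using b(2) by blast
    then have "x = lincomb k b c + 0" by simp
    then show "\<exists>c. \<exists>v\<in>{0}. x = lincomb k b c + v" by blast
  qed (use b(1,3) assms vec.subspace_0[OF assms] in auto)
next
  assume "free_ext {0} V k"
  from free_extE[OF this] obtain w where w: "\<And>i. i < k \<Longrightarrow> w i \<in> V"
      "\<And>x. x \<in> V \<Longrightarrow> \<exists>c. \<exists>v\<in>{0}. x = lincomb k w c + v"
      "\<And>c i. lincomb k w c \<in> {0} \<Longrightarrow> i < k \<Longrightarrow> c i = 0" by metis
  have "V = {lincomb k w c | c. True}"
    using w(1,2) assms lincomb_in_subspace[of V k w] by fastforce
  then show "free_of_rank n V k" unfolding free_of_rank_def zvec_eq_0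
    using w by (intro exI[of _ w]) auto
qed

text \<open>Lifts of a basis of the quotient span a complement.\<close>

lemma cofree_direct_summand:
  fixes V :: "(nat \<Rightarrow> 'a::{comm_ring_1,finite}) set"
  assumes "cofree (vecs n) V" shows "direct_summand n V"
proof -
  obtain m where m: "free_ext V (vecs n) m" using assms by (auto simp: cofree_def)
  from free_extE[OF this] obtain w where w: "\<And>i. i < m \<Longrightarrow> w i \<in> vecs n"
      "\<And>x. x \<in> vecs n \<Longrightarrow> \<exists>c. \<exists>v\<in>V. x = lincomb m w c + v"
      "\<And>c i. lincomb m w c \<in> V \<Longrightarrow> i < m \<Longrightarrow> c i = 0" by metis
  let ?U = "{lincomb m w c | c. True}"
  have V: "vec.subspace V" "V \<subseteq> vecs n" using cofree_subspace[OF assms] by auto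
  have U: "vec.subspace ?U"
  proof (rule vec.subspaceI)
    have "0 = lincomb m w (\<lambda>_. 0)" by (simp add: lincomb_eq_sum)
    then show "0 \<in> ?U" by blast
    fix x y r assume "x \<in> ?U"
    then obtain c where x: "x = lincomb m w c" by blast
    have "smul r x = lincomb m w (\<lambda>i. r * c i)" unfolding x lincomb_eq_sum by (simp add: vec.scale_sum_right)
    then show "smul r x \<in> ?U" by blast
    assume "y \<in> ?U"
    then obtain c' where y: "y = lincomb m w c'" by blast
    have "x + y = lincomb m w (\<lambda>i. c i + c' i)"
      unfolding x y lincomb_eq_sum by (simp add: vec.scale_left_distrib sum.distrib)
    then show "x + y \<in> ?U" by blast
  qed
  have "?U \<subseteq> vecs n" using w(1) by (auto intro!: lincomb_in_subspace)
  moreover have "V \<inter> ?U = {0}"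
  proof
    show "V \<inter> ?U \<subseteq> {0}"
    proof
      fix x assume "x \<in> V \<inter> ?U"
      then obtain c where c: "x = lincomb m w c" "x \<in> V" by blast
      then have "\<forall>i<m. c i = 0" using w(3) by blast
      then show "x \<in> {0}" unfolding c(1) by (simp add: lincomb_eq_sum)
    qed
    show "{0} \<subseteq> V \<inter> ?U" using vec.subspace_0[OF V(1)] vec.subspace_0[OF U] by blast
  qed
  moreover have "\<exists>v\<in>V. \<exists>u\<in>?U. x = (\<lambda>j. v j + u j)" if x: "x \<in> vecs n" for x
  proof -
    obtain c v where "v \<in> V" "x = lincomb m w c + v" using w(2)[OF x] by blast
    then have "x = (\<lambda>j. v j + lincomb m w c j)" by (simp add: plus_fun_def add.commute)
    then show ?thesis using \<open>v \<in> V\<close> by blast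
  qed
  ultimately show ?thesis unfolding direct_summand_def submodule_iff zvec_eq_0 using V U by blast
qed

lemma cofree_rank:
  assumes "cofree (vecs n :: (nat \<Rightarrow> 'a::{comm_ring_1,finite}) set) V"
  obtains k where "k \<le> n" "free_ext {0} V k" "free_ext V (vecs n) (n - k)"
proof -
  obtain s where s: "free_ext V (vecs n) s" using assms by (auto simp: cofree_def)
  have "{0} \<subseteq> V" using vec.subspace_0 cofree_subspace(1)[OF assms] by blast
  from free_ext_cancel[OF free_ext_vecs s this] show ?thesis using that[of "n - s"] s by auto
qed

text \<open>From the quotient alone, cancellation in R^n yields a basis of V of the right size, and
  lifting the quotient basis yields the complement.\<close>

lemma grassmannian_eq:
  assumes "k \<le> n"
  shows "grassmannian n k = {V :: (nat \<Rightarrow> 'a::{comm_ring_1,finite}) set. free_ext V (vecs n) (n - k)}"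
proof (intro set_eqI iffI)
  fix V :: "(nat \<Rightarrow> 'a) set" assume V: "V \<in> grassmannian n k"
  then have s: "vec.subspace V" "V \<subseteq> vecs n"
    by (auto simp: grassmannian_def direct_summand_def submodule_iff)
  have c: "cofree (vecs n) V" "free_ext {0} V k"
    using V quotient_free_iff[OF s] free_of_rank_iff[OF s(1)] by (auto simp: grassmannian_def)
  obtain l where l: "free_ext {0} V l" "free_ext V (vecs n) (n - l)" using cofree_rank[OF c(1)] .
  then show "V \<in> {V. free_ext V (vecs n) (n - k)}" using free_ext_unique[OF l(1) c(2)] by simp
next
  fix V :: "(nat \<Rightarrow> 'a) set" assume "V \<in> {V. free_ext V (vecs n) (n - k)}"
  then have V: "free_ext V (vecs n) (n - k)" by simp
  then have c: "cofree (vecs n) V" by (auto simp: cofree_def)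
  note s = cofree_subspace[OF c]
  obtain l where l: "l \<le> n" "free_ext {0} V l" "free_ext V (vecs n) (n - l)" using cofree_rank[OF c] .
  have "l = k" using free_ext_unique[OF l(3) V] l(1) assms by simp
  then show "V \<in> grassmannian n k"
    using l(2) c cofree_direct_summand[OF c] quotient_free_iff[OF s(1,5)] free_of_rank_iff[OF s(1)]
    by (auto simp: grassmannian_def)
qed

lemma tits_vertices_iff:
  "V \<in> tits_vertices n \<longleftrightarrow> cofree (vecs n) V \<and> {0} \<subset> V \<and> V \<subset> (vecs n :: (nat \<Rightarrow> 'a::{comm_ring_1,finite}) set)"
proof
  assume V: "V \<in> tits_vertices n"
  then have s: "vec.subspace V" "V \<subseteq> vecs n"
    by (auto simp: tits_vertices_def direct_summand_def submodule_iff)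
  then show "cofree (vecs n) V \<and> {0} \<subset> V \<and> V \<subset> vecs n"
    using V quotient_free_iff[OF s] vec.subspace_0[OF s(1)] by (auto simp: tits_vertices_def zvec_eq_0)
next
  assume V: "cofree (vecs n) V \<and> {0} \<subset> V \<and> V \<subset> vecs n"
  then have c: "cofree (vecs n) V" by simp
  note s = cofree_subspace[OF c]
  obtain l where l: "free_ext {0} V l" using cofree_rank[OF c] by metis
  then have "free_mod n V" using free_of_rank_iff[OF s(1)] unfolding free_mod_def by blast
  then show "V \<in> tits_vertices n"
    using V cofree_direct_summand[OF c] quotient_free_iff[OF s(1,5)]
    by (auto simp: tits_vertices_def zvec_eq_0)
qed

text \<open>The chain is cut at a term W comparable with all of F, and the halves are completed in
  the intervals below and above W; the sizes add up as (k - 1) + 1 + (l - 1) = r - 1.\<close>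

lemma chain_extends_to_complete:
  fixes A :: "(nat \<Rightarrow> 'a::{comm_ring_1,finite}) set"
  assumes "free_ext A B r" "r \<ge> 1" "cofree D B" "F \<in> order_complex {W. cofree D W \<and> A \<subset> W \<and> W \<subset> B}"
  shows "\<exists>G. F \<subseteq> G \<and> finite G \<and> G \<in> order_complex {W. cofree D W \<and> A \<subset> W \<and> W \<subset> B} \<and> card G = r - 1"
  using assms
proof (induction r arbitrary: A B F rule: less_induct)
  case (less r)
  note AB = less.prems(1) and co = less.prems(3) and F = less.prems(4)
  let ?T = "\<lambda>A B. {W. cofree D W \<and> A \<subset> W \<and> W \<subset> B}"
  have cA: "cofree D A" using cofree_trans[OF AB co] .
  have sD: "vec.subspace D" "finite D" using cofree_subspace[OF co] by auto
  show ?case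
  proof (cases "r = 1")
    case True
    have "F = {}"
    proof (rule ccontr)
      assume "F \<noteq> {}"
      then obtain W where "cofree D W" "A \<subset> W" "W \<subset> B" using F by (auto simp: order_complex_def)
      from cofree_between_ranks[OF AB co this] show False using True by auto
    qed
    then show ?thesis using True by (intro exI[of _ "{}"]) (auto simp: order_complex_def)
  next
    case False
    then have r2: "r \<ge> 2" using less.prems by simp
    have "\<exists>W\<in>?T A B. \<forall>U\<in>F. U = W \<or> U \<subset> W \<or> W \<subset> U"
    proof (cases "F = {}")
      case True
      \<comment> \<open>An empty chain offers no place to cut, so A + Rv with v in general position
        is taken; the vector z outside D makes the condition on \<open>e\<close> vacuous.\<close>
      obtain z where z: "z \<notin> D" using infinite_nat_functions sD(2) ex_new_if_finite by blast
      have "z \<notin> residual D I A" for I using residual_subset[OF sD(1), of A I] cofree_subspace[OF cA] z by blast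
      then obtain v where v: "v \<in> B" "\<And>I. I \<in> maxspec \<Longrightarrow> v \<notin> residual D I A"
        using exists_generic_vector[OF AB r2 co, of "\<lambda>_. z"] by metis
      let ?W = "vec.span (insert v A)"
      have vD: "v \<in> D" using v cofree_subspace(5)[OF co] by blast
      note W = cofree_span_insert[OF cA vD v(2)]
      have "?W \<subseteq> B" using v(1) free_ext_subset[OF AB] cofree_subspace(1)[OF co] by (intro vec.span_minimal) auto
      moreover have "A \<subset> ?W" using free_ext_subset[OF W(1)] free_ext_eq_iff[OF W(1)] by auto
      moreover have "?W \<noteq> B" using free_ext_unique[OF W(1), of r] AB r2 by auto
      ultimately show ?thesis using True W(2) by blast
    next
      case False
      then obtain W where W: "W \<in> F" by blast
      have "U = W \<or> U \<subset> W \<or> W \<subset> U" if "U \<in> F" for U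
        using F W that unfolding order_complex_def psubset_eq by blast
      moreover have "W \<in> ?T A B" using F W unfolding order_complex_def by blast
      ultimately show ?thesis by (intro bexI[of _ W] ballI)
    qed
    then obtain W where W0: "W \<in> ?T A B" "\<forall>U\<in>F. U = W \<or> U \<subset> W \<or> W \<subset> U" by (rule bexE)
    then have W: "cofree D W" "A \<subset> W" "W \<subset> B" by simp_all
    have FW: "U = W \<or> U \<subset> W \<or> W \<subset> U" if "U \<in> F" for U using W0(2) that by (rule bspec)
    obtain k l where kl: "k \<ge> 1" "l \<ge> 1" "k + l = r" "free_ext A W k" "free_ext W B l"
      using cofree_between_ranks[OF AB co W] .
    have F12: "{U\<in>F. U \<subset> W} \<in> order_complex (?T A W)" "{U\<in>F. W \<subset> U} \<in> order_complex (?T W B)"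
      using F by (auto simp: order_complex_def)
    have kr: "k < r" "l < r" using kl by auto
    obtain G1 where G1: "{U\<in>F. U \<subset> W} \<subseteq> G1" "finite G1" "G1 \<in> order_complex (?T A W)" "card G1 = k - 1"
      using less.IH[OF kr(1) kl(4) kl(1) W(1) F12(1)] by (elim exE conjE)
    obtain G2 where G2: "{U\<in>F. W \<subset> U} \<subseteq> G2" "finite G2" "G2 \<in> order_complex (?T W B)" "card G2 = l - 1"
      using less.IH[OF kr(2) kl(5) kl(2) co F12(2)] by (elim exE conjE)
    let ?G = "insert W (G1 \<union> G2)"
    have sub1: "U \<subset> W" if "U \<in> G1" for U using G1(3) that by (auto simp: order_complex_def)
    have sub2: "W \<subset> U" if "U \<in> G2" for U using G2(3) that by (auto simp: order_complex_def)
    have "F \<subseteq> ?G"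
    proof
      fix U assume U: "U \<in> F"
      from FW[OF U] show "U \<in> ?G"
      proof (elim disjE)
        assume "U \<subset> W" then show ?thesis using U subsetD[OF G1(1), of U] by simp
      next
        assume "W \<subset> U" then show ?thesis using U subsetD[OF G2(1), of U] by simp
      qed simp
    qed
    moreover have "?G \<in> order_complex (?T A B)"
      unfolding order_complex_def
    proof (intro CollectI conjI ballI)
      have "G1 \<subseteq> ?T A W" "G2 \<subseteq> ?T W B" using G1(3) G2(3) by (auto simp: order_complex_def)
      moreover have "?T A W \<subseteq> ?T A B" "?T W B \<subseteq> ?T A B" using W(2,3) by auto
      ultimately show "?G \<subseteq> ?T A B" using W0(1) by (intro insert_subsetI Un_least) (auto dest: subsetD)
      have ch1: "U \<subseteq> V \<or> V \<subseteq> U" if "U \<in> G1" "V \<in> G1" for U V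
        using G1(3) that by (simp add: order_complex_def)
      have ch2: "U \<subseteq> V \<or> V \<subseteq> U" if "U \<in> G2" "V \<in> G2" for U V
        using G2(3) that by (simp add: order_complex_def)
      have ch12: "U \<subseteq> V" if "U \<in> insert W G1" "V \<in> insert W G2" for U V
        using sub1[of U] sub2[of V] that by auto
      fix U V assume "U \<in> ?G" "V \<in> ?G"
      then show "U \<subseteq> V \<or> V \<subseteq> U" using ch1[of U V] ch2[of U V] ch12[of U V] ch12[of V U] by auto
    qed
    moreover have "card ?G = r - 1"
    proof -
      have "G1 \<inter> G2 = {}" "W \<notin> G1 \<union> G2" using sub1 sub2 by blast+
      then show ?thesis using G1 G2 kl by (simp add: card_Un_disjoint)
    qed
    ultimately show ?thesis using G1(2) G2(2) by blast
  qed
qed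

lemma tits_vertices_eq:
  "tits_vertices n = {V :: (nat \<Rightarrow> 'a::{comm_ring_1,finite}) set. cofree (vecs n) V \<and> {0} \<subset> V \<and> V \<subset> vecs n}"
  using tits_vertices_iff by blast

lemma cofree_self: "vec.subspace D \<Longrightarrow> finite D \<Longrightarrow> cofree D D"
  unfolding cofree_def using free_ext_refl by blast

lemma finite_tits_vertices: "finite (tits_vertices n :: (nat \<Rightarrow> 'a::{comm_ring_1,finite}) set set)"
  unfolding tits_vertices_eq by (rule finite_subset[of _ "Pow (vecs n)"]) (auto simp: finite_vecs)

lemma tits_flag_extends:
  fixes \<sigma> :: "(nat \<Rightarrow> 'a::{comm_ring_1,finite}) set set"
  assumes "n \<ge> 1" "\<sigma> \<in> order_complex (tits_vertices n)"
  obtains G where "\<sigma> \<subseteq> G" "G \<in> order_complex (tits_vertices n)" "card G = n - 1" "finite G"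
proof -
  note ext = chain_extends_to_complete[OF free_ext_vecs assms(1) cofree_self[OF vecs_subspace finite_vecs]
      assms(2)[unfolded tits_vertices_eq], folded tits_vertices_eq]
  show ?thesis using ext that by (elim exE conjE)
qed

text \<open>Every chain of vertices extends to a complete flag of vertices, so it is a good
  flag.\<close>

lemma order_complex_tits_vertices:
  assumes "n \<ge> 1"
  shows "order_complex (tits_vertices n) = (tits_simplices n :: (nat \<Rightarrow> 'a::{comm_ring_1,finite}) set set set)"
proof (intro set_eqI iffI)
  fix \<sigma> :: "(nat \<Rightarrow> 'a) set set" assume s: "\<sigma> \<in> order_complex (tits_vertices n)"
  have flag: "is_flag n G" if "G \<in> order_complex (tits_vertices n)" for G :: "(nat \<Rightarrow> 'a) set set"
    using that order_complex_finite[OF finite_tits_vertices that]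
    unfolding is_flag_def order_complex_def tits_vertices_def by blast
  obtain G where "\<sigma> \<subseteq> G" "G \<in> order_complex (tits_vertices n)" "card G = n - 1"
    using tits_flag_extends[OF assms s] .
  then have "good_flag n \<sigma>" unfolding good_flag_def complete_flag_def using flag s by blast
  then show "\<sigma> \<in> tits_simplices n" using s by (auto simp: tits_simplices_def order_complex_def)
qed (auto simp: tits_simplices_def order_complex_def good_flag_def is_flag_def)

text \<open>The empty chain counts and the exponent is the number of vertices, so this is minus the
  reduced Euler characteristic.\<close>

definition euler :: "'b set set \<Rightarrow> int" where
  "euler P = (\<Sum>\<sigma>\<in>order_complex P. (-1) ^ card \<sigma>)"

lemma steinberg_rank_eq_euler:
  assumes n: "n \<ge> 1"
  shows "int (steinberg_rank TYPE('a::{comm_ring_1,finite}) n)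
    = (-1) ^ (n - 1) * euler (tits_vertices n :: (nat \<Rightarrow> 'a) set set)"
proof -
  let ?T = "tits_vertices n :: (nat \<Rightarrow> 'a) set set" let ?D = "vecs n :: (nat \<Rightarrow> 'a) set"
  obtain z where z: "z \<notin> ?D" using infinite_nat_functions finite_vecs ex_new_if_finite by blast
  have zr: "z \<notin> residual ?D I V" if "V \<subseteq> ?D" for I V
    using residual_subset[OF vecs_subspace that] z by blast
  have "avoiding ?D {0} ?D (\<lambda>_. z) = ?T"
    unfolding tits_vertices_eq avoiding_def using zr by blast
  \<comment> \<open>With the empty factor and p = 0 the bound is n - 1, that is, vanishing below the
    top degree n - 2.\<close>
  moreover have "acyclic_below ({} \<union> avoiding ?D {0} ?D (\<lambda>_. z)) (0 + n - 1)"
  proof (rule avoiding_acyclic[OF free_ext_vecs cofree_self[OF vecs_subspace finite_vecs]])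
    show "z \<notin> residual ?D I {0}" for I using free_ext_subset[OF free_ext_vecs] by (rule zr)
    show "acyclic_below {} 0" by (simp add: acyclic_below_def)
  qed auto
  ultimately have ac: "acyclic_below ?T (n - 1)" by simp
  have "card \<sigma> \<le> n - 1" if s: "\<sigma> \<in> order_complex ?T" for \<sigma>
  proof -
    obtain G where "\<sigma> \<subseteq> G" "card G = n - 1" "finite G" using tits_flag_extends[OF n s] .
    then show ?thesis using card_mono by metis
  qed
  from homology_rank_eq_euler[OF finite_tits_vertices this ac] show ?thesis
    unfolding steinberg_rank_def order_complex_tits_vertices[OF n] euler_def .
qed

section \<open>Recursion for the Euler characteristic\<close>

lemma chain_Union_mem:
  assumes "\<sigma> \<in> order_complex P" "finite \<sigma>" "\<sigma> \<noteq> {}" shows "\<Union>\<sigma> \<in> \<sigma>"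
proof -
  obtain m where m: "m \<in> \<sigma>" "\<And>w. w \<in> \<sigma> \<Longrightarrow> m \<subseteq> w \<Longrightarrow> m = w"
    using finite_has_maximal[OF assms(2,3)] by metis
  have "w \<subseteq> m" if "w \<in> \<sigma>" for w
  proof -
    have "w \<subseteq> m \<or> m \<subseteq> w" using assms(1) m(1) that by (simp add: order_complex_def)
    then show ?thesis using m(2)[OF that] by auto
  qed
  then have "\<Union>\<sigma> = m" using m(1) by auto
  then show ?thesis using m by simp
qed

text \<open>The largest term of a nonempty chain is its union, so the fibres of \<open>Union\<close>
  sort the chains. Deleting that term flips the sign; the leading 1 is the empty chain.\<close>

lemma euler_recursion:
  assumes P: "finite P"
  shows "euler P = 1 - (\<Sum>W\<in>P. euler {U\<in>P. U \<subset> W})"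
proof -
  let ?S = "order_complex P"
  have fS: "finite ?S" by (rule finite_order_complex[OF P])
  have e: "{} \<in> ?S" by (simp add: order_complex_def)
  have fib: "{\<sigma>\<in>?S - {{}}. \<Union>\<sigma> = W} = insert W ` order_complex {U\<in>P. U \<subset> W}" if W: "W \<in> P" for W
  proof (intro set_eqI iffI)
    fix \<sigma> assume "\<sigma> \<in> {\<sigma>\<in>?S - {{}}. \<Union>\<sigma> = W}"
    then have s: "\<sigma> \<in> ?S" "\<sigma> \<noteq> {}" "\<Union>\<sigma> = W" by auto
    then have "W \<in> \<sigma>" using chain_Union_mem[OF s(1) order_complex_finite[OF P s(1)] s(2)] by simp
    then have "\<sigma> = insert W (\<sigma> - {W})" by blast
    moreover have "\<sigma> - {W} \<in> order_complex {U\<in>P. U \<subset> W}"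
      using s(1,3) unfolding order_complex_def by blast
    ultimately show "\<sigma> \<in> insert W ` order_complex {U\<in>P. U \<subset> W}" by blast
  next
    fix \<sigma> assume "\<sigma> \<in> insert W ` order_complex {U\<in>P. U \<subset> W}"
    then obtain \<tau> where t: "\<sigma> = insert W \<tau>" "\<tau> \<in> order_complex {U\<in>P. U \<subset> W}" by blast
    have 1: "\<tau> \<subseteq> P" "\<And>U. U \<in> \<tau> \<Longrightarrow> U \<subset> W" using t(2) by (auto simp: order_complex_def)
    then have "\<Union>\<sigma> = W" unfolding t(1) by blast
    moreover have "\<sigma> \<in> ?S" using t 1 W unfolding order_complex_def by blast
    ultimately show "\<sigma> \<in> {\<sigma>\<in>?S - {{}}. \<Union>\<sigma> = W}" using t(1) by blast
  qed
  have contrib: "(\<Sum>\<sigma>\<in>{\<sigma>\<in>?S - {{}}. \<Union>\<sigma> = W}. (-1) ^ card \<sigma>) = - euler {U\<in>P. U \<subset> W}" if W: "W \<in> P" for W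
  proof -
    have notin: "W \<notin> \<tau>" "finite \<tau>" if "\<tau> \<in> order_complex {U\<in>P. U \<subset> W}" for \<tau>
      using that order_complex_finite[OF _ that] P by (auto simp: order_complex_def)
    have "inj_on (insert W) (order_complex {U\<in>P. U \<subset> W})"
      using notin(1) by (intro inj_onI) (metis insert_ident)
    then have "(\<Sum>\<sigma>\<in>{\<sigma>\<in>?S - {{}}. \<Union>\<sigma> = W}. (-1) ^ card \<sigma>)
        = (\<Sum>\<tau>\<in>order_complex {U\<in>P. U \<subset> W}. (-1) ^ card (insert W \<tau>))"
      unfolding fib[OF W] by (simp add: sum.reindex)
    also have "\<dots> = (\<Sum>\<tau>\<in>order_complex {U\<in>P. U \<subset> W}. - ((-1::int) ^ card \<tau>))"
      using notin by (intro sum.cong) auto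
    finally show ?thesis by (simp add: euler_def sum_negf)
  qed
  have "euler P = 1 + (\<Sum>\<sigma>\<in>?S - {{}}. (-1) ^ card \<sigma>)"
    unfolding euler_def using fS e by (simp add: sum.remove)
  also have "(\<Sum>\<sigma>\<in>?S - {{}}. (-1) ^ card \<sigma>) = (\<Sum>W\<in>P. \<Sum>\<sigma>\<in>{\<sigma>\<in>?S - {{}}. \<Union>\<sigma> = W}. (-1::int) ^ card \<sigma>)"
  proof (intro sum.group[symmetric])
    show "Union ` (?S - {{}}) \<subseteq> P"
    proof
      fix W assume "W \<in> Union ` (?S - {{}})"
      then obtain \<sigma> where s: "\<sigma> \<in> ?S" "\<sigma> \<noteq> {}" "W = \<Union>\<sigma>" by blast
      then show "W \<in> P" using chain_Union_mem[OF s(1) order_complex_finite[OF P s(1)] s(2)]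
        unfolding order_complex_def by blast
    qed
  qed (use fS P in auto)
  also have "\<dots> = (\<Sum>W\<in>P. - euler {U\<in>P. U \<subset> W})" by (rule sum.cong[OF refl contrib])
  finally show ?thesis by (simp add: sum_negf)
qed

lemma euler_iso:
  assumes h: "bij_betw h P Q" and mono: "\<And>U V. U \<in> P \<Longrightarrow> V \<in> P \<Longrightarrow> U \<subseteq> V \<longleftrightarrow> h U \<subseteq> h V"
  shows "euler P = euler Q"
proof -
  have inj: "inj_on h P" and Q: "Q = h ` P" using h by (auto simp: bij_betw_def)
  have "order_complex Q = (`) h ` order_complex P"
  proof (intro set_eqI iffI)
    fix \<sigma> assume s: "\<sigma> \<in> order_complex Q"
    let ?\<tau> = "{U\<in>P. h U \<in> \<sigma>}"
    have "\<sigma> = h ` ?\<tau>" using s Q by (auto simp: order_complex_def)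
    moreover have "?\<tau> \<in> order_complex P"
      unfolding order_complex_def
    proof (intro CollectI conjI ballI)
      fix U V assume "U \<in> ?\<tau>" "V \<in> ?\<tau>"
      then show "U \<subseteq> V \<or> V \<subseteq> U" using s mono[of U V] mono[of V U] by (simp add: order_complex_def)
    qed simp
    ultimately show "\<sigma> \<in> (`) h ` order_complex P" by blast
  next
    fix \<sigma> assume "\<sigma> \<in> (`) h ` order_complex P"
    then obtain \<tau> where t: "\<sigma> = h ` \<tau>" "\<tau> \<in> order_complex P" by blast
    then have tP: "\<tau> \<subseteq> P" by (simp add: order_complex_def)
    show "\<sigma> \<in> order_complex Q"
      unfolding order_complex_def t(1)
    proof (intro CollectI conjI ballI)
      show "h ` \<tau> \<subseteq> Q" unfolding Q using tP by (rule image_mono)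
      fix X Y assume "X \<in> h ` \<tau>" "Y \<in> h ` \<tau>"
      then obtain U V where UV: "X = h U" "Y = h V" "U \<in> \<tau>" "V \<in> \<tau>" by blast
      then have "U \<subseteq> V \<or> V \<subseteq> U" using t(2) by (simp add: order_complex_def)
      then show "X \<subseteq> Y \<or> Y \<subseteq> X" using UV mono[of U V] mono[of V U] tP by auto
    qed
  qed
  moreover have "inj_on ((`) h) (order_complex P)"
    using inj_on_image_eq_iff[OF inj] by (auto simp: inj_on_def order_complex_def)
  moreover have "card (h ` \<tau>) = card \<tau>" if "\<tau> \<in> order_complex P" for \<tau>
    using that inj by (intro card_image) (auto simp: order_complex_def intro: inj_on_subset)
  ultimately show ?thesis by (simp add: euler_def sum.reindex)
qed


section \<open>The summands below a fixed summand\<close>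

lemma module_hom_lincomb: "module_hom smul smul (\<lambda>c. lincomb m b c)"
  by unfold_locales
    (auto simp: lincomb_def smul_def fun_eq_iff sum.distrib sum_distrib_left algebra_simps)

lemma free_ext_image_iff:
  fixes U :: "(nat \<Rightarrow> 'a::{comm_ring_1,finite}) set"
  assumes hom: "module_hom smul smul f" and inj: "inj_on f D" and D: "vec.subspace D"
    and U: "vec.subspace U" "finite U" "U \<subseteq> D"
  shows "free_ext (f ` U) (f ` D) s \<longleftrightarrow> free_ext U D s"
proof -
  interpret f: module_hom smul smul f by (rule hom)
  have sU: "vec.subspace (f ` U)" by (rule f.subspace_image[OF U(1)])
  have card: "card (f ` D) = card D" "card (f ` U) = card U"
    using inj U(3) by (auto intro!: card_image inj_on_subset[OF inj])
  have span_eq: "vec.span (f ` U \<union> f ` C) = f ` vec.span (U \<union> C)" for C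
    unfolding image_Un[symmetric] by (rule f.span_image)
  show ?thesis
  proof
    assume "free_ext U D s"
    then obtain C where C: "finite C" "card C \<le> s" "D = vec.span (U \<union> C)"
      and c: "card D = card (UNIV::'a set) ^ s * card U" unfolding free_ext_def by blast
    have "f ` D = vec.span (f ` U \<union> f ` C)" unfolding span_eq using C(3) by simp
    moreover have "card (f ` C) \<le> s" using card_image_le[OF C(1), of f] C(2) by simp
    ultimately show "free_ext (f ` U) (f ` D) s"
      unfolding free_ext_def using sU U(2) C(1) c card by (intro conjI exI[of _ "f ` C"]) auto
  next
    assume fe: "free_ext (f ` U) (f ` D) s"
    obtain C' where C': "finite C'" "card C' = s" "f ` D = vec.span (f ` U \<union> C')" using free_ext_basis[OF fe] .
    have "C' \<subseteq> f ` D" unfolding C' by (auto intro: vec.span_base)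
    then obtain C where C: "C \<subseteq> D" "inj_on f C" "C' = f ` C" by (auto simp: subset_image_inj)
    have sub: "vec.span (U \<union> C) \<subseteq> D" using C U D by (intro vec.span_minimal) auto
    have "f ` D = f ` vec.span (U \<union> C)" using C'(3) C(3) span_eq by simp
    then have "D = vec.span (U \<union> C)" using inj_on_image_eq_iff[OF inj subset_refl sub] by simp
    moreover have "finite C" "card C = s" using C C' by (auto simp: card_image finite_image_iff)
    ultimately show "free_ext U D s"
      unfolding free_ext_def using U free_ext_card[OF fe] card by auto
  qed
qed

text \<open>A basis of W identifies R^m with W and carries the Tits poset of R^m isomorphically onto
  the vertices strictly inside W.\<close>

lemma euler_below:
  fixes W :: "(nat \<Rightarrow> 'a::{comm_ring_1,finite}) set"
  assumes W: "W \<in> tits_vertices n" and m: "free_ext {0} W m"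
  shows "euler {U\<in>tits_vertices n. U \<subset> W} = euler (tits_vertices m :: (nat \<Rightarrow> 'a) set set)"
proof -
  let ?D = "vecs m :: (nat \<Rightarrow> 'a) set"
  obtain b where b: "\<And>i. i < m \<Longrightarrow> b i \<in> W" "\<And>x. x \<in> W \<Longrightarrow> \<exists>c. \<exists>v\<in>{0}. x = lincomb m b c + v"
      "\<And>c i. lincomb m b c \<in> {0} \<Longrightarrow> i < m \<Longrightarrow> c i = 0" using free_extE[OF m] by metis
  define f where "f = lincomb m b"
  have hom: "module_hom smul smul f" using module_hom_lincomb[of m b] by (simp add: f_def)
  interpret f: module_hom smul smul f by (rule hom)
  have cW: "cofree (vecs n) W" using W by (simp add: tits_vertices_iff)
  have sW: "vec.subspace W" using cofree_subspace[OF cW] by simp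
  have inj: "inj_on f ?D"
  proof (rule inj_onI)
    fix c c' assume c: "c \<in> ?D" "c' \<in> ?D" "f c = f c'"
    have "lincomb m b (\<lambda>i. c i - c' i) = 0" using c(3) unfolding lincomb_diff[symmetric] f_def by simp
    then have "c i = c' i" if "i < m" for i using b(3)[of "\<lambda>i. c i - c' i" i] that by simp
    then show "c = c'" using c(1,2) by (auto simp: fun_eq_iff vecs_def) (metis not_le)
  qed
  have img: "f ` ?D = W"
  proof
    show "f ` ?D \<subseteq> W" using b(1) sW by (auto simp: f_def intro: lincomb_in_subspace)
    show "W \<subseteq> f ` ?D"
    proof
      fix x assume "x \<in> W"
      then obtain c where c: "x = lincomb m b c" using b(2) by force
      let ?c = "\<lambda>i. if i < m then c i else 0"
      have "x = f ?c" "?c \<in> ?D" unfolding c by (auto simp: f_def lincomb_def vecs_def)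
      then show "x \<in> f ` ?D" by blast
    qed
  qed
  have f0: "f 0 = 0" by (rule f.zero)
  \<comment> \<open>Free quotient in W and free quotient in R^n are equivalent below W: one
    direction composes with the free quotient of W, the other is cancellation.\<close>
  have cof: "cofree (vecs n) (f ` U) \<longleftrightarrow> cofree ?D U" if U: "vec.subspace U" "U \<subseteq> ?D" for U
  proof -
    have fin: "finite U" using finite_subset[OF U(2) finite_vecs] .
    have "cofree ?D U \<longleftrightarrow> (\<exists>s. free_ext (f ` U) W s)"
      unfolding cofree_def using free_ext_image_iff[OF hom inj vecs_subspace U(1) fin U(2)] img by simp
    also have "\<dots> \<longleftrightarrow> cofree (vecs n) (f ` U)"
      using cofree_trans[OF _ cW] cofree_free_ext[OF _ cW] img U(2) by (metis image_mono)
    finally show ?thesis by simp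
  qed
  have "bij_betw ((`) f) (tits_vertices m) {U\<in>tits_vertices n. U \<subset> W}"
    unfolding bij_betw_def
  proof
    show "inj_on ((`) f) (tits_vertices m)"
    proof (rule inj_onI)
      fix U V assume "U \<in> tits_vertices m" "V \<in> tits_vertices m" "f ` U = f ` V"
      moreover from this have "U \<subseteq> ?D" "V \<subseteq> ?D" by (auto simp: tits_vertices_iff)
      ultimately show "U = V" using inj_on_image_eq_iff[OF inj] by blast
    qed
    show "(`) f ` tits_vertices m = {U\<in>tits_vertices n. U \<subset> W}"
    proof (intro set_eqI iffI)
      fix V assume "V \<in> (`) f ` tits_vertices m"
      then obtain U where U: "V = f ` U" "cofree ?D U" "{0} \<subset> U" "U \<subset> ?D"
        by (auto simp: tits_vertices_iff)
      have UD: "U \<subseteq> ?D" "{0} \<subseteq> ?D" using U by auto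
      have "V \<subset> W"
        using U(1,4) img inj_on_image_eq_iff[OF inj UD(1) subset_refl] by auto
      moreover have "{0} \<subset> V"
      proof -
        have "f ` {0} \<noteq> f ` U" using inj_on_image_eq_iff[OF inj UD(2) UD(1)] U(3) by auto
        moreover have "f ` {0} \<subseteq> f ` U" using U(3) by (intro image_mono) auto
        ultimately show ?thesis using U(1) f0 by auto
      qed
      moreover have "cofree (vecs n) V" using cof[OF cofree_subspace(1)[OF U(2)] UD(1)] U by simp
      moreover have "W \<subset> vecs n" using W by (simp add: tits_vertices_iff)
      ultimately show "V \<in> {U\<in>tits_vertices n. U \<subset> W}" by (auto simp: tits_vertices_iff)
    next
      fix V assume "V \<in> {U\<in>tits_vertices n. U \<subset> W}"
      then have V: "cofree (vecs n) V" "{0} \<subset> V" "V \<subset> W" by (auto simp: tits_vertices_iff)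
      define U where "U = {c\<in>?D. f c \<in> V}"
      have sV: "vec.subspace V" using cofree_subspace[OF V(1)] by simp
      have sU: "vec.subspace U"
        using vec.subspace_inter[OF vecs_subspace[of m] f.subspace_vimage[OF sV]]
        by (simp add: U_def vimage_def Int_def)
      have fU: "f ` U = V" using V(3) img by (auto simp: U_def)
      have UD: "U \<subseteq> ?D" by (auto simp: U_def)
      have "cofree ?D U" using cof[OF sU UD] V(1) fU by simp
      moreover have "{0} \<subset> U" using fU V(2) f0 vec.subspace_0[OF sU] by auto
      moreover have "U \<noteq> ?D" using fU img V(3) by auto
      ultimately have "U \<in> tits_vertices m" using UD by (auto simp: tits_vertices_iff)
      then show "V \<in> (`) f ` tits_vertices m" using fU by blast
    qed
  qed
  moreover have "U \<subseteq> V \<longleftrightarrow> f ` U \<subseteq> f ` V" if "U \<in> tits_vertices m" "V \<in> tits_vertices m" for U V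
  proof -
    have UV: "U \<subseteq> ?D" "V \<subseteq> ?D" using that by (auto simp: tits_vertices_iff)
    have "x \<in> V" if "f ` U \<subseteq> f ` V" "x \<in> U" for x
      using that UV inj_on_image_mem_iff[OF inj _ UV(2), of x] by blast
    then show ?thesis by blast
  qed
  ultimately show ?thesis by (rule euler_iso[symmetric])
qed

lemma tits_vertices_eq_grassmannians:
  "tits_vertices n = (\<Union>m\<in>{1..<n}. grassmannian n m :: (nat \<Rightarrow> 'a::{comm_ring_1,finite}) set set)"
proof (intro set_eqI iffI)
  fix V :: "(nat \<Rightarrow> 'a) set" assume V: "V \<in> tits_vertices n"
  then have c: "cofree (vecs n) V" "{0} \<subset> V" "V \<subset> vecs n" by (auto simp: tits_vertices_iff)
  obtain k where k: "k \<le> n" "free_ext {0} V k" "free_ext V (vecs n) (n - k)" using cofree_rank[OF c(1)] .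
  have "k \<noteq> 0" "n - k \<noteq> 0" using free_ext_eq_iff[OF k(2)] free_ext_eq_iff[OF k(3)] c by auto
  then show "V \<in> (\<Union>m\<in>{1..<n}. grassmannian n m)" using k by (auto simp: grassmannian_eq)
next
  fix V :: "(nat \<Rightarrow> 'a) set" assume "V \<in> (\<Union>m\<in>{1..<n}. grassmannian n m)"
  then obtain m where m: "1 \<le> m" "m < n" "free_ext V (vecs n) (n - m)" by (auto simp: grassmannian_eq)
  then have c: "cofree (vecs n) V" by (auto simp: cofree_def)
  obtain k where k: "k \<le> n" "free_ext {0} V k" "free_ext V (vecs n) (n - k)" using cofree_rank[OF c] .
  have "k = m" using free_ext_unique[OF k(3) m(3)] k(1) m by simp
  then have "{0} \<noteq> V" "V \<noteq> vecs n" using free_ext_eq_iff[OF k(2)] free_ext_eq_iff[OF k(3)] m by auto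
  then show "V \<in> tits_vertices n"
    using c free_ext_subset[OF k(2)] free_ext_subset[OF k(3)] by (auto simp: tits_vertices_iff)
qed

lemma euler_tits_vertices:
  "euler (tits_vertices n :: (nat \<Rightarrow> 'a::{comm_ring_1,finite}) set set)
    = 1 - (\<Sum>m\<in>{1..<n}. int (card (grassmannian n m :: (nat \<Rightarrow> 'a) set set))
        * euler (tits_vertices m :: (nat \<Rightarrow> 'a) set set))"
proof -
  let ?T = "tits_vertices n :: (nat \<Rightarrow> 'a) set set"
  let ?G = "\<lambda>m. grassmannian n m :: (nat \<Rightarrow> 'a) set set"
  have T: "?T = (\<Union>m\<in>{1..<n}. ?G m)" by (rule tits_vertices_eq_grassmannians)
  have fin: "finite (?G m)" if "m \<in> {1..<n}" for m
    using finite_subset[OF _ finite_tits_vertices, of "?G m" n] T that by blast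
  have disj: "?G i \<inter> ?G j = {}" if "i \<in> {1..<n}" "j \<in> {1..<n}" "i \<noteq> j" for i j
  proof (rule ccontr)
    assume "?G i \<inter> ?G j \<noteq> {}"
    then obtain V where "V \<in> ?G i" "V \<in> ?G j" by blast
    then have "n - i = n - j" using that free_ext_unique by (auto simp: grassmannian_eq)
    then show False using that by auto
  qed
  have term_eq: "euler {U\<in>?T. U \<subset> W} = euler (tits_vertices m :: (nat \<Rightarrow> 'a) set set)"
    if m: "m \<in> {1..<n}" and W: "W \<in> ?G m" for m W
  proof (rule euler_below)
    show "W \<in> ?T" using T m W by blast
    have "free_ext W (vecs n) (n - m)" using W m by (simp add: grassmannian_eq)
    moreover from this have "cofree (vecs n) W" by (auto simp: cofree_def)
    then obtain k where "k \<le> n" "free_ext {0} W k" "free_ext W (vecs n) (n - k)" using cofree_rank by metis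
    moreover from calculation have "n - k = n - m" using free_ext_unique by blast
    ultimately show "free_ext {0} W m" using m by (metis atLeastLessThan_iff diff_diff_cancel less_imp_le)
  qed
  have "(\<Sum>W\<in>?T. euler {U\<in>?T. U \<subset> W}) = (\<Sum>m\<in>{1..<n}. \<Sum>W\<in>?G m. euler {U\<in>?T. U \<subset> W})"
    by (subst (1) T, rule sum.UNION_disjoint) (use fin disj in auto)
  also have "\<dots> = (\<Sum>m\<in>{1..<n}. \<Sum>W\<in>?G m. euler (tits_vertices m :: (nat \<Rightarrow> 'a) set set))"
    by (intro sum.cong refl term_eq)
  finally have "(\<Sum>W\<in>?T. euler {U\<in>?T. U \<subset> W})
    = (\<Sum>m\<in>{1..<n}. int (card (?G m)) * euler (tits_vertices m :: (nat \<Rightarrow> 'a) set set))" by simp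
  moreover have "euler ?T = 1 - (\<Sum>W\<in>?T. euler {U\<in>?T. U \<subset> W})"
    by (rule euler_recursion[OF finite_tits_vertices])
  ultimately show ?thesis by (simp only:)
qed

lemma card_grassmannian_0: "card (grassmannian n 0 :: (nat \<Rightarrow> 'a::{comm_ring_1,finite}) set set) = 1"
proof -
  have "grassmannian n 0 = {{0} :: (nat \<Rightarrow> 'a) set}"
  proof (intro set_eqI iffI)
    fix V :: "(nat \<Rightarrow> 'a) set" assume "V \<in> grassmannian n 0"
    then have V: "free_ext V (vecs n) n" by (simp add: grassmannian_eq)
    then have c: "cofree (vecs n) V" by (auto simp: cofree_def)
    obtain k where k: "k \<le> n" "free_ext {0} V k" "free_ext V (vecs n) (n - k)" using cofree_rank[OF c] .
    have "n - k = n" using free_ext_unique[OF k(3) V] .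
    then have "k = 0 \<or> n = 0" using k(1) by auto
    then have "k = 0" using k(1) by auto
    then show "V \<in> {{0}}" using free_ext_eq_iff[OF k(2)] by simp
  qed (use free_ext_vecs in \<open>auto simp: grassmannian_eq\<close>)
  then show ?thesis by simp
qed

theorem theoremD:
  fixes n :: nat
  assumes "n \<ge> 1"
  shows "int (d_seq TYPE('a::{comm_ring_1,finite}) n) =
    (\<Sum>i=1..n. (-1) ^ (i - 1)
        * int (card (grassmannian n (n - i) :: (nat \<Rightarrow> 'a) set set))
        * int (d_seq TYPE('a) (n - i)))"
proof -
  let ?e = "\<lambda>m. euler (tits_vertices m :: (nat \<Rightarrow> 'a) set set)"
  let ?g = "\<lambda>m. int (card (grassmannian n m :: (nat \<Rightarrow> 'a) set set))"
  let ?d = "\<lambda>m. int (d_seq TYPE('a) m)"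
  have d: "?d m = (-1) ^ (m - 1) * ?e m" if "m \<ge> 1" for m
    using steinberg_rank_eq_euler[OF that, where 'a = 'a] that by (simp add: d_seq_def)
  have "(\<Sum>i=1..n. (-1) ^ (i - 1) * ?g (n - i) * ?d (n - i)) = (\<Sum>m\<in>{0..<n}. (-1) ^ (n - m - 1) * ?g m * ?d m)"
    by (rule sum.reindex_bij_witness[of _ "\<lambda>m. n - m" "\<lambda>i. n - i"]) auto
  \<comment> \<open>The term m = 0 is split off: its value comes from the convention
    \<open>d_0 = 1\<close>, while the sign formula \<open>d\<close> holds for m at least 1. It
    matches the constant 1 in the Euler recursion.\<close>
  also have "\<dots> = (-1) ^ (n - 1) + (\<Sum>m\<in>{1..<n}. (-1) ^ (n - m - 1) * ?g m * ?d m)"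
    using assms by (simp add: sum.atLeast_Suc_lessThan card_grassmannian_0 d_seq_def)
  also have "(\<Sum>m\<in>{1..<n}. (-1) ^ (n - m - 1) * ?g m * ?d m) = (\<Sum>m\<in>{1..<n}. (-1) ^ (n - 1) * - (?g m * ?e m))"
  proof (rule sum.cong[OF refl])
    fix m assume m: "m \<in> {1..<n}"
    \<comment> \<open>Here 1 <= m < n, so no subtraction is truncated and n - 2 has the parity
      opposite to n - 1; this is the minus sign of the Euler recursion.\<close>
    have "(-1::int) ^ (n - m - 1) * (-1) ^ (m - 1) = (-1) ^ (n - 2)"
      using m by (simp add: power_add[symmetric] numeral_2_eq_2)
    also have "(-1::int) ^ (n - 2) = - ((-1) ^ (n - 1))"
    proof -
      have "n - 1 = Suc (n - 2)" using m by auto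
      then show ?thesis by simp
    qed
    finally have s: "(-1::int) ^ (n - m - 1) * (-1) ^ (m - 1) = - ((-1) ^ (n - 1))" .
    have "(-1) ^ (n - m - 1) * ?g m * ?d m = ((-1) ^ (n - m - 1) * (-1) ^ (m - 1)) * (?g m * ?e m)"
      using m d[of m] by simp
    then show "(-1) ^ (n - m - 1) * ?g m * ?d m = (-1) ^ (n - 1) * - (?g m * ?e m)"
      unfolding s by simp
  qed
  also have "(-1) ^ (n - 1) + \<dots> = (-1) ^ (n - 1) * ?e n"
    by (subst (2) euler_tits_vertices) (simp add: sum_distrib_left right_diff_distrib sum_negf)
  also have "\<dots> = ?d n" using d[OF assms] by simp
  finally show ?thesis by simp
qed

end
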